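(* There exists $C>0$ such that for every $t\ge0$ and all $a=(x,y,z),\ a'=(x',y',z')\in\mathbb H$, there is a random vector $(X,Y,Z,X',Y',Z')$ with $\mathrm{Law}(X,Y,Z)=\mu^a_t$ and $\mathrm{Law}(X',Y',Z')=\mu^{a'}_t$ such that $$\mathcal W_1(\mu^a_t,\mu^{a'}_t)\le\mathbb E\left[d_{\mathbb H}\big((X,Y,Z),(X',Y',Z')\big)\right]\le C\,d_{\mathbb H}(a,a')$$ and $$X'=X+(x'-x)\ \text{ almost surely},\qquad Y'=Y+(y'-y)\ \text{ almost surely}.$$
   Context: Heisenberg group: $\mathbb H=\mathbb R^3$ with the group law $(x,y,z)\cdot(x',y',z')=\left(x+x',y+y',z+z'+\tfrac12(xy'-yx')\right)$. Left-invariant vector fields: $\mathsf X=\partial_x-\tfrac y2\partial_z$, $\mathsf Y=\partial_y+\tfrac x2\partial_z$. Distance: $d_{\mathbb H}(a,a')=\inf_\gamma\int_0^1|\dot\gamma(t)|_{\mathrm h}\,dt$, the infimum being over horizontal curves $\gamma:[0,1]\to\mathbb H$ from $a$ to $a'$, i.e. absolutely continuous curves with $\dot\gamma(t)\in\mathrm{Vect}(\mathsf X(\gamma(t)),\mathsf Y(\gamma(t)))$ for almost every $t$; $|\cdot|_{\mathrm h}$ is the Euclidean norm on $\mathrm{Vect}(\mathsf X,\mathsf Y)$ making $(\mathsf X,\mathsf Y)$ orthonormal (Carnot–Carathéodory distance). Heisenberg Brownian motion starting in $a\in\mathbb H$: $\mathbf B^a_t=a\cdot\left(B^1_t,B^2_t,\tfrac12\left(\int_0^tB^1_s\,dB^2_s-\int_0^tB^2_s\,dB^1_s\right)\right)$,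 where $B^1,B^2$ are independent standard one-dimensional Brownian motions starting at $0$. Notation: $\mu^a_t=\mathrm{Law}(\mathbf B^a_t)$. $L^1$-Wasserstein distance: $\mathcal W_1(\mu,\nu)=\inf_{\pi\in\Pi(\mu,\nu)}\iint d_{\mathbb H}(u,v)\,d\pi(u,v)$, where $\Pi(\mu,\nu)$ is the set of probability measures on $\mathbb H\times\mathbb H$ with marginals $\mu$ and $\nu$. *)

theory Defs
  imports "HOL-Probability.Probability"
begin

section \<open>The Heisenberg group and its Carnot--Caratheodory distance\<close>

type_synonym heis = "real \<times> real \<times> real"

fun heis_mult :: "heis \<Rightarrow> heis \<Rightarrow> heis" where
  "heis_mult (x, y, z) (x', y', z') = (x + x', y + y', z + z' + (x * y' - y * x') / 2)"

fun X_field :: "heis \<Rightarrow> heis" where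
  "X_field (x, y, z) = (1, 0, - y / 2)"

fun Y_field :: "heis \<Rightarrow> heis" where
  "Y_field (x, y, z) = (0, 1, x / 2)"

text \<open>The norm is meaningful only for tangent vectors \<open>w\<close> in the span of the two fields at \<open>p\<close>;
  the fields are linearly independent at every point, so the coefficients are unique.\<close>

definition horizontal_norm :: "heis \<Rightarrow> heis \<Rightarrow> real" where
  "horizontal_norm p w =
    (THE r. \<exists>u v. w = u *\<^sub>R X_field p + v *\<^sub>R Y_field p \<and> r = sqrt (u\<^sup>2 + v\<^sup>2))"

definition absolutely_continuous_curve :: "real \<Rightarrow> real \<Rightarrow> (real \<Rightarrow> 'a::metric_space) \<Rightarrow> bool" where
  "absolutely_continuous_curve a b \<gamma> \<longleftrightarrow>
    (\<forall>\<epsilon>>0. \<exists>\<delta>>0. \<forall>(n::nat) l r.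
      (\<forall>i<n. a \<le> l i \<and> l i \<le> r i \<and> r i \<le> b) \<and>
      disjoint_family_on (\<lambda>i. {l i<..<r i}) {..<n} \<and>
      (\<Sum>i<n. r i - l i) < \<delta> \<longrightarrow>
      (\<Sum>i<n. dist (\<gamma> (l i)) (\<gamma> (r i))) < \<epsilon>)"

definition horizontal_curve :: "(real \<Rightarrow> heis) \<Rightarrow> bool" where
  "horizontal_curve \<gamma> \<longleftrightarrow>
    absolutely_continuous_curve 0 1 \<gamma> \<and>
    (AE t in lebesgue. t \<in> {0..1} \<longrightarrow>
      \<gamma> differentiable (at t within {0..1}) \<and>
      vector_derivative \<gamma> (at t within {0..1}) \<in> span {X_field (\<gamma> t), Y_field (\<gamma> t)})"

definition horizontal_length :: "(real \<Rightarrow> heis) \<Rightarrow> real" where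
  "horizontal_length \<gamma> =
    (LINT t:{0..1}|lebesgue. horizontal_norm (\<gamma> t) (vector_derivative \<gamma> (at t within {0..1})))"

definition cc_dist :: "heis \<Rightarrow> heis \<Rightarrow> real" where
  "cc_dist a a' =
    (INF \<gamma>\<in>{\<gamma>. horizontal_curve \<gamma> \<and> \<gamma> 0 = a \<and> \<gamma> 1 = a'}. horizontal_length \<gamma>)"

section \<open>The Wasserstein distance\<close>

definition couplings :: "heis measure \<Rightarrow> heis measure \<Rightarrow> (heis \<times> heis) measure set" where
  "couplings \<mu> \<nu> =
    {\<pi>. prob_space \<pi> \<and> sets \<pi> = sets borel \<and> distr \<pi> borel fst = \<mu> \<and> distr \<pi> borel snd = \<nu>}"

definition W1_dist :: "heis measure \<Rightarrow> heis measure \<Rightarrow> ennreal" where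
  "W1_dist \<mu> \<nu> = (INF \<pi>\<in>couplings \<mu> \<nu>. \<integral>\<^sup>+ p. ennreal (cc_dist (fst p) (snd p)) \<partial>\<pi>)"

section \<open>Brownian motion\<close>

text \<open>Processes are functions of a real time, of which only the values at nonnegative times matter.\<close>

definition standard_brownian_motion :: "'w measure \<Rightarrow> (real \<Rightarrow> 'w \<Rightarrow> real) \<Rightarrow> bool" where
  "standard_brownian_motion M B \<longleftrightarrow>
    prob_space M \<and>
    (\<forall>t\<ge>0. B t \<in> borel_measurable M) \<and>
    (AE \<omega> in M. B 0 \<omega> = 0) \<and>
    (\<forall>\<tau>::nat \<Rightarrow> real. 0 \<le> \<tau> 0 \<longrightarrow> mono \<tau> \<longrightarrow>
      prob_space.indep_vars M (\<lambda>_. borel) (\<lambda>i \<omega>. B (\<tau> (Suc i)) \<omega> - B (\<tau> i) \<omega>) UNIV) \<and>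
    (\<forall>s t. 0 \<le> s \<longrightarrow> s < t \<longrightarrow>
      distributed M lborel (\<lambda>\<omega>. B t \<omega> - B s \<omega>) (normal_density 0 (sqrt (t - s)))) \<and>
    (AE \<omega> in M. continuous_on {0..} (\<lambda>t. B t \<omega>))"

definition independent_brownian_motions ::
  "'w measure \<Rightarrow> (real \<Rightarrow> 'w \<Rightarrow> real) \<Rightarrow> (real \<Rightarrow> 'w \<Rightarrow> real) \<Rightarrow> bool" where
  "independent_brownian_motions M B1 B2 \<longleftrightarrow>
    standard_brownian_motion M B1 \<and> standard_brownian_motion M B2 \<and>
    prob_space.indep_var M
      (PiM {0..} (\<lambda>_. borel)) (\<lambda>\<omega>. \<lambda>t\<in>{0..}. B1 t \<omega>)
      (PiM {0..} (\<lambda>_. borel)) (\<lambda>\<omega>. \<lambda>t\<in>{0..}. B2 t \<omega>)"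

definition natural_filtration ::
  "'w measure \<Rightarrow> (real \<Rightarrow> 'w \<Rightarrow> real) \<Rightarrow> (real \<Rightarrow> 'w \<Rightarrow> real) \<Rightarrow> real \<Rightarrow> 'w measure" where
  "natural_filtration M B1 B2 t =
    vimage_algebra (space M) (\<lambda>\<omega>. \<lambda>s\<in>{0..t}. (B1 s \<omega>, B2 s \<omega>)) (PiM {0..t} (\<lambda>_. borel))"

section \<open>The Ito integral\<close>

text \<open>A triple \<open>(n, s, \<xi>)\<close> stands for the step process that equals \<open>\<xi> i\<close> on the time
  interval from \<open>s i\<close> (excluded) to \<open>s (i + 1)\<close> (included), for \<open>i < n\<close>, and vanishes
  elsewhere.\<close>

type_synonym 'w step_process = "nat \<times> (nat \<Rightarrow> real) \<times> (nat \<Rightarrow> 'w \<Rightarrow> real)"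

fun elementary_process :: "'w measure \<Rightarrow> (real \<Rightarrow> 'w measure) \<Rightarrow> real \<Rightarrow> 'w step_process \<Rightarrow> bool" where
  "elementary_process M F T (n, s, \<xi>) \<longleftrightarrow>
    0 \<le> s 0 \<and> s n \<le> T \<and> (\<forall>i<n. s i \<le> s (Suc i)) \<and>
    (\<forall>i<n. \<xi> i \<in> borel_measurable (F (s i)) \<and> integrable M (\<lambda>\<omega>. (\<xi> i \<omega>)\<^sup>2))"

fun step_value :: "'w step_process \<Rightarrow> real \<Rightarrow> 'w \<Rightarrow> real" where
  "step_value (n, s, \<xi>) r \<omega> = (\<Sum>i<n. \<xi> i \<omega> * indicator {s i<..s (Suc i)} r)"

fun step_integral :: "'w step_process \<Rightarrow> (real \<Rightarrow> 'w \<Rightarrow> real) \<Rightarrow> 'w \<Rightarrow> real" where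
  "step_integral (n, s, \<xi>) B \<omega> = (\<Sum>i<n. \<xi> i \<omega> * (B (s (Suc i)) \<omega> - B (s i) \<omega>))"

text \<open>\<open>has_ito_integral M F H B T I\<close>: the random variable \<open>I\<close> is a version of the stochastic
  integral of \<open>H\<close> against \<open>B\<close> over the time interval from \<open>0\<close> to \<open>T\<close>, i.e. the mean-square limit
  of the integrals of elementary processes that converge to \<open>H\<close> in mean square.\<close>

definition has_ito_integral ::
  "'w measure \<Rightarrow> (real \<Rightarrow> 'w measure) \<Rightarrow> (real \<Rightarrow> 'w \<Rightarrow> real) \<Rightarrow> (real \<Rightarrow> 'w \<Rightarrow> real) \<Rightarrow> real
    \<Rightarrow> ('w \<Rightarrow> real) \<Rightarrow> bool" where
  "has_ito_integral M F H B T I \<longleftrightarrow>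
    I \<in> borel_measurable M \<and>
    (\<exists>\<phi>::nat \<Rightarrow> 'w step_process.
      (\<forall>k. elementary_process M F T (\<phi> k)) \<and>
      (\<lambda>k. \<integral>\<^sup>+ \<omega>. (\<integral>\<^sup>+ r\<in>{0..T}. ennreal ((step_value (\<phi> k) r \<omega> - H r \<omega>)\<^sup>2) \<partial>lborel) \<partial>M)
        \<longlonglongrightarrow> 0 \<and>
      (\<lambda>k. \<integral>\<^sup>+ \<omega>. ennreal ((step_integral (\<phi> k) B \<omega> - I \<omega>)\<^sup>2) \<partial>M) \<longlonglongrightarrow> 0)"

text \<open>The integral is determined only up to almost sure equality, which does not affect laws.\<close>

definition ito_integral ::
  "'w measure \<Rightarrow> (real \<Rightarrow> 'w measure) \<Rightarrow> (real \<Rightarrow> 'w \<Rightarrow> real) \<Rightarrow> (real \<Rightarrow> 'w \<Rightarrow> real) \<Rightarrow> real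
    \<Rightarrow> 'w \<Rightarrow> real" where
  "ito_integral M F H B T = (SOME I. has_ito_integral M F H B T I)"

section \<open>Heisenberg Brownian motion\<close>

definition levy_area ::
  "'w measure \<Rightarrow> (real \<Rightarrow> 'w \<Rightarrow> real) \<Rightarrow> (real \<Rightarrow> 'w \<Rightarrow> real) \<Rightarrow> real \<Rightarrow> 'w \<Rightarrow> real" where
  "levy_area M B1 B2 t \<omega> =
    (ito_integral M (natural_filtration M B1 B2) B1 B2 t \<omega>
      - ito_integral M (natural_filtration M B1 B2) B2 B1 t \<omega>) / 2"

definition heis_brownian_motion ::
  "'w measure \<Rightarrow> (real \<Rightarrow> 'w \<Rightarrow> real) \<Rightarrow> (real \<Rightarrow> 'w \<Rightarrow> real) \<Rightarrow> heis \<Rightarrow> real \<Rightarrow> 'w \<Rightarrow> heis" where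
  "heis_brownian_motion M B1 B2 a t \<omega> = heis_mult a (B1 t \<omega>, B2 t \<omega>, levy_area M B1 B2 t \<omega>)"

definition heis_law ::
  "'w measure \<Rightarrow> (real \<Rightarrow> 'w \<Rightarrow> real) \<Rightarrow> (real \<Rightarrow> 'w \<Rightarrow> real) \<Rightarrow> heis \<Rightarrow> real \<Rightarrow> heis measure" where
  "heis_law M B1 B2 a t = distr M borel (heis_brownian_motion M B1 B2 a t)"

end

theory Submission
  imports Defs
begin

text \<open>The Carnot--Caratheodory distance is comparable to the gauge
  \<open>\<bar>x'-x\<bar> + \<bar>y'-y\<bar> + sqrt \<bar>z'-z-(x y'-y x')/2\<bar>\<close>. If both Brownian motions use the same planar endpoint
  \<open>(b\<^sub>1, b\<^sub>2)\<close>, with Levy areas \<open>A\<close> and \<open>A'\<close>, the gauge between the endpoints has the planar part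
  \<open>(p, q) = (x'-x, y'-y)\<close> and the vertical part \<open>r + (A' - A) + h\<close>, where \<open>r\<close> is the vertical part at time
  \<open>0\<close> and \<open>h = p b\<^sub>2 - q b\<^sub>1\<close>. So \<open>A' = A - h\<close> would be ideal.

  Remove from the path of \<open>B\<^sup>2\<close> its component along the tent function on \<open>{0..t}\<close>. The coefficient of
  this component is, up to scaling, a standard Gaussian \<open>g\<close> independent of the first path, of the rest of
  the second path, and in particular of \<open>(b\<^sub>1, b\<^sub>2)\<close>; the area is \<open>A = R + L g\<close> with \<open>R\<close>, \<open>L\<close> independent of
  \<open>g\<close> and \<open>L\<close> Gaussian. Now keep everything except \<open>g\<close>, and couple \<open>g\<close> with a standard Gaussian \<open>g'\<close> such
  that \<open>g' = g - h/L\<close> outside an event of conditional probability at most a multiple of \<open>\<bar>h/L\<bar>\<close>, on which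
  \<open>g' = -g\<close>. The expected square root of the vertical part is then at most
  \<open>sqrt \<bar>r\<bar> + C E [\<bar>h\<bar> / sqrt \<bar>L\<bar>]\<close>, and the last term is of order \<open>\<bar>p\<bar> + \<bar>q\<bar>\<close>.\<close>

section \<open>Curves and the gauge\<close>

text \<open>Driving both processes by the same planar path gives \<open>A' = A\<close> and the
  vertical part r + h. Already for r = 0 its expected square root is of order sqrt ((\<bar>p\<bar> +
  \<bar>q\<bar>) * sqrt t), which no fixed multiple of \<bar>p\<bar> + \<bar>q\<bar> bounds. An
  error of the full size t of the area costs sqrt t, but if it occurs only with probability of order
  \<bar>h\<bar> / t, the cost becomes linear in h. The tent serves because it vanishes at both ends
  of the time interval: its coefficient can change without moving the planar endpoint, hence h. The
  area is bilinear in the two paths, so it is affine in g. The obstacle is that the area is an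
  arbitrary version of a mean-square limit, not a function of the paths. It is first identified with
  the almost sure limit of dyadic sums, for which the affine dependence on g is plain algebra. In
  general h and L are dependent, as both involve the first path; Young's inequality separates them.
  The dyadic approximations of L are centred Gaussians of standard deviation at least t/8, which
  gives a finite negative moment of L.\<close>

lemma absolutely_continuous_curveD_finite:
  assumes "absolutely_continuous_curve a b F" "\<epsilon> > 0"
  obtains \<delta> where "\<delta> > 0"
    "\<And>(I :: 'i set) l r. finite I \<Longrightarrow> (\<And>i. i \<in> I \<Longrightarrow> a \<le> l i \<and> l i \<le> r i \<and> r i \<le> b) \<Longrightarrow>
      disjoint_family_on (\<lambda>i. {l i<..<r i}) I \<Longrightarrow> (\<Sum>i\<in>I. r i - l i) < \<delta> \<Longrightarrow>
      (\<Sum>i\<in>I. dist (F (l i)) (F (r i))) < \<epsilon>"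
proof -
  obtain \<delta> where \<delta>: "\<delta> > 0" "\<forall>(n::nat) l r. (\<forall>i<n. a \<le> l i \<and> l i \<le> r i \<and> r i \<le> b) \<and>
      disjoint_family_on (\<lambda>i. {l i<..<r i}) {..<n} \<and>
      (\<Sum>i<n. r i - l i) < \<delta> \<longrightarrow> (\<Sum>i<n. dist (F (l i)) (F (r i))) < \<epsilon>"
    using assms unfolding absolutely_continuous_curve_def by blast
  show thesis
  proof (rule that[OF \<delta>(1)])
    fix I :: "'i set" and l r :: "'i \<Rightarrow> real"
    assume fin: "finite I" and lr: "\<And>i. i \<in> I \<Longrightarrow> a \<le> l i \<and> l i \<le> r i \<and> r i \<le> b"
      and dj: "disjoint_family_on (\<lambda>i. {l i<..<r i}) I" and s: "(\<Sum>i\<in>I. r i - l i) < \<delta>"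
    \<comment> \<open>The definition numbers the intervals by \<open>{..<n}\<close>, while divisions
      are sets of intervals; an enumeration of \<open>I\<close> mediates.\<close>
    obtain h where h: "bij_betw h {0..<card I} I" using ex_bij_betw_nat_finite[OF fin] by blast
    then have h: "bij_betw h {..<card I} I" by (simp add: atLeast0LessThan)
    have re: "(\<Sum>i\<in>I. u i) = (\<Sum>j<card I. u (h j))" for u :: "'i \<Rightarrow> real"
      using sum.reindex_bij_betw[OF h, of u] by simp
    have hI: "h j \<in> I" if "j < card I" for j using h that by (auto simp: bij_betw_def)
    have "(\<Sum>j<card I. dist (F (l (h j))) (F (r (h j)))) < \<epsilon>"
    proof (rule \<delta>(2)[rule_format], intro conjI)
      show "\<forall>i<card I. a \<le> l (h i) \<and> l (h i) \<le> r (h i) \<and> r (h i) \<le> b"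
        using lr hI by blast
      show "disjoint_family_on (\<lambda>i. {l (h i)<..<r (h i)}) {..<card I}"
        using dj hI bij_betw_imp_inj_on[OF h] unfolding disjoint_family_on_def inj_on_def
        by (metis lessThan_iff)
      show "(\<Sum>i<card I. r (h i) - l (h i)) < \<delta>" using s re[of "\<lambda>i. r i - l i"] by simp
    qed
    then show "(\<Sum>i\<in>I. dist (F (l i)) (F (r i))) < \<epsilon>" by (simp add: re)
  qed
qed

lemma tagged_division_real_memD:
  fixes a b :: real
  assumes "p tagged_division_of {a..b}" "(x, K) \<in> p"
  shows "K = {Inf K..Sup K}" "Inf K \<le> Sup K" "a \<le> Inf K" "Sup K \<le> b" "x \<in> K" "x \<in> {a..b}"
    "measure lborel K = Sup K - Inf K"
proof -
  have x: "x \<in> K" "K \<subseteq> {a..b}" using tagged_division_ofD(2,3)[OF assms] by auto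
  obtain u v where "K = cbox u v" using tagged_division_ofD(4)[OF assms] by auto
  then have K: "K = {u..v}" "u \<le> v" using x by auto
  then show "K = {Inf K..Sup K}" "Inf K \<le> Sup K" "a \<le> Inf K" "Sup K \<le> b" "x \<in> K" "x \<in> {a..b}"
     "measure lborel K = Sup K - Inf K"
    using x by auto
qed

text \<open>The Henstock--Kurzweil gauge handles the exceptional null set: tags in it only see
  intervals of small total length, on which absolute continuity controls the increments.\<close>

theorem absolutely_continuous_curve_FTC:
  fixes F :: "real \<Rightarrow> 'a::euclidean_space"
  assumes ac: "absolutely_continuous_curve a b F" and ab: "a \<le> b" and N: "negligible N"
    and der: "\<And>x. x \<in> {a..b} - N \<Longrightarrow> (F has_vector_derivative f x) (at x within {a..b})"
  shows "(f has_integral F b - F a) {a..b}"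
proof -
  \<comment> \<open>On \<open>N\<close> the function \<open>f\<close> is arbitrary. With the value 0
    there, a tag in \<open>N\<close> contributes only the increment of \<open>F\<close> over its
    interval.\<close>
  define g where "g = (\<lambda>x. if x \<in> N then 0 else f x)"
  have "(g has_integral F b - F a) {a..b}"
    unfolding has_integral_real
  proof (intro allI impI)
    fix e :: real assume e: "e > 0"
    define e2 where "e2 = e / 2 / (b - a + 1)"
    have e2: "e2 > 0" using e ab by (simp add: e2_def)
    obtain \<delta> where \<delta>: "\<delta> > 0"
      "\<And>(I :: (real \<times> real set) set) l r. finite I \<Longrightarrow> (\<And>i. i \<in> I \<Longrightarrow> a \<le> l i \<and> l i \<le> r i \<and> r i \<le> b) \<Longrightarrow>
      disjoint_family_on (\<lambda>i. {l i<..<r i}) I \<Longrightarrow> (\<Sum>i\<in>I. r i - l i) < \<delta> \<Longrightarrow>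
      (\<Sum>i\<in>I. dist (F (l i)) (F (r i))) < e/2"
      using absolutely_continuous_curveD_finite[OF ac, of "e/2", where 'i="real \<times> real set"] e half_gt_zero by blast
    have Nnull: "N \<in> null_sets lebesgue" using N negligible_iff_null_sets by blast
    obtain T where T: "open T" "N \<subseteq> T" "T - N \<in> lmeasurable" "emeasure lebesgue (T - N) < ennreal \<delta>"
      using sets_lebesgue_outer_open[of N \<delta>] Nnull \<delta>(1) by (auto simp: null_sets_def)
    have Tm: "emeasure lebesgue T < ennreal \<delta>"
      using T(4) emeasure_Diff_null_set[OF Nnull, of T] T(1) by auto
    have "\<exists>d>0. (x \<in> N \<longrightarrow> ball x d \<subseteq> T) \<and> (x \<in> {a..b} - N \<longrightarrow>
       (\<forall>y\<in>{a..b}. \<bar>y - x\<bar> < d \<longrightarrow> norm (F y - F x - (y - x) *\<^sub>R f x) \<le> e2 * \<bar>y - x\<bar>))" for x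
    proof (cases "x \<in> N")
      case True
      then show ?thesis using T(1,2) open_contains_ball by (metis DiffD2 subsetD)
    next
      case False
      show ?thesis
      proof (cases "x \<in> {a..b}")
        case True
        with False der[of x] e2 show ?thesis
          unfolding has_vector_derivative_def has_derivative_within_alt by auto
      next
        case out: False
        with False show ?thesis by (auto intro: exI[of _ 1])
      qed
    qed
    then obtain d where d: "\<And>x. d x > 0" "\<And>x. x \<in> N \<Longrightarrow> ball x (d x) \<subseteq> T"
      "\<And>x y. x \<in> {a..b} - N \<Longrightarrow> y \<in> {a..b} \<Longrightarrow> \<bar>y - x\<bar> < d x \<Longrightarrow>
        norm (F y - F x - (y - x) *\<^sub>R f x) \<le> e2 * \<bar>y - x\<bar>"
      by metis
    show "\<exists>\<gamma>. gauge \<gamma> \<and> (\<forall>p. p tagged_division_of {a..b} \<and> \<gamma> fine p \<longrightarrow>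
        norm ((\<Sum>(x,K)\<in>p. measure lborel K *\<^sub>R g x) - (F b - F a)) < e)"
    proof (intro exI[of _ "\<lambda>x. ball x (d x)"] conjI allI impI)
      show "gauge (\<lambda>x. ball x (d x))" using d(1) by (simp add: gauge_ball_dependent)
      fix p assume "p tagged_division_of {a..b} \<and> (\<lambda>x. ball x (d x)) fine p"
      then have p: "p tagged_division_of {a..b}" and fine: "\<And>x K. (x,K) \<in> p \<Longrightarrow> K \<subseteq> ball x (d x)"
        unfolding fine_def by blast+
      have fin: "finite p" using p by blast
      note K = tagged_division_real_memD[OF p]
      define p1 where "p1 = {(x,K)\<in>p. x \<in> N}"
      define p2 where "p2 = {(x,K)\<in>p. x \<notin> N}"
      have p12: "p = p1 \<union> p2" "p1 \<inter> p2 = {}" "finite p1" "finite p2" "p1 \<subseteq> p" "p2 \<subseteq> p"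
        using fin by (auto simp: p1_def p2_def intro: finite_subset[OF _ fin])
      let ?h = "\<lambda>(x,K). norm (measure lborel K *\<^sub>R g x - (F (Sup K) - F (Inf K)))"
      have Kp: "a \<le> Inf (snd i)" "Inf (snd i) \<le> Sup (snd i)" "Sup (snd i) \<le> b" if "i \<in> p1" for i
        using K(2-4)[of "fst i" "snd i"] that p12(5) by auto
      have dj: "disjoint_family_on (\<lambda>i. {Inf (snd i)<..<Sup (snd i)}) p"
        unfolding disjoint_family_on_def
      proof (intro ballI impI)
        fix i j assume ij: "i \<in> p" "j \<in> p" "i \<noteq> j"
        obtain x K1 y K2 where [simp]: "i = (x,K1)" "j = (y,K2)" by fastforce
        have "interior K1 \<inter> interior K2 = {}" using tagged_division_ofD(5)[OF p, of x K1 y K2] ij by auto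
        moreover have "interior K1 = {Inf K1<..<Sup K1}" "interior K2 = {Inf K2<..<Sup K2}"
          using K(1)[of x K1] K(1)[of y K2] ij interior_atLeastAtMost_real[of "Inf K1" "Sup K1"]
            interior_atLeastAtMost_real[of "Inf K2" "Sup K2"] by simp_all
        ultimately show "{Inf (snd i)<..<Sup (snd i)} \<inter> {Inf (snd j)<..<Sup (snd j)} = {}" by simp
      qed
      have "sum ?h p1 = (\<Sum>i\<in>p1. dist (F (Inf (snd i))) (F (Sup (snd i))))"
        by (intro sum.cong) (auto simp: p1_def g_def dist_norm norm_minus_commute)
      also have "\<dots> < e/2"
      proof (rule \<delta>(2))
        show "finite p1" by fact
        show "a \<le> Inf (snd i) \<and> Inf (snd i) \<le> Sup (snd i) \<and> Sup (snd i) \<le> b" if "i \<in> p1" for i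
          using Kp[OF that] by auto
        show dj1: "disjoint_family_on (\<lambda>i. {Inf (snd i)<..<Sup (snd i)}) p1"
          using dj p12(5) by (rule disjoint_family_on_mono[rotated])
        have "ennreal (\<Sum>i\<in>p1. Sup (snd i) - Inf (snd i)) = (\<Sum>i\<in>p1. ennreal (Sup (snd i) - Inf (snd i)))"
          using Kp by (intro sum_ennreal[symmetric]) auto
        also have "\<dots> = (\<Sum>i\<in>p1. emeasure lebesgue {Inf (snd i)<..<Sup (snd i)})"
          using Kp by (intro sum.cong refl) auto
        also have "\<dots> = emeasure lebesgue (\<Union>i\<in>p1. {Inf (snd i)<..<Sup (snd i)})"
          using dj1 p12(3) by (intro sum_emeasure) auto
        also have "\<dots> \<le> emeasure lebesgue T"
        proof (rule emeasure_mono)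
          show "(\<Union>i\<in>p1. {Inf (snd i)<..<Sup (snd i)}) \<subseteq> T"
          proof clarify
            fix z x Ka assume i: "(x,Ka) \<in> p1" and z: "z \<in> {Inf (snd (x,Ka))<..<Sup (snd (x,Ka))}"
            have "x \<in> N" "(x,Ka) \<in> p" using i by (auto simp: p1_def)
            moreover have "z \<in> Ka" using z by (subst K(1)[OF \<open>(x,Ka) \<in> p\<close>]) auto
            ultimately show "z \<in> T" using fine d(2) by blast
          qed
          show "T \<in> sets lebesgue" using T(1) by auto
        qed
        also have "\<dots> < ennreal \<delta>" by fact
        finally show "(\<Sum>i\<in>p1. Sup (snd i) - Inf (snd i)) < \<delta>" using \<delta>(1) Kp(2) by (subst (asm) ennreal_less_iff) (auto intro: sum_nonneg)
      qed
      finally have s1: "sum ?h p1 < e/2" .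
      have "sum ?h p2 \<le> (\<Sum>(x,K)\<in>p2. e2 * measure lborel K)"
      proof (rule sum_mono, clarify)
        fix x Ka assume i: "(x,Ka) \<in> p2"
        then have xp: "(x,Ka) \<in> p" "x \<notin> N" by (auto simp: p2_def)
        note K' = K[OF xp(1)]
        have m: "Inf Ka \<in> Ka" "Sup Ka \<in> Ka" using K'(2) by (subst (2) K'(1), simp)+
        have x: "Inf Ka \<le> x" "x \<le> Sup Ka" using K'(5) by (subst (asm) K'(1), simp)+
        have bd: "\<bar>Inf Ka - x\<bar> < d x" "\<bar>Sup Ka - x\<bar> < d x"
          using m fine[OF xp(1)] by (auto simp: subset_iff dist_real_def abs_minus_commute)
        have 1: "norm (F (Inf Ka) - F x - (Inf Ka - x) *\<^sub>R f x) \<le> e2 * (x - Inf Ka)"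
          using d(3)[of x "Inf Ka"] xp K' bd x by auto
        have 2: "norm (F (Sup Ka) - F x - (Sup Ka - x) *\<^sub>R f x) \<le> e2 * (Sup Ka - x)"
          using d(3)[of x "Sup Ka"] xp K' bd x by auto
        \<comment> \<open>Straddle argument: both endpoints are compared with the tag, where the
          derivative is available, and the two errors add up to \<open>e2\<close> times the length
          of the interval.\<close>
        have eq: "measure lborel Ka *\<^sub>R g x - (F (Sup Ka) - F (Inf Ka)) =
           (F (Inf Ka) - F x - (Inf Ka - x) *\<^sub>R f x) - (F (Sup Ka) - F x - (Sup Ka - x) *\<^sub>R f x)"
          unfolding K'(7) using xp(2) by (simp add: g_def algebra_simps)
        show "norm (measure lborel Ka *\<^sub>R g x - (F (Sup Ka) - F (Inf Ka))) \<le> e2 * measure lborel Ka"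
          unfolding eq unfolding K'(7)
          by (rule order_trans[OF norm_triangle_ineq4], rule order_trans[OF add_mono[OF 1 2]])
             (simp add: right_diff_distrib)
      qed
      also have "\<dots> \<le> (\<Sum>(x,K)\<in>p. e2 * measure lborel K)"
        using fin p12(6) e2 by (intro sum_mono2) auto
      also have "\<dots> = e2 * (b - a)"
        using additive_content_tagged_division[of p a b] p ab
        by (simp add: sum_distrib_left[symmetric] case_prod_unfold)
      also have "\<dots> < e / 2" using e ab by (simp add: e2_def divide_simps)
      finally have s2: "sum ?h p2 < e/2" .
      have "(\<Sum>(x,K)\<in>p. measure lborel K *\<^sub>R g x) - (F b - F a) = (\<Sum>(x,K)\<in>p. measure lborel K *\<^sub>R g x - (F (Sup K) - F (Inf K)))"
        using additive_tagged_division_1[OF ab p, of F] by (simp add: sum_subtractf case_prod_unfold)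
      also have "norm \<dots> \<le> sum ?h p" by (rule sum_norm_le) (auto simp: case_prod_unfold)
      also have "\<dots> = sum ?h p1 + sum ?h p2" unfolding p12(1) using p12(2-4) by (intro sum.union_disjoint) auto
      finally show "norm ((\<Sum>(x,K)\<in>p. measure lborel K *\<^sub>R g x) - (F b - F a)) < e" using s1 s2 by linarith
    qed
  qed
  then show ?thesis by (rule has_integral_spike[OF N, rotated]) (auto simp: g_def)
qed


lemma absolutely_continuous_curve_subinterval:
  assumes "absolutely_continuous_curve a b F" "a \<le> c" "d \<le> b"
  shows "absolutely_continuous_curve c d F"
  unfolding absolutely_continuous_curve_def
proof (intro allI impI)
  fix \<epsilon> :: real assume "\<epsilon> > 0"
  then obtain \<delta> where \<delta>: "\<delta> > 0" "\<forall>(n::nat) l r. (\<forall>i<n. a \<le> l i \<and> l i \<le> r i \<and> r i \<le> b) \<and>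
      disjoint_family_on (\<lambda>i. {l i<..<r i}) {..<n} \<and>
      (\<Sum>i<n. r i - l i) < \<delta> \<longrightarrow> (\<Sum>i<n. dist (F (l i)) (F (r i))) < \<epsilon>"
    using assms(1) unfolding absolutely_continuous_curve_def by blast
  show "\<exists>\<delta>>0. \<forall>(n::nat) l r.
      (\<forall>i<n. c \<le> l i \<and> l i \<le> r i \<and> r i \<le> d) \<and>
      disjoint_family_on (\<lambda>i. {l i<..<r i}) {..<n} \<and>
      (\<Sum>i<n. r i - l i) < \<delta> \<longrightarrow> (\<Sum>i<n. dist (F (l i)) (F (r i))) < \<epsilon>"
  proof (intro exI[of _ \<delta>] conjI allI impI)
    fix n :: nat and l r :: "nat \<Rightarrow> real"
    assume "(\<forall>i<n. c \<le> l i \<and> l i \<le> r i \<and> r i \<le> d) \<and>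
      disjoint_family_on (\<lambda>i. {l i<..<r i}) {..<n} \<and> (\<Sum>i<n. r i - l i) < \<delta>"
    then show "(\<Sum>i<n. dist (F (l i)) (F (r i))) < \<epsilon>"
      using assms(2,3) by (intro \<delta>(2)[rule_format]) force
  qed (rule \<delta>(1))
qed

text \<open>On an interval shorter than the \<delta> belonging to \<epsilon> = 1, the increments of
  \<open>F\<close> over any division add up to less than 1. By the fundamental theorem they are the
  integrals of \<open>f\<close> over the pieces, so the bounded variation criterion applies, and
  finitely many such intervals cover \<open>{a..b}\<close>. Integrability matters because
  \<open>horizontal_length\<close> is a Lebesgue integral, whose value for a non-integrable function
  is 0 by default.\<close>

lemma absolutely_continuous_curve_absolutely_integrable:
  fixes F :: "real \<Rightarrow> 'a::euclidean_space"
  assumes ac: "absolutely_continuous_curve a b F" and ab: "a \<le> b" and N: "negligible N"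
    and der: "\<And>x. x \<in> {a..b} - N \<Longrightarrow> (F has_vector_derivative f x) (at x within {a..b})"
  shows "f absolutely_integrable_on {a..b}"
proof -
  have FTC: "(f has_integral F d - F c) {c..d}" if "a \<le> c" "c \<le> d" "d \<le> b" for c d
    using that
    by (intro absolutely_continuous_curve_FTC[OF absolutely_continuous_curve_subinterval[OF ac] _ N]
        has_vector_derivative_within_subset[OF der]) auto
  obtain \<delta> where \<delta>: "\<delta> > 0"
      "\<And>(I :: real set set) l r. finite I \<Longrightarrow> (\<And>i. i \<in> I \<Longrightarrow> a \<le> l i \<and> l i \<le> r i \<and> r i \<le> b) \<Longrightarrow>
      disjoint_family_on (\<lambda>i. {l i<..<r i}) I \<Longrightarrow> (\<Sum>i\<in>I. r i - l i) < \<delta> \<Longrightarrow>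
      (\<Sum>i\<in>I. dist (F (l i)) (F (r i))) < 1"
    using absolutely_continuous_curveD_finite[OF ac, of 1, where 'i="real set"] zero_less_one by blast
  have small: "f absolutely_integrable_on {c..d}" if cd: "a \<le> c" "c \<le> d" "d \<le> b" "d - c < \<delta>" for c d
  proof -
    have "f absolutely_integrable_on cbox c d"
    proof (rule bounded_variation_absolutely_integrable_interval)
      show "f integrable_on cbox c d" using FTC[OF cd(1-3)] by (auto simp: integrable_on_def)
      fix D assume D: "D division_of cbox c d"
      have K: "K = {Inf K..Sup K}" "Inf K \<le> Sup K" "c \<le> Inf K" "Sup K \<le> d" if KD: "K \<in> D" for K
      proof -
        have "K \<noteq> {}" "K \<subseteq> {c..d}" using division_ofD(2,3)[OF D KD] by auto
        moreover obtain u v where "K = cbox u v" using division_ofD(4)[OF D KD] by blast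
        ultimately have "K = {u..v}" "u \<le> v" "c \<le> u" "v \<le> d" by auto
        then show "K = {Inf K..Sup K}" "Inf K \<le> Sup K" "c \<le> Inf K" "Sup K \<le> d" by auto
      qed
      have "(\<Sum>K\<in>D. norm (integral K f)) = (\<Sum>K\<in>D. dist (F (Inf K)) (F (Sup K)))"
      proof (rule sum.cong[OF refl])
        fix K assume "K \<in> D"
        note K = K[OF this]
        have "(f has_integral F (Sup K) - F (Inf K)) {Inf K..Sup K}"
          using K(2-4) cd by (intro FTC) auto
        then have "integral {Inf K..Sup K} f = F (Sup K) - F (Inf K)" by (rule integral_unique)
        then show "norm (integral K f) = dist (F (Inf K)) (F (Sup K))"
          using K(1) by (metis dist_norm norm_minus_commute)
      qed
      also have "\<dots> < 1"
      proof (rule \<delta>(2))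
        show "finite D" using D by blast
        show "a \<le> Inf i \<and> Inf i \<le> Sup i \<and> Sup i \<le> b" if "i \<in> D" for i
          using K[OF that] cd by auto
        show "disjoint_family_on (\<lambda>i. {Inf i<..<Sup i}) D"
          unfolding disjoint_family_on_def
        proof (intro ballI impI)
          fix i j assume ij: "i \<in> D" "j \<in> D" "i \<noteq> j"
          then have "interior i \<inter> interior j = {}" using division_ofD(5)[OF D] by blast
          then show "{Inf i<..<Sup i} \<inter> {Inf j<..<Sup j} = {}"
            using K(1)[OF ij(1)] K(1)[OF ij(2)] by (metis interior_atLeastAtMost_real)
        qed
        have "(\<Sum>i\<in>D. Sup i - Inf i) = (\<Sum>i\<in>D. measure lborel i)"
          using K(1,2) by (intro sum.cong refl) (metis content_real)
        also have "\<dots> = d - c" using additive_content_division[OF D] cd by simp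
        finally show "(\<Sum>i\<in>D. Sup i - Inf i) < \<delta>" using cd by simp
      qed
      finally show "(\<Sum>K\<in>D. norm (integral K f)) \<le> 1" by simp
    qed
    then show ?thesis by simp
  qed
  have step: "f absolutely_integrable_on {a..min b (a + real n * (\<delta>/2))}" for n
  proof (induction n)
    case 0
    then show ?case using ab \<delta>(1) by (intro small) auto
  next
    case (Suc n)
    let ?s = "\<lambda>n. min b (a + real n * (\<delta>/2))"
    have s: "a \<le> ?s n" "?s n \<le> ?s (Suc n)" "?s (Suc n) - ?s n < \<delta>"
      using ab \<delta>(1) by (auto simp: min_def field_simps)
    then have "f absolutely_integrable_on {?s n..?s (Suc n)}" by (intro small) auto
    from absolutely_integrable_Un[OF Suc.IH this] show ?case
      using s by (simp add: ivl_disj_un_two_touch(4) del: of_nat_Suc)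
  qed
  obtain n :: nat where "real n > (b - a) / (\<delta>/2)" using reals_Archimedean2 by blast
  then have "min b (a + real n * (\<delta>/2)) = b" using \<delta>(1) by (simp add: field_simps)
  then show ?thesis using step[of n] by simp
qed

section \<open>The gauge as a lower bound for the length of horizontal curves\<close>

text \<open>The three coordinates of the group product of the inverse of the first point with the
  second, each measured according to its weight under the dilations (s x, s y, s^2 z). This makes it
  left invariant and homogeneous of degree one, like the distance.\<close>

fun cc_gauge :: "heis \<Rightarrow> heis \<Rightarrow> real" where
  "cc_gauge (x, y, z) (x', y', z') =
    \<bar>x' - x\<bar> + \<bar>y' - y\<bar> + sqrt \<bar>z' - z - (x * y' - y * x') / 2\<bar>"

lemma cc_gauge_nonneg: "0 \<le> cc_gauge a b"
  by (cases a; cases b) simp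

text \<open>The coefficients in the frame are the first two coordinates of the vector; this resolves
  the definite description in \<open>horizontal_norm\<close>.\<close>

lemma horizontal_span:
  assumes "w \<in> span {X_field p, Y_field p}"
  shows "w = (fst w, fst (snd w), (fst p * fst (snd w) - fst (snd p) * fst w) / 2)"
    and "horizontal_norm p w = sqrt ((fst w)\<^sup>2 + (fst (snd w))\<^sup>2)"
proof -
  obtain x y z where p: "p = (x, y, z)" by (cases p) auto
  obtain u v where "w = u *\<^sub>R X_field p + v *\<^sub>R Y_field p"
    using assms unfolding span_insert span_empty by (auto simp: algebra_simps eq_diff_eq)
  then have w: "w = (u, v, (x * v - y * u) / 2)" by (simp add: p algebra_simps diff_divide_distrib)
  then show "w = (fst w, fst (snd w), (fst p * fst (snd w) - fst (snd p) * fst w) / 2)" by (simp add: p)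
  have "horizontal_norm p w = sqrt (u\<^sup>2 + v\<^sup>2)"
    unfolding horizontal_norm_def
  proof (rule the_equality)
    show "\<exists>u' v'. w = u' *\<^sub>R X_field p + v' *\<^sub>R Y_field p \<and> sqrt (u\<^sup>2 + v\<^sup>2) = sqrt (u'\<^sup>2 + v'\<^sup>2)"
      using w by (intro exI[of _ u] exI[of _ v]) (simp add: p algebra_simps diff_divide_distrib)
    show "r = sqrt (u\<^sup>2 + v\<^sup>2)" if "\<exists>u v. w = u *\<^sub>R X_field p + v *\<^sub>R Y_field p \<and> r = sqrt (u\<^sup>2 + v\<^sup>2)" for r
      using that w by (auto simp: p)
  qed
  then show "horizontal_norm p w = sqrt ((fst w)\<^sup>2 + (fst (snd w))\<^sup>2)" using w by simp
qed

lemma has_integral_norm_bound_negligible: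
  fixes f :: "'n::euclidean_space \<Rightarrow> 'a::banach"
  assumes "(f has_integral i) S" "g integrable_on S" "negligible N" "\<And>t. t \<in> S - N \<Longrightarrow> norm (f t) \<le> g t"
  shows "norm i \<le> integral S g"
proof -
  have "((\<lambda>t. if t \<in> N then 0 else f t) has_integral i) S"
    by (rule has_integral_spike[OF assms(3) _ assms(1)]) auto
  moreover have "((\<lambda>t. if t \<in> N then 0 else g t) has_integral integral S g) S"
    by (rule has_integral_spike[OF assms(3) _ integrable_integral[OF assms(2)]]) auto
  ultimately have "norm (integral S (\<lambda>t. if t \<in> N then 0 else f t)) \<le> integral S (\<lambda>t. if t \<in> N then 0 else g t)"
    using assms(4) by (intro integral_norm_bound_integral) (auto simp: integrable_on_def)
  then show ?thesis
    using \<open>((\<lambda>t. if t \<in> N then 0 else f t) has_integral i) S\<close>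
      \<open>((\<lambda>t. if t \<in> N then 0 else g t) has_integral integral S g) S\<close> by (simp add: integral_unique)
qed

text \<open>Each of the three summands of the gauge is at most the length \<open>l\<close>. For the
  planar ones this is clear; the vertical displacement relative to the starting point is at most
  \<open>l * l\<close>, because the planar part of the curve never leaves the
  \<open>l\<close>-neighbourhood of its start in either coordinate. The second claim bounds the
  infimum in \<open>cc_dist\<close> from below.\<close>

lemma cc_gauge_le_horizontal_length:
  assumes "horizontal_curve \<gamma>"
  shows "cc_gauge (\<gamma> 0) (\<gamma> 1) \<le> 3 * horizontal_length \<gamma>" "0 \<le> horizontal_length \<gamma>"
proof -
  define v where "v t = vector_derivative \<gamma> (at t within {0..1})" for t
  define sp where "sp t = sqrt ((fst (v t))\<^sup>2 + (fst (snd (v t)))\<^sup>2)" for t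
  have ac: "absolutely_continuous_curve 0 1 \<gamma>" using assms by (simp add: horizontal_curve_def)
  have ae: "AE t in lebesgue. t \<in> {0..1} \<longrightarrow>
      \<gamma> differentiable (at t within {0..1}) \<and> v t \<in> span {X_field (\<gamma> t), Y_field (\<gamma> t)}"
    using assms by (simp add: horizontal_curve_def v_def)
  then obtain N where N: "N \<in> null_sets lebesgue" "{t \<in> space lebesgue. \<not> (t \<in> {0..1} \<longrightarrow>
      \<gamma> differentiable (at t within {0..1}) \<and> v t \<in> span {X_field (\<gamma> t), Y_field (\<gamma> t)})} \<subseteq> N"
    unfolding eventually_ae_filter by blast
  then have neg: "negligible N" by (simp add: negligible_iff_null_sets)
  have D: "\<gamma> differentiable (at t within {0..1})" "v t \<in> span {X_field (\<gamma> t), Y_field (\<gamma> t)}"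
    if "t \<in> {0..1} - N" for t
    using N(2) that by auto
  have der: "(\<gamma> has_vector_derivative v t) (at t within {0..1})" if "t \<in> {0..1} - N" for t
    using D(1)[OF that] unfolding v_def by (rule vector_derivative_works[THEN iffD1])
  have FTC: "(v has_integral \<gamma> s - \<gamma> 0) {0..s}" if "s \<in> {0..1}" for s
    using that
    by (intro absolutely_continuous_curve_FTC[OF absolutely_continuous_curve_subinterval[OF ac] _ neg]
        has_vector_derivative_within_subset[OF der]) auto
  have vi: "v absolutely_integrable_on {0..1}"
    by (rule absolutely_continuous_curve_absolutely_integrable[OF ac _ neg der]) auto
  \<comment> \<open>The planar speed is measurable and dominated by the norm of the derivative.
    \<open>horizontal_norm\<close> is computed only off the negligible set and inherits
    integrability from \<open>sp\<close>.\<close>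
  have spi: "sp absolutely_integrable_on {0..1}"
  proof (rule measurable_bounded_by_integrable_imp_absolutely_integrable)
    have "v \<in> borel_measurable (lebesgue_on {0..1})" using vi by (simp add: absolutely_integrable_measurable)
    moreover have "(\<lambda>w::heis. sqrt ((fst w)\<^sup>2 + (fst (snd w))\<^sup>2)) \<in> borel_measurable borel"
      by (intro borel_measurable_continuous_onI continuous_intros)
    ultimately show "sp \<in> borel_measurable (lebesgue_on {0..1})"
      unfolding sp_def by (rule measurable_compose)
    show "(\<lambda>t. norm (v t)) integrable_on {0..1}" using vi by (simp add: absolutely_integrable_on_def)
    fix t
    have "norm (v t) = sqrt ((fst (v t))\<^sup>2 + ((fst (snd (v t)))\<^sup>2 + (snd (snd (v t)))\<^sup>2))"
      by (cases "v t") (simp add: norm_prod_def)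
    then show "norm (sp t) \<le> norm (v t)" by (simp add: sp_def)
  qed auto
  then have spi': "sp integrable_on {0..1}" by (simp add: absolutely_integrable_on_def)
  define l where "l = integral {0..1} sp"
  have hl: "horizontal_length \<gamma> = l"
  proof -
    have eq: "horizontal_norm (\<gamma> t) (v t) = sp t" if "t \<in> {0..1} - N" for t
      using horizontal_span(2)[OF D(2)[OF that]] by (simp add: sp_def)
    have "(\<lambda>t. horizontal_norm (\<gamma> t) (v t)) absolutely_integrable_on {0..1}"
      by (rule absolutely_integrable_spike[OF spi neg eq])
    then have "horizontal_length \<gamma> = integral {0..1} (\<lambda>t. horizontal_norm (\<gamma> t) (v t))"
      unfolding horizontal_length_def v_def[symmetric] by (rule set_lebesgue_integral_eq_integral)
    also have "\<dots> = l" unfolding l_def by (rule integral_spike[OF neg]) (use eq in auto)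
    finally show ?thesis .
  qed
  have sp0: "sp t \<ge> 0" for t by (simp add: sp_def)
  have spv: "\<bar>fst (v t)\<bar> \<le> sp t" "\<bar>fst (snd (v t))\<bar> \<le> sp t" for t
    by (simp_all add: sp_def real_le_rsqrt)
  have l0: "l \<ge> 0" unfolding l_def using sp0 by (intro integral_nonneg spi') auto
  have part: "integral {0..s} sp \<le> l" "sp integrable_on {0..s}" if "s \<in> {0..1}" for s
  proof -
    show "sp integrable_on {0..s}" using that by (intro integrable_on_subinterval[OF spi']) auto
    then show "integral {0..s} sp \<le> l" unfolding l_def
      using that spi' sp0 by (intro integral_subset_le) auto
  qed
  have bx: "\<bar>fst (\<gamma> s) - fst (\<gamma> 0)\<bar> \<le> l" if "s \<in> {0..1}" for s
  proof -
    have "((fst \<circ> v) has_integral fst (\<gamma> s - \<gamma> 0)) {0..s}"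
      by (rule has_integral_linear[OF FTC[OF that] bounded_linear_fst])
    from has_integral_norm_bound_negligible[OF this part(2)[OF that] negligible_empty] show ?thesis
      using spv part(1)[OF that] by fastforce
  qed
  have bls: "bounded_linear (\<lambda>w::heis. fst (snd w))" "bounded_linear (\<lambda>w::heis. snd (snd w))"
    by (intro bounded_linear_fst_comp bounded_linear_snd_comp bounded_linear_snd bounded_linear_ident)+
  have by': "\<bar>fst (snd (\<gamma> s)) - fst (snd (\<gamma> 0))\<bar> \<le> l" if "s \<in> {0..1}" for s
  proof -
    have "((\<lambda>w. fst (snd w)) \<circ> v has_integral fst (snd (\<gamma> s - \<gamma> 0))) {0..s}"
      by (rule has_integral_linear[OF FTC[OF that] bls(1)])
    from has_integral_norm_bound_negligible[OF this part(2)[OF that] negligible_empty] show ?thesis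
      using spv part(1)[OF that] by fastforce
  qed
  obtain x0 y0 z0 where g0: "\<gamma> 0 = (x0, y0, z0)" by (cases "\<gamma> 0") auto
  obtain x1 y1 z1 where g1: "\<gamma> 1 = (x1, y1, z1)" by (cases "\<gamma> 1") auto
  \<comment> \<open>Translating the initial point to the origin makes the vertical speed at most \<open>l\<close> times the
    horizontal one.\<close>
  define \<Lambda> where "\<Lambda> = (\<lambda>w::heis. snd (snd w) - (x0 / 2) * fst (snd w) + (y0 / 2) * fst w)"
  have bl: "bounded_linear \<Lambda>" unfolding \<Lambda>_def
    by (intro bounded_linear_add bounded_linear_sub bounded_linear_mult_right[THEN bounded_linear_compose]
      bls bounded_linear_fst)
  have "norm (\<Lambda> (\<gamma> 1 - \<gamma> 0)) \<le> integral {0..1} (\<lambda>t. l * sp t)"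
  proof (rule has_integral_norm_bound_negligible[OF has_integral_linear[OF FTC bl] _ neg])
    show "(\<lambda>t. l * sp t) integrable_on {0..1}" using integrable_on_cmult_left[OF spi', of l] by simp
    fix t :: real assume t: "t \<in> {0..1} - N"
    obtain x y z where gt: "\<gamma> t = (x, y, z)" by (cases "\<gamma> t") auto
    obtain a b c where vt: "v t = (a, b, c)" by (cases "v t") auto
    have c: "c = (x * b - y * a) / 2" using horizontal_span(1)[OF D(2)[OF t]] by (simp add: gt vt)
    have "\<Lambda> (v t) = ((x - x0) * b - (y - y0) * a) / 2"
      by (simp add: \<Lambda>_def vt c field_simps)
    also have "\<bar>\<dots>\<bar> \<le> (\<bar>x - x0\<bar> * \<bar>b\<bar> + \<bar>y - y0\<bar> * \<bar>a\<bar>) / 2"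
      by (simp add: abs_mult[symmetric])
    also have "\<dots> \<le> (l * sp t + l * sp t) / 2"
      using bx[of t] by'[of t] spv[of t] t l0 by (intro divide_right_mono add_mono mult_mono) (auto simp: gt vt g0)
    finally show "norm ((\<Lambda> \<circ> v) t) \<le> l * sp t" by simp
  qed auto
  then have "\<bar>z1 - z0 - (x0 * (y1 - y0) - y0 * (x1 - x0)) / 2\<bar> \<le> l * l"
    by (simp add: \<Lambda>_def g0 g1 l_def field_simps)
  then have "\<bar>z1 - z0 - (x0 * y1 - y0 * x1) / 2\<bar> \<le> l\<^sup>2" by (simp add: algebra_simps power2_eq_square)
  then have "sqrt \<bar>z1 - z0 - (x0 * y1 - y0 * x1) / 2\<bar> \<le> l" using l0 by (simp add: real_le_lsqrt)
  then show "cc_gauge (\<gamma> 0) (\<gamma> 1) \<le> 3 * horizontal_length \<gamma>"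
    using bx[of 1] by'[of 1] by (simp add: g0 g1 hl)
  show "0 \<le> horizontal_length \<gamma>" using l0 hl by simp
qed


section \<open>Explicit horizontal curves and the equivalence of distance and gauge\<close>

lemma lipschitz_absolutely_continuous_curve:
  fixes \<gamma> :: "real \<Rightarrow> 'a::metric_space"
  assumes "M-lipschitz_on {a..b} \<gamma>"
  shows "absolutely_continuous_curve a b \<gamma>"
  unfolding absolutely_continuous_curve_def
proof (intro allI impI)
  fix \<epsilon> :: real assume e: "\<epsilon> > 0"
  have M: "M \<ge> 0" using assms lipschitz_on_nonneg by blast
  show "\<exists>\<delta>>0. \<forall>(n::nat) l r.
      (\<forall>i<n. a \<le> l i \<and> l i \<le> r i \<and> r i \<le> b) \<and>
      disjoint_family_on (\<lambda>i. {l i<..<r i}) {..<n} \<and>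
      (\<Sum>i<n. r i - l i) < \<delta> \<longrightarrow> (\<Sum>i<n. dist (\<gamma> (l i)) (\<gamma> (r i))) < \<epsilon>"
  proof (intro exI[of _ "\<epsilon> / (M + 1)"] conjI allI impI)
    show "0 < \<epsilon> / (M + 1)" using e M by simp
    fix n :: nat and l r :: "nat \<Rightarrow> real"
    assume *: "(\<forall>i<n. a \<le> l i \<and> l i \<le> r i \<and> r i \<le> b) \<and>
      disjoint_family_on (\<lambda>i. {l i<..<r i}) {..<n} \<and> (\<Sum>i<n. r i - l i) < \<epsilon> / (M + 1)"
    have "(\<Sum>i<n. dist (\<gamma> (l i)) (\<gamma> (r i))) \<le> (\<Sum>i<n. M * (r i - l i))"
    proof (rule sum_mono)
      fix i assume "i \<in> {..<n}"
      then have "a \<le> l i" "l i \<le> r i" "r i \<le> b" using * by auto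
      then show "dist (\<gamma> (l i)) (\<gamma> (r i)) \<le> M * (r i - l i)"
        using lipschitz_onD[OF assms, of "l i" "r i"] by (simp add: dist_real_def)
    qed
    also have "\<dots> = M * (\<Sum>i<n. r i - l i)" by (simp add: sum_distrib_left)
    also have "\<dots> \<le> M * (\<epsilon> / (M + 1))" using * M by (intro mult_left_mono) auto
    also have "\<dots> < \<epsilon>" using e M by (simp add: field_simps)
    finally show "(\<Sum>i<n. dist (\<gamma> (l i)) (\<gamma> (r i))) < \<epsilon>" .
  qed
qed

lemma smooth_horizontal_curve:
  fixes X Y Z X' Y' Z' :: "real \<Rightarrow> real"
  assumes dX: "\<And>s. (X has_real_derivative X' s) (at s)"
    and dY: "\<And>s. (Y has_real_derivative Y' s) (at s)"
    and dZ: "\<And>s. (Z has_real_derivative Z' s) (at s)"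
    and cont: "continuous_on {0..1} X'" "continuous_on {0..1} Y'" "continuous_on {0..1} Z'"
    and hor: "\<And>s. Z' s = (X s * Y' s - Y s * X' s) / 2"
    and bound: "\<And>s. s \<in> {0..1} \<Longrightarrow> sqrt ((X' s)\<^sup>2 + (Y' s)\<^sup>2) \<le> B"
  shows "horizontal_curve (\<lambda>s. (X s, Y s, Z s)) \<and> horizontal_length (\<lambda>s. (X s, Y s, Z s)) \<le> B"
proof -
  let ?g = "\<lambda>s. (X s, Y s, Z s)" and ?d = "\<lambda>s. (X' s, Y' s, Z' s)"
  have der: "(?g has_vector_derivative ?d s) (at s)" for s
    using dX dY dZ by (intro has_vector_derivative_Pair) (auto simp: has_real_derivative_iff_has_vector_derivative)
  then have der': "(?g has_vector_derivative ?d s) (at s within {0..1})" for s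
    by (rule has_vector_derivative_at_within)
  have vd: "vector_derivative ?g (at s within {0..1}) = ?d s" if "s \<in> {0..1}" for s
    using that der'[of s] by (intro vector_derivative_within_closed_interval) auto
  have sp: "?d s \<in> span {X_field (?g s), Y_field (?g s)}" for s
  proof -
    have "?d s = X' s *\<^sub>R X_field (?g s) + Y' s *\<^sub>R Y_field (?g s)"
      by (simp add: hor field_simps)
    also have "\<dots> \<in> span {X_field (?g s), Y_field (?g s)}"
      by (intro span_add span_scale span_base) auto
    finally show ?thesis .
  qed
  have "compact (?d ` {0..1})" by (intro compact_continuous_image continuous_intros cont) auto
  then obtain M where M: "\<And>s. s \<in> {0..1} \<Longrightarrow> norm (?d s) \<le> M"
    using compact_imp_bounded[of "?d ` {0..1}"] unfolding bounded_iff by blast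
  have "0 \<le> M" using M[of 0] norm_ge_zero[of "?d 0"] by (meson atLeastAtMost_iff order_refl order_trans zero_le_one)
  have "M-lipschitz_on {0..1} ?g"
  proof (rule lipschitz_onI)
    fix s t :: real assume st: "s \<in> {0..1}" "t \<in> {0..1}"
    have "norm (?g s - ?g t) \<le> M * norm (s - t)"
    proof (rule differentiable_bound[where S="{0..1}"])
      show "(?g has_derivative (\<lambda>h. h *\<^sub>R ?d u)) (at u within {0..1})" for u
        using der'[of u] by (simp only: has_vector_derivative_def)
      show "onorm (\<lambda>h. h *\<^sub>R ?d u) \<le> M" if "u \<in> {0..1}" for u
      proof (rule onorm_bound[OF \<open>0 \<le> M\<close>])
        show "norm (h *\<^sub>R ?d u) \<le> M * norm h" for h
          using M[OF that] mult_right_mono[OF M[OF that], of "norm h"]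
          by (simp only: norm_scaleR) (simp add: mult.commute)
      qed
    qed (use st in auto)
    then show "dist (?g s) (?g t) \<le> M * dist s t" by (simp only: dist_norm)
  qed fact
  then have ac: "absolutely_continuous_curve 0 1 ?g" by (rule lipschitz_absolutely_continuous_curve)
  have hc: "horizontal_curve ?g"
    unfolding horizontal_curve_def
  proof (intro conjI ac AE_I2 impI)
    fix t :: real assume t: "t \<in> {0..1}"
    show "?g differentiable at t within {0..1}" using der' by (rule differentiableI_vector)
    show "vector_derivative ?g (at t within {0..1}) \<in> span {X_field (?g t), Y_field (?g t)}"
      unfolding vd[OF t] by (rule sp)
  qed
  let ?n = "\<lambda>s. sqrt ((X' s)\<^sup>2 + (Y' s)\<^sup>2)"
  have eq: "horizontal_norm (?g s) (vector_derivative ?g (at s within {0..1})) = ?n s" if "s \<in> {0..1}" for s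
    unfolding vd[OF that] using horizontal_span(2)[OF sp[of s]] by simp
  have ci: "continuous_on {0..1} ?n" by (intro continuous_intros cont)
  have "horizontal_length ?g = (LINT s:{0..1}|lebesgue. ?n s)"
    unfolding horizontal_length_def by (intro set_lebesgue_integral_cong) (use eq in auto)
  also have "\<dots> = integral {0..1} ?n"
    by (intro set_lebesgue_integral_eq_integral absolutely_integrable_continuous_real ci)
  also have "\<dots> \<le> integral {0..1::real} (\<lambda>_. B)"
    by (intro integral_le integrable_continuous_real ci bound) auto
  finally show ?thesis using hc by simp
qed

text \<open>The perturbation polynomials \<open>u = s(1-s)(1-2s)\<close> and \<open>v = s(1-s)(1/5-s(1-s))\<close> vanish at the
  endpoints and have mean zero, so adding multiples of them to a segment changes the enclosed area
  only by their own area, a multiple of \<open>\<integral> u v' = -1/350\<close>.\<close>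

lemma horizontal_curve_le_cc_gauge:
  obtains \<gamma> where "horizontal_curve \<gamma>" "\<gamma> 0 = a" "\<gamma> 1 = b" "horizontal_length \<gamma> \<le> 270 * cc_gauge a b"
proof -
  obtain x y z where a: "a = (x, y, z)" by (cases a) auto
  obtain x' y' z' where b: "b = (x', y', z')" by (cases b) auto
  define p where "p = x' - x"
  define q where "q = y' - y"
  define r where "r = z' - z - (x * y' - y * x') / 2"
  \<comment> \<open>The perturbation encloses the area \<alpha> * \<beta> times the integral of u
    v', that is - \<alpha> * \<beta> / 350, which has to equal r. Splitting the factor evenly keeps
    both amplitudes of order sqrt \<bar>r\<bar>, the scale of the gauge; the sign goes into
    \<beta>.\<close>
  define \<alpha> where "\<alpha> = sqrt (350 * \<bar>r\<bar>)"
  define \<beta> where "\<beta> = - sgn r * \<alpha>"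
  have \<alpha>0: "\<alpha> \<ge> 0" by (simp add: \<alpha>_def)
  have \<beta>a: "\<bar>\<beta>\<bar> \<le> \<alpha>" using \<alpha>0 by (simp add: \<beta>_def abs_mult sgn_if)
  have ab: "\<alpha> * \<beta> = - 350 * r"
  proof -
    have "\<alpha> * \<alpha> = 350 * \<bar>r\<bar>" by (simp add: \<alpha>_def)
    then have "\<alpha> * \<beta> = - sgn r * (350 * \<bar>r\<bar>)" by (simp add: \<beta>_def)
    then show ?thesis by (simp add: sgn_if split: if_splits)
  qed
  have "\<alpha> \<le> 19 * sqrt \<bar>r\<bar>"
  proof -
    have "sqrt 350 \<le> 19" by (rule real_le_lsqrt) auto
    then have "sqrt 350 * sqrt \<bar>r\<bar> \<le> 19 * sqrt \<bar>r\<bar>" by (intro mult_right_mono) auto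
    then show ?thesis by (simp add: \<alpha>_def real_sqrt_mult)
  qed
  define u where "u s = s - 3 * s^2 + 2 * s^3" for s :: real
  define v where "v s = s/5 - 6/5 * s^2 + 2 * s^3 - s^4" for s :: real
  define u' where "u' s = 1 - 6 * s + 6 * s^2" for s :: real
  define v' where "v' s = 1/5 - 12/5 * s + 6 * s^2 - 4 * s^3" for s :: real
  define U where "U s = s^2/2 - s^3 + s^4/2" for s :: real
  define V where "V s = s^2/10 - 2/5 * s^3 + s^4/2 - s^5/5" for s :: real
  define K where "K s = s^2/10 - s^3 + 17/5 * s^4 - 134/25 * s^5 + 4 * s^6 - 8/7 * s^7" for s :: real
  have du: "(u has_real_derivative u' s) (at s)" for s unfolding u_def u'_def
    by (auto intro!: derivative_eq_intros)
  have dv: "(v has_real_derivative v' s) (at s)" for s unfolding v_def v'_def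
    by (auto intro!: derivative_eq_intros)
  have dU: "(U has_real_derivative u s) (at s)" for s unfolding u_def U_def
    by (auto intro!: derivative_eq_intros)
  have dV: "(V has_real_derivative v s) (at s)" for s unfolding v_def V_def
    by (auto intro!: derivative_eq_intros)
  have dK: "(K has_real_derivative u s * v' s) (at s)" for s unfolding u_def v'_def K_def
    by (auto intro!: derivative_eq_intros simp: algebra_simps power_numeral_reduce)
  define \<xi> where "\<xi> s = p * s + \<alpha> * u s" for s
  define \<eta> where "\<eta> s = q * s + \<beta> * v s" for s
  define \<xi>' where "\<xi>' s = p + \<alpha> * u' s" for s
  define \<eta>' where "\<eta>' s = q + \<beta> * v' s" for s
  \<comment> \<open>Twice the signed area swept by (\<xi>, \<eta>) since time 0, integrated in
    closed form by parts; \<open>U\<close>, \<open>V\<close> and \<open>K\<close> are the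
    antiderivatives of \<open>u\<close>, \<open>v\<close> and \<open>u * v'\<close>.\<close>
  define W where "W s = p * \<beta> * (s * v s - 2 * V s) + \<alpha> * q * (2 * U s - s * u s)
    + \<alpha> * \<beta> * (2 * K s - u s * v s)" for s
  have d\<xi>: "(\<xi> has_real_derivative \<xi>' s) (at s)" for s unfolding \<xi>_def \<xi>'_def
    by (auto intro!: derivative_eq_intros du)
  have d\<eta>: "(\<eta> has_real_derivative \<eta>' s) (at s)" for s unfolding \<eta>_def \<eta>'_def
    by (auto intro!: derivative_eq_intros dv)
  have dW: "(W has_real_derivative \<xi> s * \<eta>' s - \<eta> s * \<xi>' s) (at s)" for s
    unfolding W_def \<xi>_def \<eta>_def \<xi>'_def \<eta>'_def
    by (rule derivative_eq_intros du dv dU dV dK refl)+ (simp add: algebra_simps)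
  define X where "X s = x + \<xi> s" for s
  define Y where "Y s = y + \<eta> s" for s
  define Z where "Z s = z + 1/2 * (x * \<eta> s - y * \<xi> s) + 1/2 * W s" for s
  have cu: "continuous_on {0..1} u'" "continuous_on {0..1} v'" "continuous_on {0..1} u" "continuous_on {0..1} v"
    unfolding u'_def v'_def u_def v_def by (intro continuous_intros; simp)+
  have cx: "continuous_on {0..1} \<xi>'" "continuous_on {0..1} \<eta>'" "continuous_on {0..1} X" "continuous_on {0..1} Y"
    unfolding \<xi>'_def \<eta>'_def X_def Y_def \<xi>_def \<eta>_def by (intro continuous_intros cu)+
  let ?Z' = "\<lambda>s. (X s * \<eta>' s - Y s * \<xi>' s) / 2"
  \<comment> \<open>14 = 1 + 13 comes from the bounds of u' and v' on the unit interval. With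
    \<alpha> \<le> 19 * sqrt \<bar>r\<bar> the final constant must exceed 14 * 19 = 266.\<close>
  have *: "horizontal_curve (\<lambda>s. (X s, Y s, Z s)) \<and>
    horizontal_length (\<lambda>s. (X s, Y s, Z s)) \<le> \<bar>p\<bar> + \<bar>q\<bar> + 14 * \<alpha>"
  proof (rule smooth_horizontal_curve[where X'=\<xi>' and Y'=\<eta>' and Z'="?Z'"])
    show "(X has_real_derivative \<xi>' s) (at s)" for s unfolding X_def by (auto intro!: derivative_eq_intros d\<xi>)
    show "(Y has_real_derivative \<eta>' s) (at s)" for s unfolding Y_def by (auto intro!: derivative_eq_intros d\<eta>)
    show "(Z has_real_derivative ?Z' s) (at s)" for s unfolding Z_def X_def Y_def
      by (rule derivative_eq_intros d\<xi> d\<eta> dW refl)+ (simp add: field_simps)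
    show "continuous_on {0..1} ?Z'" by (intro continuous_intros cx) auto
    fix s :: real assume s: "s \<in> {0..1}"
    have s': "0 \<le> s" "s \<le> 1" "s^2 \<le> 1" "s^3 \<le> 1" using s by (auto simp: power_le_one)
    have "0 \<le> s\<^sup>2" "s\<^sup>2 \<le> s" "0 \<le> s^3" using s by (auto simp: power2_eq_square mult_left_le)
    have "0 \<le> (1 - 2 * s)\<^sup>2" by simp
    then have "\<bar>u' s\<bar> \<le> 1"
      using \<open>s\<^sup>2 \<le> s\<close> by (simp add: u'_def abs_le_iff power2_eq_square algebra_simps)
    moreover have "\<bar>v' s\<bar> \<le> 13" unfolding v'_def using s' \<open>0 \<le> s\<^sup>2\<close> \<open>0 \<le> s^3\<close> by linarith
    ultimately have "\<bar>\<alpha> * u' s\<bar> \<le> \<alpha> * 1" "\<bar>\<beta> * v' s\<bar> \<le> \<alpha> * 13"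
      using \<alpha>0 \<beta>a by (simp only: abs_mult abs_of_nonneg, intro mult_mono; simp)+
    then show "sqrt ((\<xi>' s)\<^sup>2 + (\<eta>' s)\<^sup>2) \<le> \<bar>p\<bar> + \<bar>q\<bar> + 14 * \<alpha>"
      using sqrt_sum_squares_le_sum_abs[of "\<xi>' s" "\<eta>' s"] unfolding \<xi>'_def \<eta>'_def by linarith
  qed (use cx in auto)
  show thesis
  proof (rule that[OF conjunct1[OF *]])
    show "(X 0, Y 0, Z 0) = a" by (simp add: X_def Y_def Z_def \<xi>_def \<eta>_def W_def u_def v_def U_def V_def K_def a)
    have "W 1 = - (\<alpha> * \<beta>) / 175" by (simp add: W_def u_def v_def U_def V_def K_def)
    then have "W 1 = 2 * r" by (simp add: ab)
    then show "(X 1, Y 1, Z 1) = b"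
      by (simp add: X_def Y_def Z_def \<xi>_def \<eta>_def u_def v_def b p_def q_def r_def field_simps)
    have "\<bar>p\<bar> + \<bar>q\<bar> + 14 * \<alpha> \<le> 270 * (\<bar>p\<bar> + \<bar>q\<bar> + sqrt \<bar>r\<bar>)"
      using \<open>\<alpha> \<le> 19 * sqrt \<bar>r\<bar>\<close> real_sqrt_ge_zero[OF abs_ge_zero[of r]] abs_ge_zero[of p] abs_ge_zero[of q]
      unfolding distrib_left by linarith
    then show "horizontal_length (\<lambda>s. (X s, Y s, Z s)) \<le> 270 * cc_gauge a b"
      using * by (simp add: a b p_def q_def r_def)
  qed
qed

theorem cc_dist_le_cc_gauge: "cc_dist a b \<le> 270 * cc_gauge a b"
proof -
  obtain \<gamma> where \<gamma>: "horizontal_curve \<gamma>" "\<gamma> 0 = a" "\<gamma> 1 = b" "horizontal_length \<gamma> \<le> 270 * cc_gauge a b"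
    using horizontal_curve_le_cc_gauge by blast
  have "cc_dist a b \<le> horizontal_length \<gamma>" unfolding cc_dist_def
  proof (rule cINF_lower)
    show "bdd_below (horizontal_length ` {\<gamma>. horizontal_curve \<gamma> \<and> \<gamma> 0 = a \<and> \<gamma> 1 = b})"
      using cc_gauge_le_horizontal_length(2) by (intro bdd_belowI2[of _ 0]) auto
  qed (use \<gamma> in auto)
  then show ?thesis using \<gamma>(4) by simp
qed

text \<open>A common lower bound of the lengths bounds an infimum of reals only if some curve
  exists; the explicit construction supplies one.\<close>

theorem cc_gauge_le_cc_dist: "cc_gauge a b \<le> 3 * cc_dist a b"
proof -
  obtain \<gamma> where \<gamma>: "horizontal_curve \<gamma>" "\<gamma> 0 = a" "\<gamma> 1 = b"
    using horizontal_curve_le_cc_gauge by blast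
  have "cc_gauge a b / 3 \<le> cc_dist a b" unfolding cc_dist_def
    using \<gamma> cc_gauge_le_horizontal_length(1) by (intro cINF_greatest) fastforce+
  then show ?thesis by simp
qed

section \<open>Independence and Gaussian projections\<close>

text \<open>The library's \<open>indep_var\<close> requires both random variables to take values in the same type.\<close>

definition (in prob_space) indep_rv :: "'b measure \<Rightarrow> ('a \<Rightarrow> 'b) \<Rightarrow> 'c measure \<Rightarrow> ('a \<Rightarrow> 'c) \<Rightarrow> bool" where
  "indep_rv S X T Y \<longleftrightarrow> random_variable S X \<and> random_variable T Y \<and>
    (\<forall>A\<in>sets S. \<forall>B\<in>sets T. prob ((X -` A \<inter> space M) \<inter> (Y -` B \<inter> space M)) =
      prob (X -` A \<inter> space M) * prob (Y -` B \<inter> space M))"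

context prob_space
begin

lemma indep_rvD:
  assumes "indep_rv S X T Y"
  shows "random_variable S X" "random_variable T Y"
    "A \<in> sets S \<Longrightarrow> B \<in> sets T \<Longrightarrow> prob ((X -` A \<inter> space M) \<inter> (Y -` B \<inter> space M)) =
      prob (X -` A \<inter> space M) * prob (Y -` B \<inter> space M)"
  using assms unfolding indep_rv_def by auto

lemma Int_stable_vimage:
  assumes "Int_stable G"
  shows "Int_stable {X -` A \<inter> S | A. A \<in> G}"
  unfolding Int_stable_def
proof safe
  fix A B assume "A \<in> G" "B \<in> G"
  then have "A \<inter> B \<in> G" using assms by (auto simp: Int_stable_def)
  then show "\<exists>C. X -` A \<inter> S \<inter> (X -` B \<inter> S) = X -` C \<inter> S \<and> C \<in> G"
    by (intro exI[of _ "A \<inter> B"]) auto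
qed

lemma indep_rv_generatorI:
  assumes [measurable]: "random_variable S X" "random_variable T Y"
    and G: "sets S = sigma_sets (space S) G" "Int_stable G" "G \<subseteq> Pow (space S)"
    and prod: "\<And>A B. A \<in> G \<Longrightarrow> B \<in> sets T \<Longrightarrow>
      prob ((X -` A \<inter> space M) \<inter> (Y -` B \<inter> space M)) = prob (X -` A \<inter> space M) * prob (Y -` B \<inter> space M)"
  shows "indep_rv S X T Y"
proof -
  let ?A = "{X -` A \<inter> space M | A. A \<in> G}" and ?B = "{Y -` B \<inter> space M | B. B \<in> sets T}"
  have GS: "A \<in> sets S" if "A \<in> G" for A using that G(1) by auto
  have "indep_set (sigma_sets (space M) ?A) (sigma_sets (space M) ?B)"
  proof (rule indep_set_sigma_sets)
    show "indep_set ?A ?B" unfolding indep_sets2_eq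
      using prod measurable_sets[OF assms(1) GS] measurable_sets[OF assms(2)] by auto
    show "Int_stable ?A" by (rule Int_stable_vimage[OF G(2)])
    show "Int_stable ?B" by (rule Int_stable_vimage[OF sets.Int_stable])
  qed
  then have *: "prob (a \<inter> b) = prob a * prob b"
    if "a \<in> sigma_sets (space M) ?A" "b \<in> sigma_sets (space M) ?B" for a b
    using that unfolding indep_sets2_eq by blast
  have "{X -` A \<inter> space M | A. A \<in> sets S} = sigma_sets (space M) ?A"
    unfolding G(1) using measurable_space[OF assms(1)]
    by (intro sigma_sets_vimage_commute) auto
  then have "X -` A \<inter> space M \<in> sigma_sets (space M) ?A" if "A \<in> sets S" for A using that by blast
  moreover have "Y -` B \<inter> space M \<in> sigma_sets (space M) ?B" if "B \<in> sets T" for B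
    using that by (intro sigma_sets.Basic) auto
  ultimately show ?thesis using * assms(1,2) unfolding indep_rv_def by blast
qed

lemma indep_rv_sym: "indep_rv S X T Y \<Longrightarrow> indep_rv T Y S X"
  unfolding indep_rv_def by (auto simp: Int_commute mult.commute)

lemma indep_var_imp_indep_rv: "indep_var S X T Y \<Longrightarrow> indep_rv S X T Y"
  unfolding indep_rv_def indep_var_eq indep_sets2_eq by (blast intro: sigma_sets.Basic)

lemma indep_rv_imp_indep_var:
  assumes "indep_rv S X T Y"
  shows "indep_var S X T Y"
  unfolding indep_var_eq
proof (intro conjI indep_set_sigma_sets)
  show "random_variable S X" "random_variable T Y" using indep_rvD[OF assms] by auto
  then show "indep_set {X -` A \<inter> space M |A. A \<in> sets S} {Y -` A \<inter> space M |A. A \<in> sets T}"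
    using indep_rvD(3)[OF assms] unfolding indep_sets2_eq by (auto intro: measurable_sets)
qed (intro Int_stable_vimage sets.Int_stable)+

lemma indep_rv_compose:
  assumes "indep_rv S X T Y" and f: "f \<in> measurable S S'" and g: "g \<in> measurable T T'"
  shows "indep_rv S' (\<lambda>\<omega>. f (X \<omega>)) T' (\<lambda>\<omega>. g (Y \<omega>))"
  unfolding indep_rv_def
proof (intro conjI ballI)
  note XY[measurable] = indep_rvD(1,2)[OF assms(1)]
  show "random_variable S' (\<lambda>\<omega>. f (X \<omega>))" "random_variable T' (\<lambda>\<omega>. g (Y \<omega>))" using f g by measurable
  fix A B assume AB: "A \<in> sets S'" "B \<in> sets T'"
  have "(\<lambda>\<omega>. f (X \<omega>)) -` A \<inter> space M = X -` (f -` A \<inter> space S) \<inter> space M"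
    "(\<lambda>\<omega>. g (Y \<omega>)) -` B \<inter> space M = Y -` (g -` B \<inter> space T) \<inter> space M"
    using measurable_space[OF XY(1)] measurable_space[OF XY(2)] by auto
  then show "prob ((\<lambda>\<omega>. f (X \<omega>)) -` A \<inter> space M \<inter> ((\<lambda>\<omega>. g (Y \<omega>)) -` B \<inter> space M)) =
    prob ((\<lambda>\<omega>. f (X \<omega>)) -` A \<inter> space M) * prob ((\<lambda>\<omega>. g (Y \<omega>)) -` B \<inter> space M)"
    using indep_rvD(3)[OF assms(1) measurable_sets[OF f AB(1)] measurable_sets[OF g AB(2)]] by simp
qed

lemma indep_rv_distr:
  assumes "indep_rv S X T Y"
  shows "distr M S X \<Otimes>\<^sub>M distr M T Y = distr M (S \<Otimes>\<^sub>M T) (\<lambda>\<omega>. (X \<omega>, Y \<omega>))"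
proof -
  note [measurable] = indep_rvD(1,2)[OF assms]
  interpret X: prob_space "distr M S X" by (rule prob_space_distr) measurable
  interpret Y: prob_space "distr M T Y" by (rule prob_space_distr) measurable
  show ?thesis
  proof (rule pair_measure_eqI)
    fix A B assume "A \<in> sets (distr M S X)" "B \<in> sets (distr M T Y)"
    then have AB: "A \<in> sets S" "B \<in> sets T" by auto
    have "(\<lambda>\<omega>. (X \<omega>, Y \<omega>)) -` (A \<times> B) \<inter> space M = (X -` A \<inter> space M) \<inter> (Y -` B \<inter> space M)" by auto
    then show "emeasure (distr M S X) A * emeasure (distr M T Y) B =
        emeasure (distr M (S \<Otimes>\<^sub>M T) (\<lambda>\<omega>. (X \<omega>, Y \<omega>))) (A \<times> B)"
      using AB indep_rvD(3)[OF assms AB]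
      by (simp add: emeasure_distr emeasure_eq_measure ennreal_mult'[symmetric])
  qed (auto intro: X.sigma_finite_measure_axioms Y.sigma_finite_measure_axioms cong: sets_pair_measure_cong)
qed

text \<open>Regrouping, verified on rectangles: the event of \<open>X\<close> splits off first, then
  those of \<open>Y\<close> and \<open>Z\<close>. Together with \<open>indep_rv_pair_right\<close>
  it replaces mutual independence of three variables of different types.\<close>

lemma indep_rv_pair_left:
  assumes XYZ: "indep_rv S X (T \<Otimes>\<^sub>M U) (\<lambda>\<omega>. (Y \<omega>, Z \<omega>))" and YZ: "indep_rv T Y U Z"
  shows "indep_rv (S \<Otimes>\<^sub>M T) (\<lambda>\<omega>. (X \<omega>, Y \<omega>)) U Z"
proof (rule indep_rv_generatorI[where G="{A \<times> B | A B. A \<in> sets S \<and> B \<in> sets T}"])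
  note [measurable] = indep_rvD(1)[OF XYZ] indep_rvD(1,2)[OF YZ]
  show "random_variable (S \<Otimes>\<^sub>M T) (\<lambda>\<omega>. (X \<omega>, Y \<omega>))" "random_variable U Z" by measurable
  have XY: "indep_rv S X T Y"
    using indep_rv_compose[OF XYZ measurable_ident measurable_fst] by simp
  fix A B assume "A \<in> {A \<times> B | A B. A \<in> sets S \<and> B \<in> sets T}" and B: "B \<in> sets U"
  then obtain A1 A2 where A: "A = A1 \<times> A2" "A1 \<in> sets S" "A2 \<in> sets T" by auto
  have "(\<lambda>\<omega>. (X \<omega>, Y \<omega>)) -` A \<inter> space M \<inter> (Z -` B \<inter> space M)
     = (X -` A1 \<inter> space M) \<inter> ((\<lambda>\<omega>. (Y \<omega>, Z \<omega>)) -` (A2 \<times> B) \<inter> space M)" by (auto simp: A)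
  then have "prob ((\<lambda>\<omega>. (X \<omega>, Y \<omega>)) -` A \<inter> space M \<inter> (Z -` B \<inter> space M))
     = prob (X -` A1 \<inter> space M) * prob ((\<lambda>\<omega>. (Y \<omega>, Z \<omega>)) -` (A2 \<times> B) \<inter> space M)"
    using indep_rvD(3)[OF XYZ A(2), of "A2 \<times> B"] A B by simp
  also have "(\<lambda>\<omega>. (Y \<omega>, Z \<omega>)) -` (A2 \<times> B) \<inter> space M = (Y -` A2 \<inter> space M) \<inter> (Z -` B \<inter> space M)" by auto
  also have "prob \<dots> = prob (Y -` A2 \<inter> space M) * prob (Z -` B \<inter> space M)"
    by (rule indep_rvD(3)[OF YZ A(3) B])
  also have "prob (X -` A1 \<inter> space M) * \<dots> = prob ((X -` A1 \<inter> space M) \<inter> (Y -` A2 \<inter> space M)) * prob (Z -` B \<inter> space M)"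
    using indep_rvD(3)[OF XY A(2,3)] by simp
  also have "(X -` A1 \<inter> space M) \<inter> (Y -` A2 \<inter> space M) = (\<lambda>\<omega>. (X \<omega>, Y \<omega>)) -` A \<inter> space M" by (auto simp: A)
  finally show "prob ((\<lambda>\<omega>. (X \<omega>, Y \<omega>)) -` A \<inter> space M \<inter> (Z -` B \<inter> space M))
     = prob ((\<lambda>\<omega>. (X \<omega>, Y \<omega>)) -` A \<inter> space M) * prob (Z -` B \<inter> space M)" .
qed (auto simp: sets_pair_measure space_pair_measure Int_stable_pair_measure_generator
  dest: sets.sets_into_space)

lemma indep_rv_pair_right:
  assumes XYZ: "indep_rv (S \<Otimes>\<^sub>M T) (\<lambda>\<omega>. (X \<omega>, Y \<omega>)) U Z" and XY: "indep_rv S X T Y"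
  shows "indep_rv S X (T \<Otimes>\<^sub>M U) (\<lambda>\<omega>. (Y \<omega>, Z \<omega>))"
proof -
  have "indep_rv U Z (T \<Otimes>\<^sub>M S) (\<lambda>\<omega>. (Y \<omega>, X \<omega>))"
    using indep_rv_compose[OF indep_rv_sym[OF XYZ] measurable_ident, of "\<lambda>(x, y). (y, x)" "T \<Otimes>\<^sub>M S"]
    by (simp add: case_prod_unfold)
  from indep_rv_sym[OF indep_rv_pair_left[OF this indep_rv_sym[OF XY]]]
  have "indep_rv S X (U \<Otimes>\<^sub>M T) (\<lambda>\<omega>. (Z \<omega>, Y \<omega>))" .
  from indep_rv_compose[OF this measurable_ident, of "\<lambda>(x, y). (y, x)" "T \<Otimes>\<^sub>M U"] show ?thesis
    by (simp add: case_prod_unfold)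
qed

text \<open>Cylinder sets generate the product sigma-algebra and are stable under intersection, so
  independence of a whole path from \<open>Y\<close> reduces to finitely many times.\<close>

lemma indep_rv_PiM_finite:
  assumes X: "\<And>i. i \<in> I \<Longrightarrow> random_variable (N i) (X i)" and Y: "random_variable T Y"
    and fin: "\<And>J. finite J \<Longrightarrow> J \<subseteq> I \<Longrightarrow> indep_rv (PiM J N) (\<lambda>\<omega>. \<lambda>j\<in>J. X j \<omega>) T Y"
  shows "indep_rv (PiM I N) (\<lambda>\<omega>. \<lambda>i\<in>I. X i \<omega>) T Y"
proof (rule indep_rv_generatorI[where G="prod_algebra I N"])
  show "random_variable (PiM I N) (\<lambda>\<omega>. \<lambda>i\<in>I. X i \<omega>)" using X by measurable
  show "random_variable T Y" by fact
  show "sets (PiM I N) = sigma_sets (space (PiM I N)) (prod_algebra I N)"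
    by (simp add: sets_PiM space_PiM)
  show "prod_algebra I N \<subseteq> Pow (space (PiM I N))"
    using prod_algebra_sets_into_space[of I N] by (simp add: space_PiM)
  show "Int_stable (prod_algebra I N)" by (rule Int_stable_prod_algebra)
  fix A B assume A': "A \<in> prod_algebra I N" and B: "B \<in> sets T"
  obtain J E where A: "A = prod_emb I N J (\<Pi>\<^sub>E j\<in>J. E j)" "finite J" "J \<subseteq> I"
    "\<And>i. i \<in> J \<Longrightarrow> E i \<in> sets (N i)" by (rule prod_algebraE[OF A']) blast
  have r: "I \<inter> J = J" using A(3) by auto
  have "(\<lambda>\<omega>. \<lambda>i\<in>I. X i \<omega>) -` A \<inter> space M = (\<lambda>\<omega>. \<lambda>j\<in>J. X j \<omega>) -` (\<Pi>\<^sub>E j\<in>J. E j) \<inter> space M"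
    using measurable_space[OF X] by (auto simp: A(1) prod_emb_def r simp del: restrict_PiE_iff)
  then show "prob ((\<lambda>\<omega>. \<lambda>i\<in>I. X i \<omega>) -` A \<inter> space M \<inter> (Y -` B \<inter> space M))
    = prob ((\<lambda>\<omega>. \<lambda>i\<in>I. X i \<omega>) -` A \<inter> space M) * prob (Y -` B \<inter> space M)"
    using indep_rvD(3)[OF fin[OF A(2,3)] _ B, of "\<Pi>\<^sub>E j\<in>J. E j"] A by (simp add: sets_PiM_I_finite)
qed

text \<open>Every event of \<open>X\<close> is an event of \<open>f\<close>, by construction of the
  generated sigma-algebra. This is how independence reaches the random variables adapted to the
  filtration.\<close>

lemma indep_rv_vimage_algebra:
  assumes ind: "indep_rv S f T Y" and X: "X \<in> measurable (vimage_algebra (space M) f S) U"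
  shows "indep_rv U X T Y"
  unfolding indep_rv_def
proof (intro conjI ballI)
  note f = indep_rvD(1)[OF ind]
  have sp: "f \<in> space M \<rightarrow> space S" using measurable_space[OF f] by auto
  have sub: "sets (vimage_algebra (space M) f S) \<subseteq> events"
    using f sp by (auto simp: sets_vimage_algebra2 intro: measurable_sets)
  show "random_variable U X" using X sub by (auto simp: measurable_def)
  show "random_variable T Y" using indep_rvD(2)[OF ind] .
  fix A B assume A: "A \<in> sets U" and B: "B \<in> sets T"
  have "X -` A \<inter> space M \<in> sets (vimage_algebra (space M) f S)"
    using measurable_sets[OF X A] by simp
  then obtain C where C: "C \<in> sets S" "X -` A \<inter> space M = f -` C \<inter> space M"
    using sp by (auto simp: sets_vimage_algebra2)
  show "prob (X -` A \<inter> space M \<inter> (Y -` B \<inter> space M)) = prob (X -` A \<inter> space M) * prob (Y -` B \<inter> space M)"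
    unfolding C(2) by (rule indep_rvD(3)[OF ind C(1) B])
qed

end

section \<open>Orthogonal decomposition of Gaussians and the tent component of Brownian
  motion\<close>

text \<open>The substitution behind it is u = x + y, z = y - \<kappa> * x, with Jacobian 1 +
  \<kappa> and inverse x = (u - z) / (1 + \<kappa>), y = u - x. With this \<kappa> the mixed term u
  z disappears from the exponent, and the variance of z is
  \<open>(\<tau> * s / \<sigma>)\<^sup>2\<close>.\<close>

lemma normal_density_rotate:
  fixes \<sigma> \<tau> u z :: real
  assumes "0 < \<sigma>" "0 < \<tau>"
  defines "\<kappa> \<equiv> \<tau>\<^sup>2 / \<sigma>\<^sup>2" and "s \<equiv> sqrt (\<sigma>\<^sup>2 + \<tau>\<^sup>2)"
  shows "normal_density 0 \<sigma> ((u - z) / (1 + \<kappa>)) * normal_density 0 \<tau> (u - (u - z) / (1 + \<kappa>)) / (1 + \<kappa>)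
    = normal_density 0 s u * normal_density 0 (\<tau> * s / \<sigma>) z"
proof -
  have s: "s > 0" "s\<^sup>2 = \<sigma>\<^sup>2 + \<tau>\<^sup>2" using assms by (auto simp: add_pos_pos)
  have k: "1 + \<kappa> = s\<^sup>2 / \<sigma>\<^sup>2" using assms s by (simp add: field_simps)
  have "\<sigma>\<^sup>2 + \<tau>\<^sup>2 \<noteq> 0" using assms(1) by (simp add: sum_power2_eq_zero_iff)
  have x: "(u - z) / (1 + \<kappa>) = \<sigma>\<^sup>2 * (u - z) / s\<^sup>2" "u - (u - z) / (1 + \<kappa>) = (\<tau>\<^sup>2 * u + \<sigma>\<^sup>2 * z) / s\<^sup>2"
    unfolding k using assms(1,2) \<open>\<sigma>\<^sup>2 + \<tau>\<^sup>2 \<noteq> 0\<close> unfolding s(2) by (simp_all add: field_simps)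
  have ex: "(\<sigma>\<^sup>2 * (u - z) / s\<^sup>2)\<^sup>2 / (2 * \<sigma>\<^sup>2) + ((\<tau>\<^sup>2 * u + \<sigma>\<^sup>2 * z) / s\<^sup>2)\<^sup>2 / (2 * \<tau>\<^sup>2)
     = u\<^sup>2 / (2 * s\<^sup>2) + z\<^sup>2 / (2 * (\<tau> * s / \<sigma>)\<^sup>2)"
  proof -
    have ex': "(a * (u - z) / S)\<^sup>2 / (2 * a) + ((b * u + a * z) / S)\<^sup>2 / (2 * b)
      = u\<^sup>2 / (2 * S) + z\<^sup>2 / (2 * (b * S / a))"
      if "a \<noteq> 0" "b \<noteq> 0" "S \<noteq> 0" "S = a + b" for a b S :: real
    proof -
      have n: "a * b * (u - z)\<^sup>2 + (b * u + a * z)\<^sup>2 = S * (b * u\<^sup>2 + a * z\<^sup>2)"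
        by (simp add: that(4) algebra_simps power2_eq_square)
      have "(a * (u - z) / S)\<^sup>2 / (2 * a) + ((b * u + a * z) / S)\<^sup>2 / (2 * b)
        = (a * b * (u - z)\<^sup>2 + (b * u + a * z)\<^sup>2) / (2 * b * S\<^sup>2)"
        using that(1-3) by (simp add: field_simps power2_eq_square)
      also have "\<dots> = u\<^sup>2 / (2 * S) + z\<^sup>2 / (2 * (b * S / a))"
        unfolding n using that(1-3) by (simp add: field_simps power2_eq_square)
      finally show ?thesis .
    qed
    show ?thesis
      using ex'[of "\<sigma>\<^sup>2" "\<tau>\<^sup>2" "s\<^sup>2"] assms(1,2) s by (simp add: power_divide power_mult_distrib)
  qed
  have e: "exp (- (\<sigma>\<^sup>2 * (u - z) / s\<^sup>2)\<^sup>2 / (2 * \<sigma>\<^sup>2)) * exp (- ((\<tau>\<^sup>2 * u + \<sigma>\<^sup>2 * z) / s\<^sup>2)\<^sup>2 / (2 * \<tau>\<^sup>2))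
    = exp (- u\<^sup>2 / (2 * s\<^sup>2)) * exp (- z\<^sup>2 / (2 * (\<tau> * s / \<sigma>)\<^sup>2))"
    unfolding exp_add[symmetric] using ex by (intro arg_cong[where f=exp]) linarith
  have c: "1 / sqrt (2 * pi * \<sigma>\<^sup>2) * (1 / sqrt (2 * pi * \<tau>\<^sup>2)) / (1 + \<kappa>)
    = 1 / sqrt (2 * pi * s\<^sup>2) * (1 / sqrt (2 * pi * (\<tau> * s / \<sigma>)\<^sup>2))"
    unfolding k using assms(1,2) s(1) by (simp add: real_sqrt_mult real_sqrt_divide field_simps power2_eq_square)
  have "normal_density 0 \<sigma> ((u - z) / (1 + \<kappa>)) * normal_density 0 \<tau> (u - (u - z) / (1 + \<kappa>)) / (1 + \<kappa>)
    = (1 / sqrt (2 * pi * \<sigma>\<^sup>2) * (1 / sqrt (2 * pi * \<tau>\<^sup>2)) / (1 + \<kappa>)) *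
      (exp (- (\<sigma>\<^sup>2 * (u - z) / s\<^sup>2)\<^sup>2 / (2 * \<sigma>\<^sup>2)) * exp (- ((\<tau>\<^sup>2 * u + \<sigma>\<^sup>2 * z) / s\<^sup>2)\<^sup>2 / (2 * \<tau>\<^sup>2)))"
    unfolding x(2) unfolding x(1) normal_density_def by simp
  also have "\<dots> = normal_density 0 s u * normal_density 0 (\<tau> * s / \<sigma>) z"
    unfolding e c normal_density_def by simp
  finally show ?thesis .
qed

text \<open>The multiple of \<open>X\<close> is chosen so that the difference has covariance 0 with
  the sum; for a Gaussian pair the joint density then factors.\<close>

lemma (in prob_space) normal_add_indep:
  assumes X: "distributed M lborel X (normal_density 0 \<sigma>)" "0 < \<sigma>"
    and Y: "distributed M lborel Y (normal_density 0 \<tau>)" "0 < \<tau>"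
    and ind: "indep_var borel X borel Y"
  shows "distributed M lborel (\<lambda>\<omega>. X \<omega> + Y \<omega>) (normal_density 0 (sqrt (\<sigma>\<^sup>2 + \<tau>\<^sup>2)))"
    and "indep_var borel (\<lambda>\<omega>. X \<omega> + Y \<omega>) borel (\<lambda>\<omega>. Y \<omega> - \<tau>\<^sup>2 / \<sigma>\<^sup>2 * X \<omega>)"
proof -
  define \<kappa> where "\<kappa> = \<tau>\<^sup>2 / \<sigma>\<^sup>2"
  define s where "s = sqrt (\<sigma>\<^sup>2 + \<tau>\<^sup>2)"
  have \<kappa>: "\<kappa> > 0" and s: "s > 0" using X(2) Y(2) by (auto simp: \<kappa>_def s_def add_pos_pos)
  have XYm[measurable]: "X \<in> borel_measurable M" "Y \<in> borel_measurable M"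
    using distributed_measurable[OF X(1)] distributed_measurable[OF Y(1)] by auto
  define U where "U = (\<lambda>\<omega>. X \<omega> + Y \<omega>)"
  define Z where "Z = (\<lambda>\<omega>. Y \<omega> - \<kappa> * X \<omega>)"
  have [measurable]: "U \<in> borel_measurable M" "Z \<in> borel_measurable M" unfolding U_def Z_def by measurable
  have ind': "indep_var lborel X lborel Y" using ind unfolding indep_var_eq by simp
  have joint: "distributed M (lborel \<Otimes>\<^sub>M lborel) (\<lambda>\<omega>. (X \<omega>, Y \<omega>))
     (\<lambda>(x, y). ennreal (normal_density 0 \<sigma> x) * ennreal (normal_density 0 \<tau> y))"
    by (rule distributed_joint_indep[OF _ _ X(1) Y(1) ind']) (auto intro: lborel.sigma_finite_measure_axioms)
  \<comment> \<open>The planar change of variables is done as two substitutions on the line, u = x +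
    y for fixed x and then z = u - (1 + \<kappa>) * x for fixed u, with an exchange of the integrals
    in between.\<close>
  have dUZ: "distributed M (lborel \<Otimes>\<^sub>M lborel) (\<lambda>\<omega>. (U \<omega>, Z \<omega>))
     (\<lambda>(u, z). ennreal (normal_density 0 s u) * ennreal (normal_density 0 (\<tau> * s / \<sigma>) z))"
    unfolding distributed_def
  proof (intro conjI measure_eqI)
    fix A assume "A \<in> sets (distr M (lborel \<Otimes>\<^sub>M lborel) (\<lambda>\<omega>. (U \<omega>, Z \<omega>)))"
    then have A[measurable]: "A \<in> sets (borel \<Otimes>\<^sub>M borel)"
      using sets_pair_measure_cong[of "lborel::real measure" borel "lborel::real measure" borel] by simp
    have "emeasure (distr M (lborel \<Otimes>\<^sub>M lborel) (\<lambda>\<omega>. (U \<omega>, Z \<omega>))) A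
      = (\<integral>\<^sup>+ \<omega>. indicator A (U \<omega>, Z \<omega>) \<partial>M)"
    proof -
      have "emeasure (distr M (lborel \<Otimes>\<^sub>M lborel) (\<lambda>\<omega>. (U \<omega>, Z \<omega>))) A
        = (\<integral>\<^sup>+ w. indicator A w \<partial>distr M (lborel \<Otimes>\<^sub>M lborel) (\<lambda>\<omega>. (U \<omega>, Z \<omega>)))"
        using A sets_pair_measure_cong[of "lborel::real measure" borel "lborel::real measure" borel]
        by (intro nn_integral_indicator[symmetric]) simp
      also have "\<dots> = (\<integral>\<^sup>+ \<omega>. indicator A (U \<omega>, Z \<omega>) \<partial>M)"
        by (rule nn_integral_distr) measurable
      finally show ?thesis .
    qed
    also have "\<dots> = (\<integral>\<^sup>+ \<omega>. (\<lambda>(x, y). indicator A (x + y, y - \<kappa> * x)) (X \<omega>, Y \<omega>) \<partial>M)"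
      by (simp add: U_def Z_def)
    also have "\<dots> = (\<integral>\<^sup>+ w. (case w of (x, y) \<Rightarrow> ennreal (normal_density 0 \<sigma> x) * ennreal (normal_density 0 \<tau> y)) *
        (\<lambda>(x, y). indicator A (x + y, y - \<kappa> * x)) w \<partial>(lborel \<Otimes>\<^sub>M lborel))"
      by (rule distributed_nn_integral[OF joint, symmetric]) measurable
    also have "\<dots> = (\<integral>\<^sup>+ x. (\<integral>\<^sup>+ y. ennreal (normal_density 0 \<sigma> x) * ennreal (normal_density 0 \<tau> y) * indicator A (x + y, y - \<kappa> * x) \<partial>lborel) \<partial>lborel)"
      by (subst lborel.nn_integral_fst[symmetric]) auto
    also have "\<dots> = (\<integral>\<^sup>+ x. (\<integral>\<^sup>+ u. ennreal (normal_density 0 \<sigma> x) * ennreal (normal_density 0 \<tau> (u - x)) * indicator A (u, (u - x) - \<kappa> * x) \<partial>lborel) \<partial>lborel)"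
    proof (rule nn_integral_cong)
      fix x :: real
      show "(\<integral>\<^sup>+ y. ennreal (normal_density 0 \<sigma> x) * ennreal (normal_density 0 \<tau> y) * indicator A (x + y, y - \<kappa> * x) \<partial>lborel)
        = (\<integral>\<^sup>+ u. ennreal (normal_density 0 \<sigma> x) * ennreal (normal_density 0 \<tau> (u - x)) * indicator A (u, (u - x) - \<kappa> * x) \<partial>lborel)"
        by (subst nn_integral_real_affine[where c=1 and t="-x"]) (auto simp: add_ac)
    qed
    also have "\<dots> = (\<integral>\<^sup>+ u. (\<integral>\<^sup>+ x. ennreal (normal_density 0 \<sigma> x) * ennreal (normal_density 0 \<tau> (u - x)) * indicator A (u, (u - x) - \<kappa> * x) \<partial>lborel) \<partial>lborel)"
      by (rule lborel_pair.Fubini') measurable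
    also have "\<dots> = (\<integral>\<^sup>+ u. (\<integral>\<^sup>+ z. ennreal (normal_density 0 s u) * ennreal (normal_density 0 (\<tau> * s / \<sigma>) z) * indicator A (u, z) \<partial>lborel) \<partial>lborel)"
    proof (rule nn_integral_cong)
      fix u :: real
      have e: "ennreal \<bar>-1 / (1 + \<kappa>)\<bar> * (ennreal (normal_density 0 \<sigma> ((u - z) / (1 + \<kappa>))) * ennreal (normal_density 0 \<tau> (u - (u - z) / (1 + \<kappa>))))
         = ennreal (normal_density 0 s u) * ennreal (normal_density 0 (\<tau> * s / \<sigma>) z)" for z
        using normal_density_rotate[OF X(2) Y(2), of u z, folded \<kappa>_def s_def] \<kappa>
        by (simp add: ennreal_mult'[symmetric] mult.commute)
      have x: "u / (1 + \<kappa>) + - 1 / (1 + \<kappa>) * z = (u - z) / (1 + \<kappa>)" for z by (simp add: diff_divide_distrib)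
      have w: "u - (u - z) / (1 + \<kappa>) - \<kappa> * ((u - z) / (1 + \<kappa>)) = z" for z
      proof -
        have "(1 + \<kappa>) * ((u - z) / (1 + \<kappa>)) = u - z" using \<kappa> by simp
        moreover have "u - X - \<kappa> * X = z" if "(1 + \<kappa>) * X = u - z" for X
          using that by (simp add: distrib_right)
        ultimately show ?thesis by blast
      qed
      show "(\<integral>\<^sup>+ x. ennreal (normal_density 0 \<sigma> x) * ennreal (normal_density 0 \<tau> (u - x)) * indicator A (u, (u - x) - \<kappa> * x) \<partial>lborel)
        = (\<integral>\<^sup>+ z. ennreal (normal_density 0 s u) * ennreal (normal_density 0 (\<tau> * s / \<sigma>) z) * indicator A (u, z) \<partial>lborel)"
        apply (subst nn_integral_real_affine[where c="-1/(1 + \<kappa>)" and t="u/(1 + \<kappa>)"])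
        subgoal by measurable
        subgoal using \<kappa> by simp
        apply (subst nn_integral_cmult[symmetric])
        subgoal by measurable
        apply (rule nn_integral_cong)
        subgoal for z unfolding x w e[symmetric] by (simp only: mult.assoc)
        done
    qed
    also have "\<dots> = emeasure (density (lborel \<Otimes>\<^sub>M lborel) (\<lambda>(u, z). ennreal (normal_density 0 s u) * ennreal (normal_density 0 (\<tau> * s / \<sigma>) z))) A"
      by (subst emeasure_density) (auto simp: lborel.nn_integral_fst[symmetric] case_prod_unfold)
    finally show "emeasure (distr M (lborel \<Otimes>\<^sub>M lborel) (\<lambda>\<omega>. (U \<omega>, Z \<omega>))) A =
      emeasure (density (lborel \<Otimes>\<^sub>M lborel) (\<lambda>x. case x of (u, z) \<Rightarrow> ennreal (normal_density 0 s u) * ennreal (normal_density 0 (\<tau> * s / \<sigma>) z))) A" .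
  qed auto
  have dU: "distributed M lborel U (normal_density 0 s)"
    using add_indep_normal[OF ind X(2) Y(2) X(1) Y(1)] by (simp add: U_def s_def)
  have dZ: "distributed M lborel Z (normal_density 0 (\<tau> * s / \<sigma>))"
  proof -
    have dX: "distributed M lborel (\<lambda>\<omega>. - \<kappa> * X \<omega>) (normal_density 0 (\<kappa> * \<sigma>))"
      using normal_density_affine[OF X(1), of "-\<kappa>" 0] X(2) \<kappa> by simp
    have "indep_var borel ((\<lambda>x. - \<kappa> * x) \<circ> X) borel ((\<lambda>y. y) \<circ> Y)"
      by (rule indep_var_compose[OF ind]) auto
    then have "indep_var borel (\<lambda>\<omega>. - \<kappa> * X \<omega>) borel Y" by (simp add: comp_def)
    from add_indep_normal[OF this _ Y(2) dX Y(1)] have "distributed M lborel Z (normal_density 0 (sqrt ((\<kappa> * \<sigma>)\<^sup>2 + \<tau>\<^sup>2)))"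
      using \<kappa> X(2) by (simp add: Z_def)
    moreover have "(\<kappa> * \<sigma>)\<^sup>2 + \<tau>\<^sup>2 = (\<tau> * s / \<sigma>)\<^sup>2"
      using X(2) by (simp add: \<kappa>_def s_def power_mult_distrib power_divide) (simp add: field_simps power2_eq_square power4_eq_xxxx)
    ultimately show ?thesis using X(2) Y(2) s by simp
  qed
  have "indep_var lborel U lborel Z"
    unfolding indep_var_distribution_eq
  proof (intro conjI)
    have pu: "prob_space (density lborel (\<lambda>x. ennreal (normal_density 0 (\<tau> * s / \<sigma>) x)))"
      using X(2) Y(2) s by (intro prob_space_normal_density) simp
    have "distr M lborel U \<Otimes>\<^sub>M distr M lborel Z =
      density lborel (\<lambda>x. ennreal (normal_density 0 s x)) \<Otimes>\<^sub>M density lborel (\<lambda>x. ennreal (normal_density 0 (\<tau> * s / \<sigma>) x))"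
      using dU dZ by (simp add: distributed_distr_eq_density)
    also have "\<dots> = density (lborel \<Otimes>\<^sub>M lborel) (\<lambda>(u, z). ennreal (normal_density 0 s u) * ennreal (normal_density 0 (\<tau> * s / \<sigma>) z))"
      using pu by (intro pair_measure_density)
        (auto intro: lborel.sigma_finite_measure_axioms prob_space_imp_sigma_finite)
    also have "\<dots> = distr M (lborel \<Otimes>\<^sub>M lborel) (\<lambda>\<omega>. (U \<omega>, Z \<omega>))"
      using distributed_distr_eq_density[OF dUZ] by simp
    finally show "distr M lborel U \<Otimes>\<^sub>M distr M lborel Z = distr M (lborel \<Otimes>\<^sub>M lborel) (\<lambda>\<omega>. (U \<omega>, Z \<omega>))" .
  qed auto
  then have "indep_var borel U borel Z" unfolding indep_var_eq by simp
  then show "indep_var borel (\<lambda>\<omega>. X \<omega> + Y \<omega>) borel (\<lambda>\<omega>. Y \<omega> - \<tau>\<^sup>2 / \<sigma>\<^sup>2 * X \<omega>)"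
    by (simp add: U_def Z_def \<kappa>_def)
  show "distributed M lborel (\<lambda>\<omega>. X \<omega> + Y \<omega>) (normal_density 0 (sqrt (\<sigma>\<^sup>2 + \<tau>\<^sup>2)))"
    using dU by (simp add: U_def s_def)
qed


text \<open>Gram--Schmidt for independent Gaussians, by induction on their number: adding one more
  variable rotates only the two-dimensional Gaussian \<open>(g, e\<^sub>n \<xi>\<^sub>n)\<close>.\<close>

lemma (in prob_space) normal_projection_indep:
  fixes \<xi> :: "nat \<Rightarrow> 'a \<Rightarrow> real" and e v :: "nat \<Rightarrow> real"
  assumes "0 < n" and "indep_vars (\<lambda>_. borel) \<xi> {..<n}"
    and "\<And>i. i < n \<Longrightarrow> 0 < v i" and "\<And>i. i < n \<Longrightarrow> e i \<noteq> 0"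
    and "\<And>i. i < n \<Longrightarrow> distributed M lborel (\<xi> i) (normal_density 0 (sqrt (v i)))"
  shows "distributed M lborel (\<lambda>\<omega>. \<Sum>i<n. e i * \<xi> i \<omega>) (normal_density 0 (sqrt (\<Sum>i<n. (e i)\<^sup>2 * v i))) \<and>
    indep_rv (PiM {..<n} (\<lambda>_. borel))
      (\<lambda>\<omega>. \<lambda>i\<in>{..<n}. \<xi> i \<omega> - e i * v i / (\<Sum>i<n. (e i)\<^sup>2 * v i) * (\<Sum>i<n. e i * \<xi> i \<omega>))
      borel (\<lambda>\<omega>. \<Sum>i<n. e i * \<xi> i \<omega>)"
  using assms
proof (induction n rule: nat_induct_non_zero)
  case 1
  have d: "distributed M lborel (\<lambda>\<omega>. e 0 * \<xi> 0 \<omega>) (normal_density 0 (sqrt ((e 0)\<^sup>2 * v 0)))"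
    using normal_density_affine[OF 1(4)[of 0], of "e 0" 0] 1 by (simp add: real_sqrt_mult)
  have [measurable]: "\<xi> 0 \<in> borel_measurable M" using distributed_measurable[OF 1(4)[of 0]] by simp
  \<comment> \<open>With a single variable the residual vanishes identically, so independence is
    trivial.\<close>
  have eq: "(\<lambda>\<omega>. \<lambda>i\<in>{..<1}. \<xi> i \<omega> - e i * v i / (\<Sum>i<1. (e i)\<^sup>2 * v i) * (\<Sum>i<1. e i * \<xi> i \<omega>))
    = (\<lambda>\<omega>. \<lambda>i\<in>{..<1}. 0)"
    using 1(2)[of 0] 1(3)[of 0] by (auto simp: fun_eq_iff restrict_def power2_eq_square)
  have "indep_rv (PiM {..<1} (\<lambda>_. borel)) (\<lambda>\<omega>. \<lambda>i\<in>{..<1::nat}. 0 :: real) borel (\<lambda>\<omega>. e 0 * \<xi> 0 \<omega>)"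
    unfolding indep_rv_def
  proof (intro conjI ballI)
    fix A :: "(nat \<Rightarrow> real) set" and B :: "real set" assume "B \<in> sets borel"
    have "(\<lambda>\<omega>. \<lambda>i\<in>{..<1::nat}. 0 :: real) -` A \<inter> space M = (if (\<lambda>i\<in>{..<1::nat}. 0) \<in> A then space M else {})" by auto
    then show "prob ((\<lambda>\<omega>. \<lambda>i\<in>{..<1::nat}. 0) -` A \<inter> space M \<inter> ((\<lambda>\<omega>. e 0 * \<xi> 0 \<omega>) -` B \<inter> space M)) =
        prob ((\<lambda>\<omega>. \<lambda>i\<in>{..<1::nat}. 0) -` A \<inter> space M) * prob ((\<lambda>\<omega>. e 0 * \<xi> 0 \<omega>) -` B \<inter> space M)"
      by (simp add: prob_space Int_absorb1)
  qed measurable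
  then show ?case unfolding eq using d by simp
next
  case (Suc n)
  define g where "g = (\<lambda>\<omega>. \<Sum>i<n. e i * \<xi> i \<omega>)"
  define q where "q = (\<Sum>i<n. (e i)\<^sup>2 * v i)"
  define R where "R = (\<lambda>\<omega>. \<lambda>i\<in>{..<n}. \<xi> i \<omega> - e i * v i / q * g \<omega>)"
  define g' where "g' = (\<lambda>\<omega>. \<Sum>i<Suc n. e i * \<xi> i \<omega>)"
  define q' where "q' = (\<Sum>i<Suc n. (e i)\<^sup>2 * v i)"
  define w where "w = (e n)\<^sup>2 * v n"
  \<comment> \<open>The combination of g and \<open>e n * \<xi> n\<close> that is uncorrelated with
    their sum g'.\<close>
  define Z where "Z = (\<lambda>\<omega>. e n * \<xi> n \<omega> - w / q * g \<omega>)"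
  have en: "e n \<noteq> 0" "v n > 0" using Suc.prems by auto
  then have w: "w > 0" by (simp add: w_def)
  have q: "q > 0" unfolding q_def using Suc.hyps Suc.prems by (intro sum_pos) auto
  have q': "q' = q + w" by (simp add: q'_def q_def w_def)
  have g': "g' = (\<lambda>\<omega>. g \<omega> + e n * \<xi> n \<omega>)" by (simp add: g'_def g_def)
  have iv: "indep_vars (\<lambda>_. borel) \<xi> {..<n}" by (rule indep_vars_subset[OF Suc.prems(1)]) auto
  have "distributed M lborel g (normal_density 0 (sqrt q)) \<and> indep_rv (PiM {..<n} (\<lambda>_. borel)) R borel g"
    unfolding R_def unfolding g_def q_def using Suc.prems by (intro Suc.IH[OF iv]) auto
  then have IH: "distributed M lborel g (normal_density 0 (sqrt q))" "indep_rv (PiM {..<n} (\<lambda>_. borel)) R borel g"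
    by blast+
  have \<xi>m[measurable]: "\<xi> i \<in> borel_measurable M" if "i < Suc n" for i
    using distributed_measurable[OF Suc.prems(4)[OF that]] by simp
  have dn: "distributed M lborel (\<lambda>\<omega>. e n * \<xi> n \<omega>) (normal_density 0 (sqrt w))"
    using normal_density_affine[OF Suc.prems(4)[of n], of "e n" 0] en by (simp add: real_sqrt_mult w_def)
  have "indep_rv (PiM {..<n} (\<lambda>_. borel)) (\<lambda>\<omega>. \<lambda>i\<in>{..<n}. \<xi> i \<omega>) (PiM {n} (\<lambda>_. borel)) (\<lambda>\<omega>. \<lambda>i\<in>{n}. \<xi> i \<omega>)"
    by (intro indep_var_imp_indep_rv indep_var_restrict[OF Suc.prems(1)]) auto
  then have 1: "indep_rv (PiM {..<n} (\<lambda>_. borel) \<Otimes>\<^sub>M borel) (\<lambda>\<omega>. (R \<omega>, g \<omega>)) borel (\<lambda>\<omega>. e n * \<xi> n \<omega>)"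
  proof -
    assume *: "indep_rv (PiM {..<n} (\<lambda>_. borel)) (\<lambda>\<omega>. \<lambda>i\<in>{..<n}. \<xi> i \<omega>) (PiM {n} (\<lambda>_. borel)) (\<lambda>\<omega>. \<lambda>i\<in>{n}. \<xi> i \<omega>)"
    let ?f = "\<lambda>x :: nat \<Rightarrow> real. (\<lambda>i\<in>{..<n}. x i - e i * v i / q * (\<Sum>i<n. e i * x i), \<Sum>i<n. e i * x i)"
    have "?f \<in> measurable (PiM {..<n} (\<lambda>_. borel)) (PiM {..<n} (\<lambda>_. borel) \<Otimes>\<^sub>M borel)"
      by (intro measurable_Pair measurable_restrict borel_measurable_diff borel_measurable_times
        borel_measurable_sum borel_measurable_const measurable_component_singleton) auto
    moreover have "(\<lambda>x :: nat \<Rightarrow> real. e n * x n) \<in> measurable (PiM {n} (\<lambda>_. borel)) borel"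
      by (intro borel_measurable_times borel_measurable_const measurable_component_singleton) auto
    moreover have "(\<lambda>\<omega>. ?f (\<lambda>i\<in>{..<n}. \<xi> i \<omega>)) = (\<lambda>\<omega>. (R \<omega>, g \<omega>))"
      by (simp add: R_def g_def fun_eq_iff restrict_def cong: sum.cong_simp)
    ultimately show ?thesis
      using indep_rv_compose[OF *, of ?f _ "\<lambda>x. e n * x n" borel] by simp
  qed
  have "indep_rv borel g borel (\<lambda>\<omega>. e n * \<xi> n \<omega>)"
    using indep_rv_compose[OF 1 measurable_snd measurable_ident] by simp
  from indep_rv_imp_indep_var[OF this]
  have gn: "distributed M lborel g' (normal_density 0 (sqrt q'))" "indep_rv borel Z borel g'"
    using normal_add_indep[OF IH(1) _ dn] q w
    by (auto simp: g' q' Z_def intro: indep_rv_sym indep_var_imp_indep_rv)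
  have "indep_rv (PiM {..<n} (\<lambda>_. borel)) R (borel \<Otimes>\<^sub>M borel) (\<lambda>\<omega>. (g \<omega>, e n * \<xi> n \<omega>))"
    by (rule indep_rv_pair_right[OF 1 IH(2)])
  from indep_rv_compose[OF this measurable_ident, of "\<lambda>(g, x). (x - w / q * g, g + x)" "borel \<Otimes>\<^sub>M borel"]
  have "indep_rv (PiM {..<n} (\<lambda>_. borel)) R (borel \<Otimes>\<^sub>M borel) (\<lambda>\<omega>. (Z \<omega>, g' \<omega>))"
    by (simp add: Z_def g')
  from indep_rv_pair_left[OF this gn(2)]
  have RZ: "indep_rv (PiM {..<n} (\<lambda>_. borel) \<Otimes>\<^sub>M borel) (\<lambda>\<omega>. (R \<omega>, Z \<omega>)) borel g'" .
  \<comment> \<open>Recovers the new residuals from the old ones and \<open>Z\<close>. Since g / q +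
    Z / q' = g' / q', an old residual only has to be corrected by a multiple of \<open>Z\<close>,
    and the last residual is itself a multiple of \<open>Z\<close>.\<close>
  let ?F = "\<lambda>(\<rho>, z). \<lambda>i\<in>{..<Suc n}. if i < n then \<rho> i - e i * v i / q' * z else z * q / (q' * e n)"
  have F: "?F \<in> measurable (PiM {..<n} (\<lambda>_. borel) \<Otimes>\<^sub>M borel) (PiM {..<Suc n} (\<lambda>_. borel :: real measure))"
  proof (unfold case_prod_unfold, rule measurable_restrict)
    fix i assume "i \<in> {..<Suc n}"
    show "(\<lambda>x. if i < n then fst x i - e i * v i / q' * snd x else snd x * q / (q' * e n))
       \<in> borel_measurable (PiM {..<n} (\<lambda>_. borel) \<Otimes>\<^sub>M borel)"
    proof (cases "i < n")
      case True
      then have [measurable]: "(\<lambda>x :: (nat \<Rightarrow> real) \<times> real. fst x i) \<in> borel_measurable (PiM {..<n} (\<lambda>_. borel) \<Otimes>\<^sub>M borel)"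
        by (intro measurable_compose[OF measurable_fst] measurable_component_singleton) auto
      from True show ?thesis by simp
    qed simp
  qed
  have "(\<lambda>\<omega>. ?F (R \<omega>, Z \<omega>)) = (\<lambda>\<omega>. \<lambda>i\<in>{..<Suc n}. \<xi> i \<omega> - e i * v i / q' * g' \<omega>)"
  proof (intro ext)
    fix \<omega> i
    have qq: "q' \<noteq> 0" "q \<noteq> 0" using q w q' by auto
    have a: "g \<omega> / q + Z \<omega> / q' = g' \<omega> / q'"
    proof -
      define G where "G = g \<omega> / q"
      have "g \<omega> = q * G" using qq by (simp add: G_def)
      moreover have "G + (x - w * G) / (q + w) = (q * G + x) / (q + w)" for x
        using qq by (simp add: q' field_simps)
      ultimately show ?thesis using qq by (simp add: Z_def g' q')
    qed
    have "\<xi> i \<omega> - e i * v i / q * g \<omega> - e i * v i / q' * Z \<omega> = \<xi> i \<omega> - e i * v i * (g \<omega> / q + Z \<omega> / q')"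
      by (simp add: algebra_simps)
    then have b: "\<xi> i \<omega> - e i * v i / q * g \<omega> - e i * v i / q' * Z \<omega> = \<xi> i \<omega> - e i * v i / q' * g' \<omega>"
      unfolding a by simp
    have "Z \<omega> * q / (q' * e n) = \<xi> n \<omega> - e n * v n / q' * g' \<omega>"
    proof -
      have "Z \<omega> * q = e n * \<xi> n \<omega> * q - w * g \<omega>"
        using qq by (simp add: Z_def left_diff_distrib)
      then have "Z \<omega> * q = e n * \<xi> n \<omega> * q' - w * g' \<omega>" by (simp add: g' q' algebra_simps)
      then show ?thesis using qq en by (simp add: w_def field_simps power2_eq_square)
    qed
    with b show "?F (R \<omega>, Z \<omega>) i = (\<lambda>i\<in>{..<Suc n}. \<xi> i \<omega> - e i * v i / q' * g' \<omega>) i"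
      by (auto simp: R_def restrict_def less_Suc_eq)
  qed
  with indep_rv_compose[OF RZ F measurable_ident]
  have "indep_rv (PiM {..<Suc n} (\<lambda>_. borel)) (\<lambda>\<omega>. \<lambda>i\<in>{..<Suc n}. \<xi> i \<omega> - e i * v i / q' * g' \<omega>) borel g'"
    by simp
  from conjI[OF gn(1) this] show ?case unfolding g'_def q'_def .
qed

text \<open>Beyond \<open>m\<close> the enumeration stays at the maximum, because
  \<open>standard_brownian_motion\<close> speaks of increments along monotone sequences indexed by
  all natural numbers.\<close>

lemma finite_set_enum_strict_mono:
  fixes K :: "'a::linorder set"
  assumes "finite K" "K \<noteq> {}"
  obtains m :: nat and \<tau> :: "nat \<Rightarrow> 'a" where "\<tau> ` {..m} = K" "\<And>i j. i < j \<Longrightarrow> j \<le> m \<Longrightarrow> \<tau> i < \<tau> j" "mono \<tau>"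
    "\<tau> 0 = Min K" "\<tau> m = Max K"
proof -
  define l where "l = sorted_list_of_set K"
  define m where "m = length l - 1"
  define \<tau> where "\<tau> i = l ! min i m" for i
  have l: "set l = K" "sorted_wrt (<) l" using assms by (auto simp: l_def)
  then have len: "length l > 0" using assms(2) by auto
  have st: "\<tau> i < \<tau> j" if "i < j" "j \<le> m" for i j
    using sorted_wrt_nth_less[OF l(2), of i j] that len by (simp add: \<tau>_def m_def)
  have mono: "mono \<tau>"
  proof (rule monoI)
    fix i j :: nat assume "i \<le> j"
    then show "\<tau> i \<le> \<tau> j"
      using st[of "min i m" "min j m"] by (cases "min i m = min j m") (auto simp: \<tau>_def min_def split: if_splits)
  qed
  have img: "\<tau> ` {..m} = K"
  proof -
    have "{..m} = {..<length l}" using len by (cases l) (auto simp: m_def)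
    moreover have "\<tau> ` {..m} = (!) l ` {..m}" by (auto simp: \<tau>_def)
    ultimately show ?thesis using l(1) by (simp add: nth_image lessThan_atLeast0)
  qed
  have "\<tau> 0 = Min K" "\<tau> m = Max K"
    unfolding img[symmetric] by (auto intro!: Min_eqI[symmetric] Max_eqI[symmetric] monoD[OF mono])
  from that[OF img st mono this] show thesis .
qed

text \<open>The sign flips at the grid point \<open>c\<close>, so the sum telescopes on either side
  of it. With \<open>c\<close> the midpoint it is used twice: for a Brownian path it gives the tent
  coefficient, for the identity it gives the tent itself.\<close>

lemma tent_telescope:
  fixes \<tau> :: "nat \<Rightarrow> real" and f :: "real \<Rightarrow> real"
  assumes st: "\<And>i j. i < j \<Longrightarrow> j \<le> m \<Longrightarrow> \<tau> i < \<tau> j" and c: "c \<in> \<tau> ` {..m}" and "k \<le> m" and "\<tau> 0 \<le> c"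
  shows "(\<Sum>i<k. (if \<tau> i < c then 1 else -1) * (f (\<tau> (Suc i)) - f (\<tau> i)))
    = (if \<tau> k \<le> c then f (\<tau> k) - f (\<tau> 0) else 2 * f c - f (\<tau> 0) - f (\<tau> k))"
  using assms(3)
proof (induction k)
  case 0
  then show ?case using assms(4) by simp
next
  case (Suc k)
  obtain j where j: "j \<le> m" "c = \<tau> j" using c by auto
  note IH = Suc.IH[OF Suc_leD[OF Suc.prems]]
  have le: "\<tau> i \<le> \<tau> j" if "i \<le> j" "j \<le> m" for i j using st[of i j] that by (cases "i = j") auto
  show ?case
  proof (cases "k < j")
    case True
    then have "\<tau> k < c" "\<tau> (Suc k) \<le> c" using st[of k j] le[of "Suc k" j] j by auto
    then show ?thesis using IH by simp
  next
    case False
    then have "c \<le> \<tau> k" "c < \<tau> (Suc k)" using st[of j "Suc k"] le[of j k] j Suc.prems by auto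
    then show ?thesis using IH by (cases "\<tau> k = c") auto
  qed
qed

text \<open>\<open>G\<close> is the integral against \<open>B\<close> of the slope of the tent, +1
  on the first half and -1 on the second. It has variance T and covariance
  \<open>min s (T - s)\<close> with the increment from 0 to s, so the subtracted term is the
  Gaussian regression of the path on \<open>G\<close>. On a finite grid this is
  \<open>normal_projection_indep\<close> with coefficients +1 and -1 applied to the
  increments.\<close>

lemma (in prob_space) brownian_tent_indep:
  fixes B :: "real \<Rightarrow> 'a \<Rightarrow> real"
  assumes bm: "standard_brownian_motion M B" and T: "T > 0"
  defines "G \<equiv> \<lambda>\<omega>. 2 * B (T/2) \<omega> - B 0 \<omega> - B T \<omega>"
  shows "distributed M lborel G (normal_density 0 (sqrt T))"
    and "indep_rv (PiM {0..T} (\<lambda>_. borel)) (\<lambda>\<omega>. \<lambda>s\<in>{0..T}. B s \<omega> - B 0 \<omega> - min s (T - s) / T * G \<omega>) borel G"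
proof -
  have Bm[measurable]: "B s \<in> borel_measurable M" if "s \<ge> 0" for s
    using bm that by (auto simp: standard_brownian_motion_def)
  have incr: "indep_vars (\<lambda>_. borel) (\<lambda>i \<omega>. B (\<tau> (Suc i)) \<omega> - B (\<tau> i) \<omega>) UNIV"
    if "0 \<le> \<tau> 0" "mono \<tau>" for \<tau> :: "nat \<Rightarrow> real"
    using bm that by (simp add: standard_brownian_motion_def)
  have norm: "distributed M lborel (\<lambda>\<omega>. B t \<omega> - B s \<omega>) (normal_density 0 (sqrt (t - s)))"
    if "0 \<le> s" "s < t" for s t
    using bm that by (simp add: standard_brownian_motion_def)
  have Gm[measurable]: "G \<in> borel_measurable M" unfolding G_def using T by (intro borel_measurable_diff borel_measurable_times borel_measurable_const Bm) auto
  define W where "W s \<omega> = B s \<omega> - B 0 \<omega> - min s (T - s) / T * G \<omega>" for s \<omega>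
  have Wm[measurable]: "W s \<in> borel_measurable M" if "s \<ge> 0" for s
    unfolding W_def using that by measurable
  have fin: "distributed M lborel G (normal_density 0 (sqrt T)) \<and>
    indep_rv (PiM J (\<lambda>_. borel)) (\<lambda>\<omega>. \<lambda>s\<in>J. W s \<omega>) borel G" if J: "finite J" "J \<subseteq> {0..T}" for J
  proof -
    \<comment> \<open>The three added times make \<open>G\<close> a combination of grid increments
      and keep the sign constant on each grid interval.\<close>
    have K: "finite (J \<union> {0, T/2, T})" "J \<union> {0, T/2, T} \<noteq> {}" using J by auto
    obtain m :: nat and \<tau> :: "nat \<Rightarrow> real" where \<tau>: "\<tau> ` {..m} = J \<union> {0, T/2, T}" "\<And>i j. i < j \<Longrightarrow> j \<le> m \<Longrightarrow> \<tau> i < \<tau> j" "mono \<tau>"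
      "\<tau> 0 = Min (J \<union> {0, T/2, T})" "\<tau> m = Max (J \<union> {0, T/2, T})"
      by (rule finite_set_enum_strict_mono[OF K]) (rule that; assumption)
    have range: "\<tau> i \<in> {0..T}" if "i \<le> m" for i
    proof -
      have "\<tau> i \<in> J \<union> {0, T/2, T}" using that \<tau>(1) by blast
      then show ?thesis using J(2) T by auto
    qed
    have \<tau>0: "\<tau> 0 = 0" unfolding \<tau>(4) by (rule Min_eqI) (use J T in auto)
    have \<tau>m: "\<tau> m = T" unfolding \<tau>(5) by (rule Max_eqI) (use J T in auto)
    have m: "m > 0" using \<tau>0 \<tau>m T by (cases m) auto
    define \<xi> where "\<xi> i \<omega> = B (\<tau> (Suc i)) \<omega> - B (\<tau> i) \<omega>" for i \<omega>
    define e :: "nat \<Rightarrow> real" where "e i = (if \<tau> i < T/2 then 1 else -1)" for i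
    define v where "v i = \<tau> (Suc i) - \<tau> i" for i
    have tel: "(\<Sum>i<k. e i * (f (\<tau> (Suc i)) - f (\<tau> i)))
      = (if \<tau> k \<le> T/2 then f (\<tau> k) - f 0 else 2 * f (T/2) - f 0 - f (\<tau> k))" if "k \<le> m" for f :: "real \<Rightarrow> real" and k
      using tent_telescope[of m \<tau> "T/2" k f, OF \<tau>(2)] \<tau>(1) that T unfolding e_def \<tau>0 by simp
    have g: "(\<Sum>i<m. e i * \<xi> i \<omega>) = G \<omega>" for \<omega>
      using tel[of m "\<lambda>s. B s \<omega>"] T by (simp add: \<xi>_def \<tau>m G_def)
    have q: "(\<Sum>i<m. (e i)\<^sup>2 * v i) = T"
    proof -
      have "(\<Sum>i<m. (e i)\<^sup>2 * v i) = (\<Sum>i<m. \<tau> (Suc i) - \<tau> i)"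
        by (intro sum.cong) (auto simp: e_def v_def)
      also have "\<dots> = T" by (subst sum_lessThan_telescope) (simp add: \<tau>0 \<tau>m)
      finally show ?thesis .
    qed
    have ev: "(\<Sum>i<k. e i * v i) = min (\<tau> k) (T - \<tau> k)" if "k \<le> m" for k
      using tel[OF that, of "\<lambda>s. s"] by (auto simp: v_def min_def)
    have "distributed M lborel (\<lambda>\<omega>. \<Sum>i<m. e i * \<xi> i \<omega>) (normal_density 0 (sqrt (\<Sum>i<m. (e i)\<^sup>2 * v i))) \<and>
      indep_rv (PiM {..<m} (\<lambda>_. borel))
        (\<lambda>\<omega>. \<lambda>i\<in>{..<m}. \<xi> i \<omega> - e i * v i / (\<Sum>i<m. (e i)\<^sup>2 * v i) * (\<Sum>i<m. e i * \<xi> i \<omega>))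
        borel (\<lambda>\<omega>. \<Sum>i<m. e i * \<xi> i \<omega>)"
    proof (rule normal_projection_indep[OF m])
      show "indep_vars (\<lambda>_. borel) \<xi> {..<m}" unfolding \<xi>_def
        by (rule indep_vars_subset[OF incr]) (use \<tau>0 \<tau>(3) in auto)
      fix i assume i: "i < m"
      show "0 < v i" using \<tau>(2)[of i "Suc i"] i by (simp add: v_def)
      show "e i \<noteq> 0" by (simp add: e_def)
      show "distributed M lborel (\<xi> i) (normal_density 0 (sqrt (v i)))"
        unfolding \<xi>_def v_def using range[of i] \<tau>(2)[of i "Suc i"] i by (intro norm) auto
    qed
    then have G: "distributed M lborel G (normal_density 0 (sqrt T))"
      and ind: "indep_rv (PiM {..<m} (\<lambda>_. borel)) (\<lambda>\<omega>. \<lambda>i\<in>{..<m}. \<xi> i \<omega> - e i * v i / T * G \<omega>) borel G"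
      unfolding g q by auto
    have "\<forall>s\<in>J. \<exists>k\<le>m. \<tau> k = s" using \<tau>(1) by (metis Un_iff atMost_iff imageE)
    then obtain k where k: "\<And>s. s \<in> J \<Longrightarrow> k s \<le> m" "\<And>s. s \<in> J \<Longrightarrow> \<tau> (k s) = s" by metis
    let ?F = "\<lambda>\<rho> :: nat \<Rightarrow> real. \<lambda>s\<in>J. \<Sum>i<k s. \<rho> i"
    have F: "?F \<in> measurable (PiM {..<m} (\<lambda>_. borel)) (PiM J (\<lambda>_. borel))"
    proof (intro measurable_restrict borel_measurable_sum measurable_component_singleton)
      fix s i assume "s \<in> J" "i \<in> {..<k s}"
      then show "i \<in> {..<m}" using k(1)[of s] by auto
    qed
    have "(\<lambda>\<omega>. ?F (\<lambda>i\<in>{..<m}. \<xi> i \<omega> - e i * v i / T * G \<omega>)) = (\<lambda>\<omega>. \<lambda>s\<in>J. W s \<omega>)"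
    proof (intro ext)
      fix \<omega> s
      show "?F (\<lambda>i\<in>{..<m}. \<xi> i \<omega> - e i * v i / T * G \<omega>) s = (\<lambda>s\<in>J. W s \<omega>) s"
      proof (cases "s \<in> J")
        case True
        note ks = k(1)[OF True] k(2)[OF True]
        have "(\<Sum>i<k s. (\<lambda>i\<in>{..<m}. \<xi> i \<omega> - e i * v i / T * G \<omega>) i) = (\<Sum>i<k s. \<xi> i \<omega> - e i * v i / T * G \<omega>)"
          using ks by (intro sum.cong) auto
        also have "\<dots> = (\<Sum>i<k s. \<xi> i \<omega>) - (\<Sum>i<k s. e i * v i) / T * G \<omega>"
          by (simp add: sum_subtractf sum_distrib_right sum_divide_distrib)
        also have "(\<Sum>i<k s. \<xi> i \<omega>) = B s \<omega> - B 0 \<omega>"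
          unfolding \<xi>_def using sum_lessThan_telescope[of "\<lambda>i. B (\<tau> i) \<omega>" "k s"] by (simp add: ks \<tau>0)
        finally show ?thesis using True by (simp add: W_def ev ks)
      qed simp
    qed
    with indep_rv_compose[OF ind F measurable_ident]
    show ?thesis using G by simp
  qed
  show "distributed M lborel G (normal_density 0 (sqrt T))" using fin[of "{}"] by simp
  show "indep_rv (PiM {0..T} (\<lambda>_. borel)) (\<lambda>\<omega>. \<lambda>s\<in>{0..T}. B s \<omega> - B 0 \<omega> - min s (T - s) / T * G \<omega>) borel G"
    unfolding W_def[symmetric]
  proof (rule indep_rv_PiM_finite)
    show "random_variable borel (W s)" if "s \<in> {0..T}" for s using that by (intro Wm) simp
    show "indep_rv (PiM J (\<lambda>_. borel)) (\<lambda>\<omega>. \<lambda>s\<in>J. W s \<omega>) borel G" if "finite J" "J \<subseteq> {0..T}" for J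
      using fin[OF that] by blast
  qed (rule Gm)
qed

lemma (in prob_space) brownian_pair_tent_indep:
  assumes ind: "independent_brownian_motions M B1 B2" and T: "T > 0"
  defines "G \<equiv> \<lambda>\<omega>. 2 * B2 (T/2) \<omega> - B2 0 \<omega> - B2 T \<omega>"
  shows "indep_rv (PiM {0..T} (\<lambda>_. borel) \<Otimes>\<^sub>M PiM {0..T} (\<lambda>_. borel))
    (\<lambda>\<omega>. (\<lambda>s\<in>{0..T}. B1 s \<omega>, \<lambda>s\<in>{0..T}. B2 s \<omega> - B2 0 \<omega> - min s (T - s) / T * G \<omega>)) borel G"
proof (rule indep_rv_pair_left)
  have bm: "standard_brownian_motion M B2" and
    12: "indep_var (PiM {0..} (\<lambda>_. borel)) (\<lambda>\<omega>. \<lambda>t\<in>{0..}. B1 t \<omega>) (PiM {0..} (\<lambda>_. borel)) (\<lambda>\<omega>. \<lambda>t\<in>{0..}. B2 t \<omega>)"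
    using ind by (auto simp: independent_brownian_motions_def)
  show "indep_rv (PiM {0..T} (\<lambda>_. borel)) (\<lambda>\<omega>. \<lambda>s\<in>{0..T}. B2 s \<omega> - B2 0 \<omega> - min s (T - s) / T * G \<omega>) borel G"
    unfolding G_def by (rule brownian_tent_indep(2)[OF bm T])
  let ?g = "\<lambda>x :: real \<Rightarrow> real. 2 * x (T/2) - x 0 - x T"
  let ?f1 = "\<lambda>x :: real \<Rightarrow> real. \<lambda>s\<in>{0..T}. x s"
  let ?f2 = "\<lambda>x :: real \<Rightarrow> real. (\<lambda>s\<in>{0..T}. x s - x 0 - min s (T - s) / T * ?g x, ?g x)"
  have "?f1 \<in> measurable (PiM {0..} (\<lambda>_. borel)) (PiM {0..T} (\<lambda>_. borel))"
    by (intro measurable_restrict measurable_component_singleton) auto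
  moreover have "?f2 \<in> measurable (PiM {0..} (\<lambda>_. borel)) (PiM {0..T} (\<lambda>_. borel) \<Otimes>\<^sub>M borel)"
    using T by (intro measurable_Pair measurable_restrict borel_measurable_diff borel_measurable_times
      borel_measurable_const measurable_component_singleton) auto
  ultimately have "indep_rv (PiM {0..T} (\<lambda>_. borel)) (\<lambda>\<omega>. ?f1 (\<lambda>t\<in>{0..}. B1 t \<omega>))
     (PiM {0..T} (\<lambda>_. borel) \<Otimes>\<^sub>M borel) (\<lambda>\<omega>. ?f2 (\<lambda>t\<in>{0..}. B2 t \<omega>))"
    by (rule indep_rv_compose[OF indep_var_imp_indep_rv[OF 12]])
  moreover have "(\<lambda>\<omega>. ?f1 (\<lambda>t\<in>{0..}. B1 t \<omega>)) = (\<lambda>\<omega>. \<lambda>s\<in>{0..T}. B1 s \<omega>)"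
    by (auto simp: fun_eq_iff restrict_def)
  moreover have "(\<lambda>\<omega>. ?f2 (\<lambda>t\<in>{0..}. B2 t \<omega>)) =
     (\<lambda>\<omega>. (\<lambda>s\<in>{0..T}. B2 s \<omega> - B2 0 \<omega> - min s (T - s) / T * G \<omega>, G \<omega>))"
    using T by (auto simp: fun_eq_iff restrict_def G_def)
  ultimately show "indep_rv (PiM {0..T} (\<lambda>_. borel)) (\<lambda>\<omega>. \<lambda>s\<in>{0..T}. B1 s \<omega>)
     (PiM {0..T} (\<lambda>_. borel) \<Otimes>\<^sub>M borel)
     (\<lambda>\<omega>. (\<lambda>s\<in>{0..T}. B2 s \<omega> - B2 0 \<omega> - min s (T - s) / T * G \<omega>, G \<omega>))"
    by simp
qed

section \<open>The Ito isometry and dyadic sums\<close>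

text \<open>The properties of integrand and integrator that the dyadic approximation uses; the Levy
  area needs it for both orders of the two Brownian motions over one filtration.
  \<open>H_variance\<close> is the mean-square modulus of continuity that makes the dyadic error
  geometric.\<close>

locale ito_integrand = prob_space M for M :: "'a measure" +
  fixes F :: "real \<Rightarrow> 'a measure" and H W :: "real \<Rightarrow> 'a \<Rightarrow> real"
  assumes F_imp_M: "0 \<le> s \<Longrightarrow> (X :: 'a \<Rightarrow> real) \<in> borel_measurable (F s) \<Longrightarrow> X \<in> borel_measurable M"
    and F_mono: "0 \<le> s \<Longrightarrow> s \<le> t \<Longrightarrow> (X :: 'a \<Rightarrow> real) \<in> borel_measurable (F s) \<Longrightarrow> X \<in> borel_measurable (F t)"
    and W_adapted: "0 \<le> s \<Longrightarrow> W s \<in> borel_measurable (F s)"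
    and H_adapted: "0 \<le> s \<Longrightarrow> H s \<in> borel_measurable (F s)"
    and W_indep: "0 \<le> s \<Longrightarrow> s \<le> t \<Longrightarrow> (X :: 'a \<Rightarrow> real) \<in> borel_measurable (F s) \<Longrightarrow>
      indep_rv borel X borel (\<lambda>\<omega>. W t \<omega> - W s \<omega>)"
    and W_mean: "0 \<le> s \<Longrightarrow> s \<le> t \<Longrightarrow> expectation (\<lambda>\<omega>. W t \<omega> - W s \<omega>) = 0"
    and W_square: "0 \<le> s \<Longrightarrow> s \<le> t \<Longrightarrow> integrable M (\<lambda>\<omega>. (W t \<omega> - W s \<omega>)\<^sup>2)"
    and W_variance: "0 \<le> s \<Longrightarrow> s \<le> t \<Longrightarrow> expectation (\<lambda>\<omega>. (W t \<omega> - W s \<omega>)\<^sup>2) = t - s"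
    and H_variance: "0 \<le> s \<Longrightarrow> s \<le> t \<Longrightarrow> (\<integral>\<^sup>+ \<omega>. ennreal ((H t \<omega> - H s \<omega>)\<^sup>2) \<partial>M) = ennreal (t - s)"
    and H_zero: "AE \<omega> in M. H 0 \<omega> = 0"
    and H_continuous: "AE \<omega> in M. continuous_on {0..} (\<lambda>t. H t \<omega>)"
begin

lemma W_measurable[measurable]: "0 \<le> s \<Longrightarrow> W s \<in> borel_measurable M"
  using W_adapted F_imp_M by blast

lemma H_measurable[measurable]: "0 \<le> s \<Longrightarrow> H s \<in> borel_measurable M"
  using H_adapted F_imp_M by blast

lemma integrable_mult_square:
  assumes "f \<in> borel_measurable M" "g \<in> borel_measurable M"
    and "integrable M (\<lambda>\<omega>. (f \<omega>)\<^sup>2)" "integrable M (\<lambda>\<omega>. (g \<omega>)\<^sup>2)"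
  shows "integrable M (\<lambda>\<omega>. f \<omega> * g \<omega> :: real)"
proof (rule Bochner_Integration.integrable_bound)
  show "integrable M (\<lambda>\<omega>. (f \<omega>)\<^sup>2 + (g \<omega>)\<^sup>2)" using assms by simp
  show "AE \<omega> in M. norm (f \<omega> * g \<omega>) \<le> norm ((f \<omega>)\<^sup>2 + (g \<omega>)\<^sup>2)"
  proof (rule AE_I2)
    fix \<omega>
    have "0 \<le> (\<bar>f \<omega>\<bar> - \<bar>g \<omega>\<bar>)\<^sup>2" by simp
    then have "2 * (\<bar>f \<omega>\<bar> * \<bar>g \<omega>\<bar>) \<le> (f \<omega>)\<^sup>2 + (g \<omega>)\<^sup>2"
      by (simp add: power2_eq_square algebra_simps abs_mult[symmetric])
    moreover have "0 \<le> \<bar>f \<omega>\<bar> * \<bar>g \<omega>\<bar>" by simp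
    ultimately have "\<bar>f \<omega>\<bar> * \<bar>g \<omega>\<bar> \<le> (f \<omega>)\<^sup>2 + (g \<omega>)\<^sup>2" by linarith
    then show "norm (f \<omega> * g \<omega>) \<le> norm ((f \<omega>)\<^sup>2 + (g \<omega>)\<^sup>2)"
      by (simp add: abs_mult)
  qed
qed (use assms in measurable)

lemma increment_integrable:
  assumes "0 \<le> s" "s \<le> t"
  shows "integrable M (\<lambda>\<omega>. W t \<omega> - W s \<omega>)"
  using integrable_mult_square[of "\<lambda>\<omega>. W t \<omega> - W s \<omega>" "\<lambda>_. 1"] assms W_square by simp

lemma past_times_increment:
  assumes st: "0 \<le> s" "s \<le> t" and P: "P \<in> borel_measurable (F s)" "integrable M P"
  shows "integrable M (\<lambda>\<omega>. P \<omega> * (W t \<omega> - W s \<omega>))" "expectation (\<lambda>\<omega>. P \<omega> * (W t \<omega> - W s \<omega>)) = 0"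
    and "integrable M (\<lambda>\<omega>. P \<omega> * (W t \<omega> - W s \<omega>)\<^sup>2)"
    and "expectation (\<lambda>\<omega>. P \<omega> * (W t \<omega> - W s \<omega>)\<^sup>2) = expectation P * (t - s)"
proof -
  have ind: "indep_var borel P borel (\<lambda>\<omega>. W t \<omega> - W s \<omega>)"
    by (rule indep_rv_imp_indep_var[OF W_indep[OF st P(1)]])
  show "integrable M (\<lambda>\<omega>. P \<omega> * (W t \<omega> - W s \<omega>))"
    by (rule indep_var_integrable[OF ind P(2) increment_integrable[OF st]])
  show "expectation (\<lambda>\<omega>. P \<omega> * (W t \<omega> - W s \<omega>)) = 0"
    by (subst indep_var_lebesgue_integral[OF ind P(2) increment_integrable[OF st]]) (simp add: W_mean[OF st])
  have "indep_rv borel P borel (\<lambda>\<omega>. (W t \<omega> - W s \<omega>)\<^sup>2)"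
    by (rule indep_rv_compose[OF W_indep[OF st P(1)], of "\<lambda>x. x" _ "\<lambda>x. x\<^sup>2"]) auto
  then have ind2: "indep_var borel P borel (\<lambda>\<omega>. (W t \<omega> - W s \<omega>)\<^sup>2)" by (rule indep_rv_imp_indep_var)
  show "integrable M (\<lambda>\<omega>. P \<omega> * (W t \<omega> - W s \<omega>)\<^sup>2)"
    by (rule indep_var_integrable[OF ind2 P(2) W_square[OF st]])
  show "expectation (\<lambda>\<omega>. P \<omega> * (W t \<omega> - W s \<omega>)\<^sup>2) = expectation P * (t - s)"
    by (subst indep_var_lebesgue_integral[OF ind2 P(2) W_square[OF st]]) (simp add: W_variance[OF st])
qed

lemma step_increment_square:
  assumes st: "0 \<le> s" "s \<le> t" and \<xi>: "\<xi> \<in> borel_measurable (F s)" "integrable M (\<lambda>\<omega>. (\<xi> \<omega>)\<^sup>2)"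
  shows "integrable M (\<lambda>\<omega>. (\<xi> \<omega> * (W t \<omega> - W s \<omega>))\<^sup>2)"
  using past_times_increment(3)[OF st _ \<xi>(2)] \<xi>(1) by (simp add: power_mult_distrib)

text \<open>Two elementary processes have unrelated partitions. Instead of passing to a common
  refinement, each pair of steps is evaluated directly and contributes the mean of \<xi> * \<eta>
  times the length of the overlap of the two intervals. Here the second interval starts no earlier
  than the first.\<close>

lemma cross_increments_aux:
  assumes ab: "0 \<le> a" "a \<le> b" and cd: "a \<le> c" "c \<le> d"
    and \<xi>: "\<xi> \<in> borel_measurable (F a)" "integrable M (\<lambda>\<omega>. (\<xi> \<omega>)\<^sup>2)"
    and \<eta>: "\<eta> \<in> borel_measurable (F c)" "integrable M (\<lambda>\<omega>. (\<eta> \<omega>)\<^sup>2)"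
  shows "expectation (\<lambda>\<omega>. (\<xi> \<omega> * (W b \<omega> - W a \<omega>)) * (\<eta> \<omega> * (W d \<omega> - W c \<omega>)))
    = expectation (\<lambda>\<omega>. \<xi> \<omega> * \<eta> \<omega>) * max 0 (min b d - c)"
proof -
  have 0: "0 \<le> c" "0 \<le> b" "0 \<le> d" using ab cd by auto
  have \<xi>c: "\<xi> \<in> borel_measurable (F c)" using F_mono[OF ab(1) cd(1) \<xi>(1)] .
  have Mm: "\<xi> \<in> borel_measurable M" "\<eta> \<in> borel_measurable M" using F_imp_M \<xi>(1) \<eta>(1) ab 0 by blast+
  \<comment> \<open>the part of the first increment that precedes \<open>c\<close> does not contribute\<close>
  have past: "integrable M (\<lambda>\<omega>. (\<xi> \<omega> * (W u \<omega> - W a \<omega>)) * \<eta> \<omega> * (W d \<omega> - W c \<omega>))"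
    "expectation (\<lambda>\<omega>. (\<xi> \<omega> * (W u \<omega> - W a \<omega>)) * \<eta> \<omega> * (W d \<omega> - W c \<omega>)) = 0" if "a \<le> u" "u \<le> c" for u
  proof -
    have "W u \<in> borel_measurable (F c)" "W a \<in> borel_measurable (F c)"
      using F_mono[OF _ that(2) W_adapted] F_mono[OF _ cd(1) W_adapted] ab that by auto
    then have m: "(\<lambda>\<omega>. (\<xi> \<omega> * (W u \<omega> - W a \<omega>)) * \<eta> \<omega>) \<in> borel_measurable (F c)"
      using \<xi>c \<eta>(1) by measurable
    have "integrable M (\<lambda>\<omega>. (\<xi> \<omega> * (W u \<omega> - W a \<omega>)) * \<eta> \<omega>)"
      using ab that 0 Mm \<eta>(2) step_increment_square[OF ab(1) that(1) \<xi>]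
      by (intro integrable_mult_square) auto
    from past_times_increment[OF 0(1) cd(2) m this]
    show "integrable M (\<lambda>\<omega>. (\<xi> \<omega> * (W u \<omega> - W a \<omega>)) * \<eta> \<omega> * (W d \<omega> - W c \<omega>))"
      "expectation (\<lambda>\<omega>. (\<xi> \<omega> * (W u \<omega> - W a \<omega>)) * \<eta> \<omega> * (W d \<omega> - W c \<omega>)) = 0" by auto
  qed
  show ?thesis
  proof (cases "b \<le> c")
    case True
    then show ?thesis using past(2)[OF ab(2) True] by (simp add: mult.assoc max_def)
  next
    case False
    let ?P = "\<lambda>\<omega>. \<xi> \<omega> * \<eta> \<omega>"
    have P: "?P \<in> borel_measurable (F c)" "integrable M ?P"
      using \<xi>c \<eta> \<xi> Mm by (auto intro: integrable_mult_square)
    define m where "m = min b d"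
    have m: "c \<le> m" "m \<le> b" "m \<le> d" "m = b \<or> m = d" "0 \<le> m" using False cd 0 by (auto simp: m_def)
    note sq = past_times_increment(3,4)[OF 0(1) m(1) P]
    have Q: "(\<lambda>\<omega>. ?P \<omega> * (W m \<omega> - W c \<omega>)) \<in> borel_measurable (F m)" "integrable M (\<lambda>\<omega>. ?P \<omega> * (W m \<omega> - W c \<omega>))"
      using F_mono[OF 0(1) m(1) P(1)] F_mono[OF 0(1) m(1) W_adapted[OF 0(1)]] W_adapted[OF m(5)]
        past_times_increment(1)[OF 0(1) m(1) P] by auto
    \<comment> \<open>beyond \<open>m = min b d\<close> only one of the two increments continues\<close>
    have fut: "integrable M (\<lambda>\<omega>. ?P \<omega> * (W m \<omega> - W c \<omega>) * ((W b \<omega> - W m \<omega>) + (W d \<omega> - W m \<omega>)))"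
      "expectation (\<lambda>\<omega>. ?P \<omega> * (W m \<omega> - W c \<omega>) * ((W b \<omega> - W m \<omega>) + (W d \<omega> - W m \<omega>))) = 0"
      using m(4) past_times_increment(1,2)[OF m(5) m(2) Q] past_times_increment(1,2)[OF m(5) m(3) Q] by auto
    have ptw: "(\<xi> \<omega> * (W b \<omega> - W a \<omega>)) * (\<eta> \<omega> * (W d \<omega> - W c \<omega>)) =
       (\<xi> \<omega> * (W c \<omega> - W a \<omega>)) * \<eta> \<omega> * (W d \<omega> - W c \<omega>) + (?P \<omega> * (W m \<omega> - W c \<omega>)\<^sup>2
       + ?P \<omega> * (W m \<omega> - W c \<omega>) * ((W b \<omega> - W m \<omega>) + (W d \<omega> - W m \<omega>)))" for \<omega>
      using m(4) by (auto simp: algebra_simps power2_eq_square)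
    have "expectation (\<lambda>\<omega>. (\<xi> \<omega> * (W b \<omega> - W a \<omega>)) * (\<eta> \<omega> * (W d \<omega> - W c \<omega>))) =
      expectation ?P * (m - c)"
      unfolding ptw using past[OF cd(1) order_refl] sq fut by simp
    then show ?thesis using m(1) by (simp add: m_def max_def)
  qed
qed

lemma cross_increments:
  assumes ab: "0 \<le> a" "a \<le> b" and cd: "0 \<le> c" "c \<le> d"
    and \<xi>: "\<xi> \<in> borel_measurable (F a)" "integrable M (\<lambda>\<omega>. (\<xi> \<omega>)\<^sup>2)"
    and \<eta>: "\<eta> \<in> borel_measurable (F c)" "integrable M (\<lambda>\<omega>. (\<eta> \<omega>)\<^sup>2)"
  shows "expectation (\<lambda>\<omega>. (\<xi> \<omega> * (W b \<omega> - W a \<omega>)) * (\<eta> \<omega> * (W d \<omega> - W c \<omega>)))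
    = expectation (\<lambda>\<omega>. \<xi> \<omega> * \<eta> \<omega>) * max 0 (min b d - max a c)"
proof (cases "a \<le> c")
  case True
  then show ?thesis using cross_increments_aux[OF ab True cd(2) \<xi> \<eta>] by (simp add: max_def)
next
  case False
  then have "c \<le> a" by simp
  have "expectation (\<lambda>\<omega>. (\<xi> \<omega> * (W b \<omega> - W a \<omega>)) * (\<eta> \<omega> * (W d \<omega> - W c \<omega>)))
    = expectation (\<lambda>\<omega>. (\<eta> \<omega> * (W d \<omega> - W c \<omega>)) * (\<xi> \<omega> * (W b \<omega> - W a \<omega>)))" by (simp add: mult.commute)
  also have "\<dots> = expectation (\<lambda>\<omega>. \<eta> \<omega> * \<xi> \<omega>) * max 0 (min d b - a)"
    by (rule cross_increments_aux[OF cd \<open>c \<le> a\<close> ab(2) \<eta> \<xi>])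
  finally show ?thesis using False by (simp add: mult.commute min.commute max_def)
qed

text \<open>Both sides expand to the mean of the double sum of \<xi> i * \<xi> j times the length of
  the overlap of intervals i and j. The intervals may overlap arbitrarily, which is what differences
  of elementary processes produce.\<close>

lemma isometry_sum:
  fixes \<xi> :: "'i \<Rightarrow> 'a \<Rightarrow> real"
  assumes fin: "finite I" and ab: "\<And>i. i \<in> I \<Longrightarrow> 0 \<le> a i \<and> a i \<le> b i \<and> b i \<le> T"
    and \<xi>: "\<And>i. i \<in> I \<Longrightarrow> \<xi> i \<in> borel_measurable (F (a i))" "\<And>i. i \<in> I \<Longrightarrow> integrable M (\<lambda>\<omega>. (\<xi> i \<omega>)\<^sup>2)"
  shows "(\<integral>\<^sup>+ \<omega>. ennreal ((\<Sum>i\<in>I. \<xi> i \<omega> * (W (b i) \<omega> - W (a i) \<omega>))\<^sup>2) \<partial>M)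
    = (\<integral>\<^sup>+ \<omega>. (\<integral>\<^sup>+ r\<in>{0..T}. ennreal ((\<Sum>i\<in>I. \<xi> i \<omega> * indicator {a i<..b i} r)\<^sup>2) \<partial>lborel) \<partial>M)"
proof -
  let ?l = "\<lambda>i j. max 0 (min (b i) (b j) - max (a i) (a j))"
  have \<xi>M: "\<xi> i \<in> borel_measurable M" if "i \<in> I" for i using F_imp_M ab \<xi>(1) that by blast
  have \<xi>\<xi>: "integrable M (\<lambda>\<omega>. \<xi> i \<omega> * \<xi> j \<omega>)" if "i \<in> I" "j \<in> I" for i j
    using that \<xi>M \<xi>(2) by (intro integrable_mult_square) auto
  have X2: "integrable M (\<lambda>\<omega>. (\<xi> i \<omega> * (W (b i) \<omega> - W (a i) \<omega>)) * (\<xi> j \<omega> * (W (b j) \<omega> - W (a j) \<omega>)))"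
    if "i \<in> I" "j \<in> I" for i j
  proof (rule integrable_mult_square)
    have *: "(\<lambda>\<omega>. \<xi> i \<omega> * (W (b i) \<omega> - W (a i) \<omega>)) \<in> borel_measurable M"
      "integrable M (\<lambda>\<omega>. (\<xi> i \<omega> * (W (b i) \<omega> - W (a i) \<omega>))\<^sup>2)" if "i \<in> I" for i
    proof -
      have "0 \<le> a i" "a i \<le> b i" "0 \<le> b i" using ab[OF that] by auto
      then show "(\<lambda>\<omega>. \<xi> i \<omega> * (W (b i) \<omega> - W (a i) \<omega>)) \<in> borel_measurable M"
        "integrable M (\<lambda>\<omega>. (\<xi> i \<omega> * (W (b i) \<omega> - W (a i) \<omega>))\<^sup>2)"
        using \<xi>M[OF that] \<xi>[OF that] by (auto intro: step_increment_square)
    qed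
    show "(\<lambda>\<omega>. \<xi> i \<omega> * (W (b i) \<omega> - W (a i) \<omega>)) \<in> borel_measurable M"
      "(\<lambda>\<omega>. \<xi> j \<omega> * (W (b j) \<omega> - W (a j) \<omega>)) \<in> borel_measurable M"
      "integrable M (\<lambda>\<omega>. (\<xi> i \<omega> * (W (b i) \<omega> - W (a i) \<omega>))\<^sup>2)"
      "integrable M (\<lambda>\<omega>. (\<xi> j \<omega> * (W (b j) \<omega> - W (a j) \<omega>))\<^sup>2)" using * that by auto
  qed
  let ?S = "\<lambda>\<omega>. \<Sum>i\<in>I. \<xi> i \<omega> * (W (b i) \<omega> - W (a i) \<omega>)"
  let ?V = "\<lambda>\<omega>. \<Sum>i\<in>I. \<Sum>j\<in>I. \<xi> i \<omega> * \<xi> j \<omega> * ?l i j"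
  have int_S: "integrable M (\<lambda>\<omega>. (?S \<omega>)\<^sup>2)"
    unfolding power2_eq_square sum_product by (intro Bochner_Integration.integrable_sum X2)
  have "(\<integral>\<^sup>+ \<omega>. ennreal ((?S \<omega>)\<^sup>2) \<partial>M) = ennreal (expectation (\<lambda>\<omega>. (?S \<omega>)\<^sup>2))"
    by (rule nn_integral_eq_integral[OF int_S]) simp
  also have "expectation (\<lambda>\<omega>. (?S \<omega>)\<^sup>2)
    = (\<Sum>i\<in>I. \<Sum>j\<in>I. expectation (\<lambda>\<omega>. (\<xi> i \<omega> * (W (b i) \<omega> - W (a i) \<omega>)) * (\<xi> j \<omega> * (W (b j) \<omega> - W (a j) \<omega>))))"
    using X2 by (simp add: power2_eq_square sum_product)
  also have "\<dots> = (\<Sum>i\<in>I. \<Sum>j\<in>I. expectation (\<lambda>\<omega>. \<xi> i \<omega> * \<xi> j \<omega>) * ?l i j)"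
    using ab \<xi> by (intro sum.cong refl cross_increments) auto
  also have "\<dots> = expectation ?V"
    using \<xi>\<xi> by simp
  finally have 1: "(\<integral>\<^sup>+ \<omega>. ennreal ((?S \<omega>)\<^sup>2) \<partial>M) = ennreal (expectation ?V)" .
  have key: "(\<integral>\<^sup>+ r\<in>{0..T}. ennreal ((\<Sum>i\<in>I. \<xi> i \<omega> * indicator {a i<..b i} r)\<^sup>2) \<partial>lborel) = ennreal (?V \<omega>)"
    "0 \<le> ?V \<omega>" for \<omega>
  proof -
    let ?f = "\<lambda>r. (\<Sum>i\<in>I. \<xi> i \<omega> * indicator {a i<..b i} r)\<^sup>2"
    have ind: "indicator {a i<..b i} r * indicator {a j<..b j} r = (indicator {max (a i) (a j)<..min (b i) (b j)} r :: real)" for i j r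
      by (auto simp: indicator_def)
    have sq: "?f r = (\<Sum>i\<in>I. \<Sum>j\<in>I. \<xi> i \<omega> * \<xi> j \<omega> * indicator {max (a i) (a j)<..min (b i) (b j)} r)" for r
      unfolding power2_eq_square sum_product ind[symmetric] by (simp only: mult_ac)
    have int: "integrable lborel (indicator {u<..v} :: real \<Rightarrow> real)" for u v :: real
      by (cases "u \<le> v") auto
    have li: "measure lborel {max (a i) (a j)<..min (b i) (b j)} = ?l i j" for i j
      by (cases "max (a i) (a j) \<le> min (b i) (b j)") (simp_all only: measure_lborel_Ioc max_def, auto)
    have intf: "integrable lborel ?f"
      unfolding sq by (intro Bochner_Integration.integrable_sum integrable_mult_right int)
    have V: "(\<integral>r. ?f r \<partial>lborel) = ?V \<omega>"
    proof -
      have "(\<integral>r. ?f r \<partial>lborel) = (\<Sum>i\<in>I. \<Sum>j\<in>I. \<integral>r. \<xi> i \<omega> * \<xi> j \<omega> * indicator {max (a i) (a j)<..min (b i) (b j)} r \<partial>lborel)"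
        unfolding sq using int by (simp only: Bochner_Integration.integral_sum Bochner_Integration.integrable_sum integrable_mult_right)
      then show ?thesis by (simp only: integral_mult_right_zero) (simp add: li)
    qed
    have "(\<integral>\<^sup>+ r\<in>{0..T}. ennreal (?f r) \<partial>lborel) = (\<integral>\<^sup>+ r. ennreal (?f r) \<partial>lborel)"
    proof (rule nn_integral_cong)
      fix r :: real
      show "ennreal (?f r) * indicator {0..T} r = ennreal (?f r)"
      proof (cases "r \<in> {0..T}")
        case False
        then have "(\<Sum>i\<in>I. \<xi> i \<omega> * indicator {a i<..b i} r) = 0"
          using ab by (intro sum.neutral) (force simp: indicator_def)
        then show ?thesis by simp
      qed simp
    qed
    also have "\<dots> = ennreal (\<integral>r. ?f r \<partial>lborel)"
      by (rule nn_integral_eq_integral[OF intf]) simp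
    finally show "(\<integral>\<^sup>+ r\<in>{0..T}. ennreal (?f r) \<partial>lborel) = ennreal (?V \<omega>)" unfolding V .
    show "0 \<le> ?V \<omega>" unfolding V[symmetric] by (intro Bochner_Integration.integral_nonneg) auto
  qed
  have "integrable M ?V" using \<xi>\<xi> by (intro Bochner_Integration.integrable_sum integrable_mult_left) auto
  then have "ennreal (expectation ?V) = (\<integral>\<^sup>+ \<omega>. ennreal (?V \<omega>) \<partial>M)"
    using key(2) by (intro nn_integral_eq_integral[symmetric]) auto
  then show ?thesis unfolding 1 key(1) .
qed

lemma elementary_process_times:
  assumes "elementary_process M F T (n, s, \<xi>)" "i < n"
  shows "0 \<le> s i \<and> s i \<le> s (Suc i) \<and> s (Suc i) \<le> T"
proof -
  have st: "s i \<le> s (Suc i)" if "i < n" for i using assms(1) that by simp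
  have lo: "0 \<le> s i" if "i \<le> n" for i using that
  proof (induction i)
    case 0
    then show ?case using assms(1) by simp
  next
    case (Suc i)
    then show ?case using st[of i] by simp
  qed
  have hi: "s i \<le> T" if "i \<le> n" for i using that
  proof (induction rule: inc_induct)
    case base
    then show ?case using assms(1) by simp
  next
    case (step i)
    then show ?case using st[of i] by simp
  qed
  show ?thesis using lo[of i] hi[of "Suc i"] st assms(2) by simp
qed

text \<open>The difference is a family of steps over the disjoint union of the two index sets, with
  the coefficients of the second process negated.\<close>

lemma step_isometry:
  assumes \<phi>: "elementary_process M F T \<phi>" and \<psi>: "elementary_process M F T \<psi>"
  shows "(\<integral>\<^sup>+ \<omega>. ennreal ((step_integral \<phi> W \<omega> - step_integral \<psi> W \<omega>)\<^sup>2) \<partial>M)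
    = (\<integral>\<^sup>+ \<omega>. (\<integral>\<^sup>+ r\<in>{0..T}. ennreal ((step_value \<phi> r \<omega> - step_value \<psi> r \<omega>)\<^sup>2) \<partial>lborel) \<partial>M)"
proof -
  obtain n s \<xi> where p: "\<phi> = (n, s, \<xi>)" by (cases \<phi>) auto
  obtain m u \<eta> where q: "\<psi> = (m, u, \<eta>)" by (cases \<psi>) auto
  let ?I = "{..<n} <+> {..<m}"
  let ?\<xi> = "case_sum \<xi> (\<lambda>i \<omega>. - \<eta> i \<omega>)"
  let ?a = "case_sum s u" and ?b = "case_sum (\<lambda>i. s (Suc i)) (\<lambda>i. u (Suc i))"
  have 1: "(\<Sum>i\<in>?I. ?\<xi> i \<omega> * (W (?b i) \<omega> - W (?a i) \<omega>)) = step_integral \<phi> W \<omega> - step_integral \<psi> W \<omega>" for \<omega>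
    by (simp only: p q step_integral.simps sum.Plus[OF finite_lessThan finite_lessThan] sum.case mult_minus_left comp_def
      sum_negf diff_conv_add_uminus[of "sum _ _"])
  have 2: "(\<Sum>i\<in>?I. ?\<xi> i \<omega> * indicator {?a i<..?b i} r) = step_value \<phi> r \<omega> - step_value \<psi> r \<omega>" for r \<omega>
    by (simp only: p q step_value.simps sum.Plus[OF finite_lessThan finite_lessThan] sum.case mult_minus_left comp_def
      sum_negf diff_conv_add_uminus[of "sum _ _"])
  have "(\<integral>\<^sup>+ \<omega>. ennreal ((\<Sum>i\<in>?I. ?\<xi> i \<omega> * (W (?b i) \<omega> - W (?a i) \<omega>))\<^sup>2) \<partial>M)
    = (\<integral>\<^sup>+ \<omega>. (\<integral>\<^sup>+ r\<in>{0..T}. ennreal ((\<Sum>i\<in>?I. ?\<xi> i \<omega> * indicator {?a i<..?b i} r)\<^sup>2) \<partial>lborel) \<partial>M)"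
  proof (rule isometry_sum)
    show "0 \<le> ?a i \<and> ?a i \<le> ?b i \<and> ?b i \<le> T" if "i \<in> ?I" for i
      using that elementary_process_times[OF \<phi>[unfolded p]] elementary_process_times[OF \<psi>[unfolded q]] by auto
    show "?\<xi> i \<in> borel_measurable (F (?a i))" "integrable M (\<lambda>\<omega>. (?\<xi> i \<omega>)\<^sup>2)" if "i \<in> ?I" for i
      using that \<phi> \<psi> by (auto simp: p q)
  qed auto
  then show ?thesis unfolding 1 2 .
qed

end

section \<open>Mean-square limits with a geometric rate\<close>

lemma AE_summable_of_nn_integral_le:
  fixes f :: "nat \<Rightarrow> 'a \<Rightarrow> real"
  assumes [measurable]: "\<And>n. f n \<in> borel_measurable M" and f: "\<And>n \<omega>. 0 \<le> f n \<omega>"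
    and c: "summable c" "\<And>n. 0 \<le> c n" and le: "\<And>n. (\<integral>\<^sup>+ \<omega>. ennreal (f n \<omega>) \<partial>M) \<le> ennreal (c n)"
  shows "AE \<omega> in M. summable (\<lambda>n. f n \<omega>)"
proof -
  have "(\<integral>\<^sup>+ \<omega>. (\<Sum>n. ennreal (f n \<omega>)) \<partial>M) = (\<Sum>n. \<integral>\<^sup>+ \<omega>. ennreal (f n \<omega>) \<partial>M)"
    by (rule nn_integral_suminf) measurable
  also have "\<dots> \<le> (\<Sum>n. ennreal (c n))" by (intro suminf_le le) auto
  also have "\<dots> = ennreal (\<Sum>n. c n)" using c by (intro suminf_ennreal2) auto
  also have "\<dots> < \<infinity>" by simp
  finally have "AE \<omega> in M. (\<Sum>n. ennreal (f n \<omega>)) \<noteq> \<infinity>"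
    by (intro nn_integral_PInf_AE) auto
  then show ?thesis
    by eventually_elim (auto intro: summable_suminf_not_top f)
qed

lemma square_diff_le: "((a::real) - c)\<^sup>2 \<le> 2 * (a - b)\<^sup>2 + 2 * (b - c)\<^sup>2"
proof -
  have "0 \<le> ((a - b) - (b - c))\<^sup>2" by simp
  then show ?thesis by (simp add: power2_eq_square algebra_simps)
qed

lemma nn_integral_square_diff_le:
  fixes f g h :: "'a \<Rightarrow> real"
  assumes [measurable]: "f \<in> borel_measurable M" "g \<in> borel_measurable M" "h \<in> borel_measurable M"
  shows "(\<integral>\<^sup>+ \<omega>. ennreal ((f \<omega> - h \<omega>)\<^sup>2) \<partial>M) \<le>
    2 * (\<integral>\<^sup>+ \<omega>. ennreal ((f \<omega> - g \<omega>)\<^sup>2) \<partial>M) + 2 * (\<integral>\<^sup>+ \<omega>. ennreal ((g \<omega> - h \<omega>)\<^sup>2) \<partial>M)"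
proof -
  have "(\<integral>\<^sup>+ \<omega>. ennreal ((f \<omega> - h \<omega>)\<^sup>2) \<partial>M) \<le>
    (\<integral>\<^sup>+ \<omega>. 2 * ennreal ((f \<omega> - g \<omega>)\<^sup>2) + 2 * ennreal ((g \<omega> - h \<omega>)\<^sup>2) \<partial>M)"
  proof (rule nn_integral_mono)
    fix \<omega>
    have "ennreal ((f \<omega> - h \<omega>)\<^sup>2) \<le> ennreal (2 * (f \<omega> - g \<omega>)\<^sup>2 + 2 * (g \<omega> - h \<omega>)\<^sup>2)"
      by (rule ennreal_leI[OF square_diff_le])
    also have "\<dots> = 2 * ennreal ((f \<omega> - g \<omega>)\<^sup>2) + 2 * ennreal ((g \<omega> - h \<omega>)\<^sup>2)"
      by (simp add: ennreal_plus ennreal_mult)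
    finally show "ennreal ((f \<omega> - h \<omega>)\<^sup>2) \<le> 2 * ennreal ((f \<omega> - g \<omega>)\<^sup>2) + 2 * ennreal ((g \<omega> - h \<omega>)\<^sup>2)" .
  qed
  also have "\<dots> = 2 * (\<integral>\<^sup>+ \<omega>. ennreal ((f \<omega> - g \<omega>)\<^sup>2) \<partial>M) + 2 * (\<integral>\<^sup>+ \<omega>. ennreal ((g \<omega> - h \<omega>)\<^sup>2) \<partial>M)"
    by (simp add: nn_integral_add nn_integral_cmult)
  finally show ?thesis .
qed

lemma ennreal_tendsto_zero_geometric:
  assumes "\<And>n. f n \<le> ennreal (C / 2 ^ n)"
  shows "f \<longlonglongrightarrow> (0 :: ennreal)"
proof -
  have "(\<lambda>n. C / 2 ^ n) \<longlonglongrightarrow> 0" by (rule LIMSEQ_divide_realpow_zero) simp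
  from tendsto_ennrealI[OF this] have "(\<lambda>n. ennreal (C / 2 ^ n)) \<longlonglongrightarrow> 0" by simp
  from tendsto_sandwich[OF _ _ tendsto_const[of 0] this] show ?thesis using assms by simp
qed

text \<open>Completeness at a geometric rate. The weight q = (4/3)^n still leaves summable means C *
  (2/3)^n and has summable inverses, so \<bar>d\<bar> \<le> q * d^2 + 1/q makes the successive
  differences almost surely absolutely summable. Fatou's lemma then carries the Cauchy bound over to
  the limit.\<close>

lemma L2_limit_exists:
  fixes X :: "nat \<Rightarrow> 'a \<Rightarrow> real"
  assumes X[measurable]: "\<And>n. X n \<in> borel_measurable M" and C: "0 \<le> C"
    and le: "\<And>n m. n \<le> m \<Longrightarrow> (\<integral>\<^sup>+ \<omega>. ennreal ((X n \<omega> - X m \<omega>)\<^sup>2) \<partial>M) \<le> ennreal (C / 2 ^ n)"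
  obtains I where "I \<in> borel_measurable M" "(\<lambda>n. \<integral>\<^sup>+ \<omega>. ennreal ((X n \<omega> - I \<omega>)\<^sup>2) \<partial>M) \<longlonglongrightarrow> 0"
proof -
  define I where "I \<omega> = lim (\<lambda>n. X n \<omega>)" for \<omega>
  have Im[measurable]: "I \<in> borel_measurable M" unfolding I_def by measurable
  let ?d = "\<lambda>n \<omega>. X n \<omega> - X (Suc n) \<omega>"
  have "AE \<omega> in M. summable (\<lambda>n. (4/3) ^ n * (?d n \<omega>)\<^sup>2)"
  proof (rule AE_summable_of_nn_integral_le[where c="\<lambda>n. C * (2/3) ^ n"])
    fix n
    have "(\<integral>\<^sup>+ \<omega>. ennreal ((4/3) ^ n * (?d n \<omega>)\<^sup>2) \<partial>M) = ennreal ((4/3) ^ n) * (\<integral>\<^sup>+ \<omega>. ennreal ((?d n \<omega>)\<^sup>2) \<partial>M)"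
      by (simp add: ennreal_mult nn_integral_cmult)
    also have "\<dots> \<le> ennreal ((4/3) ^ n) * ennreal (C / 2 ^ n)" by (intro mult_left_mono le) auto
    also have "\<dots> = ennreal ((4/3) ^ n * (C / 2 ^ n))" by (rule ennreal_mult[symmetric]) (use C in auto)
    also have "(4/3) ^ n * (C / 2 ^ n) = C * (2/3) ^ n"
    proof -
      have "(4/3 :: real) ^ n = 2 ^ n * (2/3) ^ n" by (simp add: power_mult_distrib[symmetric])
      then show ?thesis by simp
    qed
    finally show "(\<integral>\<^sup>+ \<omega>. ennreal ((4/3) ^ n * (?d n \<omega>)\<^sup>2) \<partial>M) \<le> ennreal (C * (2/3) ^ n)" .
  qed (use C in \<open>auto intro!: summable_mult summable_geometric\<close>)
  then have lim: "AE \<omega> in M. (\<lambda>n. X n \<omega>) \<longlonglongrightarrow> I \<omega>"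
  proof eventually_elim
    case (elim \<omega>)
    have "summable (\<lambda>n. (4/3) ^ n * (?d n \<omega>)\<^sup>2 + (3/4) ^ n)"
      by (intro summable_add elim summable_geometric) simp
    moreover have "norm (?d n \<omega>) \<le> (4/3) ^ n * (?d n \<omega>)\<^sup>2 + (3/4) ^ n" for n
    proof -
      define q where "q = (4/3 :: real) ^ n"
      have q: "q > 0" "(3/4 :: real) ^ n = 1 / q" by (auto simp: q_def power_one_over[symmetric] power_divide)
      have "\<bar>x\<bar> \<le> q * x\<^sup>2 + 1 / q" for x
      proof -
        have "0 \<le> (q * \<bar>x\<bar> - 1)\<^sup>2" by simp
        then have "2 * (q * \<bar>x\<bar>) \<le> q * q * x\<^sup>2 + 1"
          by (simp add: power2_eq_square algebra_simps)
        moreover have "0 \<le> q * \<bar>x\<bar>" using q by simp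
        ultimately have "q * \<bar>x\<bar> \<le> q * q * x\<^sup>2 + 1" by linarith
        then have "q * \<bar>x\<bar> \<le> q * (q * x\<^sup>2 + 1 / q)" using q(1) by (simp add: distrib_left mult.assoc)
        then show ?thesis using q by simp
      qed
      then show ?thesis by (simp add: q_def[symmetric] q(2))
    qed
    ultimately have "summable (\<lambda>n. ?d n \<omega>)" by (rule summable_comparison_test'[where N=0])
    then have "convergent (\<lambda>n. \<Sum>i<n. ?d i \<omega>)" by (simp add: summable_iff_convergent)
    moreover have "(\<Sum>i<n. ?d i \<omega>) = X 0 \<omega> - X n \<omega>" for n
      by (rule sum_lessThan_telescope')
    ultimately have "convergent (\<lambda>n. X 0 \<omega> - X n \<omega>)" by simp
    from convergent_diff[OF convergent_const[of "X 0 \<omega>"] this] have "convergent (\<lambda>n. X n \<omega>)" by simp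
    then show ?case unfolding I_def by (simp add: convergent_LIMSEQ_iff)
  qed
  have I: "(\<integral>\<^sup>+ \<omega>. ennreal ((X n \<omega> - I \<omega>)\<^sup>2) \<partial>M) \<le> ennreal (C / 2 ^ n)" for n
  proof -
    have "(\<integral>\<^sup>+ \<omega>. ennreal ((X n \<omega> - I \<omega>)\<^sup>2) \<partial>M) = (\<integral>\<^sup>+ \<omega>. liminf (\<lambda>m. ennreal ((X n \<omega> - X m \<omega>)\<^sup>2)) \<partial>M)"
    proof (rule nn_integral_cong_AE)
      show "AE \<omega> in M. ennreal ((X n \<omega> - I \<omega>)\<^sup>2) = liminf (\<lambda>m. ennreal ((X n \<omega> - X m \<omega>)\<^sup>2))"
        using lim
      proof eventually_elim
        case (elim \<omega>)
        have "(\<lambda>m. ennreal ((X n \<omega> - X m \<omega>)\<^sup>2)) \<longlonglongrightarrow> ennreal ((X n \<omega> - I \<omega>)\<^sup>2)"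
          by (intro tendsto_intros elim)
        then show ?case by (intro lim_imp_Liminf[symmetric]) auto
      qed
    qed
    also have "\<dots> \<le> liminf (\<lambda>m. \<integral>\<^sup>+ \<omega>. ennreal ((X n \<omega> - X m \<omega>)\<^sup>2) \<partial>M)"
      by (rule nn_integral_liminf) measurable
    also have "\<dots> \<le> ennreal (C / 2 ^ n)"
      using le by (intro Liminf_le) (auto simp: eventually_sequentially)
    finally show ?thesis .
  qed
  have "(\<lambda>n. \<integral>\<^sup>+ \<omega>. ennreal ((X n \<omega> - I \<omega>)\<^sup>2) \<partial>M) \<longlonglongrightarrow> 0"
    by (rule ennreal_tendsto_zero_geometric[OF I])
  from that[OF Im this] show thesis .
qed

section \<open>Dyadic approximation of the integrand and of the Ito integral\<close>

context ito_integrand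
begin

definition dyadic_step :: "real \<Rightarrow> nat \<Rightarrow> 'a step_process" where
  "dyadic_step T n = (2 ^ n, \<lambda>i. real i * T / 2 ^ n, \<lambda>i. H (real i * T / 2 ^ n))"

text \<open>A jointly measurable version of \<open>H\<close> on \<open>{0..T}\<close>, the limit of
  its values at the dyadic times just below r. Continuity of \<open>H\<close> is known only almost
  surely, and the exchange of the time integral with the expectation requires measurability in both
  variables together.\<close>

definition H_cont :: "real \<Rightarrow> real \<Rightarrow> 'a \<Rightarrow> real" where
  "H_cont T r \<omega> = lim (\<lambda>n. H (real (nat \<lfloor>r * 2 ^ n / T\<rfloor>) * T / 2 ^ n) \<omega>)"

lemma H_square_integrable:
  assumes "0 \<le> s"
  shows "integrable M (\<lambda>\<omega>. (H s \<omega>)\<^sup>2)"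
proof (rule integrableI_bounded)
  have "(\<integral>\<^sup>+ \<omega>. ennreal (norm ((H s \<omega>)\<^sup>2)) \<partial>M) = (\<integral>\<^sup>+ \<omega>. ennreal ((H s \<omega> - H 0 \<omega>)\<^sup>2) \<partial>M)"
    using H_zero by (intro nn_integral_cong_AE) (auto elim: eventually_mono)
  also have "\<dots> < \<infinity>" using H_variance[OF order_refl assms] by simp
  finally show "(\<integral>\<^sup>+ \<omega>. ennreal (norm ((H s \<omega>)\<^sup>2)) \<partial>M) < \<infinity>" .
qed (use assms in measurable)

lemma elementary_dyadic_step:
  assumes "0 \<le> T"
  shows "elementary_process M F T (dyadic_step T n)"
  using assms H_adapted H_square_integrable by (auto simp: dyadic_step_def intro!: divide_right_mono mult_right_mono)

lemma H_cont_measurable: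
  assumes "0 \<le> T"
  shows "(\<lambda>p. H_cont T (fst p) (snd p)) \<in> borel_measurable (lborel \<Otimes>\<^sub>M M)"
  unfolding H_cont_def
proof (rule borel_measurable_lim_metric)
  fix n
  show "(\<lambda>p. H (real (nat \<lfloor>fst p * 2 ^ n / T\<rfloor>) * T / 2 ^ n) (snd p)) \<in> borel_measurable (lborel \<Otimes>\<^sub>M M)"
  proof (rule measurable_compose_countable[where f="\<lambda>i p. H (real i * T / 2 ^ n) (snd p)"])
    show "(\<lambda>p. H (real i * T / 2 ^ n) (snd p)) \<in> borel_measurable (lborel \<Otimes>\<^sub>M M)" for i
      using assms by (intro measurable_compose[OF measurable_snd] H_measurable) auto
    show "(\<lambda>p. nat \<lfloor>fst p * 2 ^ n / T\<rfloor>) \<in> measurable (lborel \<Otimes>\<^sub>M M) (count_space UNIV)"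
      by measurable
  qed
qed

lemma H_cont_eq:
  assumes T: "0 \<le> T"
  shows "AE \<omega> in M. \<forall>r\<in>{0..T}. H_cont T r \<omega> = H r \<omega>"
  using H_continuous
proof eventually_elim
  case (elim \<omega>)
  show ?case
  proof
    fix r assume r: "r \<in> {0..T}"
    define g where "g n = real (nat \<lfloor>r * 2 ^ n / T\<rfloor>) * T / 2 ^ n" for n :: nat
    have g: "r - T / 2 ^ n \<le> g n" "g n \<le> r" for n
    proof -
      have "real (nat \<lfloor>x\<rfloor>) \<le> x \<and> x - 1 \<le> real (nat \<lfloor>x\<rfloor>)" if "0 \<le> x" for x :: real
        using that by linarith
      from this[of "r * 2 ^ n / T"] have *: "real (nat \<lfloor>r * 2 ^ n / T\<rfloor>) \<le> r * 2 ^ n / T"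
        "r * 2 ^ n / T - 1 \<le> real (nat \<lfloor>r * 2 ^ n / T\<rfloor>)" using r T by auto
      have "r - T / 2 ^ n \<le> g n \<and> g n \<le> r"
      proof (cases "T = 0")
        case False
        then have "T > 0" using T by simp
        define k q where "k = real (nat \<lfloor>r * 2 ^ n / T\<rfloor>)" and "q = (2 :: real) ^ n"
        have "0 < T / q" using \<open>T > 0\<close> by (simp add: q_def)
        then have "k * (T / q) \<le> (r * q / T) * (T / q)" "(r * q / T - 1) * (T / q) \<le> k * (T / q)"
          using * by (simp_all only: k_def q_def mult_right_mono less_imp_le)
        moreover have "(r * q / T) * (T / q) = r" "(r * q / T - 1) * (T / q) = r - T / q"
          using \<open>T > 0\<close> by (auto simp: q_def field_simps)
        ultimately show ?thesis by (auto simp: g_def k_def q_def)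
      qed (use r in \<open>auto simp: g_def\<close>)
      then show "r - T / 2 ^ n \<le> g n" "g n \<le> r" by auto
    qed
    have "(\<lambda>n. r - T / 2 ^ n) \<longlonglongrightarrow> r - 0"
      by (rule tendsto_diff[OF tendsto_const LIMSEQ_divide_realpow_zero]) simp
    then have "g \<longlonglongrightarrow> r"
      using tendsto_sandwich[of "\<lambda>n. r - T / 2 ^ n" g sequentially "\<lambda>_. r" r] g by simp
    moreover have "g n \<in> {0..}" for n using T by (simp add: g_def)
    ultimately have "(\<lambda>n. H (g n) \<omega>) \<longlonglongrightarrow> H r \<omega>"
      using r by (intro continuous_on_tendsto_compose[OF elim]) auto
    then show "H_cont T r \<omega> = H r \<omega>" unfolding H_cont_def g_def by (rule limI)
  qed
qed

lemma step_value_measurable: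
  assumes "elementary_process M F T \<phi>"
  shows "(\<lambda>p. step_value \<phi> (fst p) (snd p)) \<in> borel_measurable (lborel \<Otimes>\<^sub>M M)"
proof -
  obtain n s \<xi> where p: "\<phi> = (n, s, \<xi>)" by (cases \<phi>) auto
  have [measurable]: "\<xi> i \<in> borel_measurable M" if "i < n" for i
    using F_imp_M elementary_process_times[OF assms[unfolded p] that] assms that by (auto simp: p)
  show ?thesis unfolding p step_value.simps
  proof (rule borel_measurable_sum)
    fix i assume "i \<in> {..<n}"
    then have [measurable]: "\<xi> i \<in> borel_measurable M" by simp
    show "(\<lambda>p. \<xi> i (snd p) * indicator {s i<..s (Suc i)} (fst p)) \<in> borel_measurable (lborel \<Otimes>\<^sub>M M)"
      by measurable
  qed
qed

lemma step_integral_measurable: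
  assumes "elementary_process M F T \<phi>"
  shows "step_integral \<phi> W \<in> borel_measurable M"
proof -
  obtain n s \<xi> where p: "\<phi> = (n, s, \<xi>)" by (cases \<phi>) auto
  have "step_integral \<phi> W = (\<lambda>\<omega>. \<Sum>i<n. \<xi> i \<omega> * (W (s (Suc i)) \<omega> - W (s i) \<omega>))"
    by (simp add: p fun_eq_iff)
  also have "\<dots> \<in> borel_measurable M"
  proof (rule borel_measurable_sum)
    fix i assume "i \<in> {..<n}"
    then have i: "i < n" by simp
    note el = elementary_process_times[OF assms[unfolded p] i]
    have "0 \<le> s i" "0 \<le> s (Suc i)" "\<xi> i \<in> borel_measurable M"
      using el F_imp_M[of "s i" "\<xi> i"] assms i by (auto simp: p)
    then show "(\<lambda>\<omega>. \<xi> i \<omega> * (W (s (Suc i)) \<omega> - W (s i) \<omega>)) \<in> borel_measurable M" by measurable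
  qed
  finally show ?thesis .
qed

text \<open>The squared distance, with the integrals in the order used by
  \<open>has_ito_integral\<close>; hence the factors 2 in its triangle inequality.\<close>

abbreviation L2_dist :: "real \<Rightarrow> (real \<Rightarrow> 'a \<Rightarrow> real) \<Rightarrow> (real \<Rightarrow> 'a \<Rightarrow> real) \<Rightarrow> ennreal" where
  "L2_dist T f g \<equiv> (\<integral>\<^sup>+ \<omega>. (\<integral>\<^sup>+ r\<in>{0..T}. ennreal ((f r \<omega> - g r \<omega>)\<^sup>2) \<partial>lborel) \<partial>M)"

lemma L2_dist_eq:
  assumes [measurable]: "(\<lambda>p. f (fst p) (snd p)) \<in> borel_measurable (lborel \<Otimes>\<^sub>M M)"
    "(\<lambda>p. g (fst p) (snd p)) \<in> borel_measurable (lborel \<Otimes>\<^sub>M M)"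
  shows "L2_dist T f g = (\<integral>\<^sup>+ p. ennreal ((f (fst p) (snd p) * indicator {0..T} (fst p) - g (fst p) (snd p) * indicator {0..T} (fst p))\<^sup>2) \<partial>(lborel \<Otimes>\<^sub>M M))"
    and "L2_dist T f g = (\<integral>\<^sup>+ r\<in>{0..T}. (\<integral>\<^sup>+ \<omega>. ennreal ((f r \<omega> - g r \<omega>)\<^sup>2) \<partial>M) \<partial>lborel)"
proof -
  interpret P: pair_sigma_finite lborel M ..
  let ?k = "\<lambda>p. ennreal ((f (fst p) (snd p) * indicator {0..T} (fst p) - g (fst p) (snd p) * indicator {0..T} (fst p))\<^sup>2)"
  have k[measurable]: "?k \<in> borel_measurable (lborel \<Otimes>\<^sub>M M)" by measurable
  have kk: "?k (r, \<omega>) = ennreal ((f r \<omega> - g r \<omega>)\<^sup>2) * indicator {0..T} r" for r \<omega>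
    by (simp add: indicator_def)
  have "integral\<^sup>N (lborel \<Otimes>\<^sub>M M) ?k = (\<integral>\<^sup>+ \<omega>. (\<integral>\<^sup>+ r. ?k (r, \<omega>) \<partial>lborel) \<partial>M)"
    by (rule P.nn_integral_snd[OF k, symmetric])
  then show "L2_dist T f g = integral\<^sup>N (lborel \<Otimes>\<^sub>M M) ?k" unfolding kk by simp
  also have "\<dots> = (\<integral>\<^sup>+ r. (\<integral>\<^sup>+ \<omega>. ?k (r, \<omega>) \<partial>M) \<partial>lborel)"
    by (rule nn_integral_fst[OF k, symmetric])
  also have "\<dots> = (\<integral>\<^sup>+ r\<in>{0..T}. (\<integral>\<^sup>+ \<omega>. ennreal ((f r \<omega> - g r \<omega>)\<^sup>2) \<partial>M) \<partial>lborel)"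
    unfolding kk by (intro nn_integral_cong) (auto simp: indicator_def)
  finally show "L2_dist T f g = \<dots>" .
qed

lemma L2_dist_triangle:
  assumes [measurable]: "(\<lambda>p. f (fst p) (snd p)) \<in> borel_measurable (lborel \<Otimes>\<^sub>M M)"
    "(\<lambda>p. g (fst p) (snd p)) \<in> borel_measurable (lborel \<Otimes>\<^sub>M M)"
    "(\<lambda>p. h (fst p) (snd p)) \<in> borel_measurable (lborel \<Otimes>\<^sub>M M)"
  shows "L2_dist T f h \<le> 2 * L2_dist T f g + 2 * L2_dist T g h"
  unfolding L2_dist_eq(1)[OF assms(1,2)] L2_dist_eq(1)[OF assms(1,3)] L2_dist_eq(1)[OF assms(2,3)]
  by (rule nn_integral_square_diff_le) measurable

lemma L2_dist_H:
  assumes "0 \<le> T"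
  shows "L2_dist T f H = L2_dist T f (H_cont T)"
proof (rule nn_integral_cong_AE)
  show "AE \<omega> in M. (\<integral>\<^sup>+ r\<in>{0..T}. ennreal ((f r \<omega> - H r \<omega>)\<^sup>2) \<partial>lborel)
    = (\<integral>\<^sup>+ r\<in>{0..T}. ennreal ((f r \<omega> - H_cont T r \<omega>)\<^sup>2) \<partial>lborel)"
    using H_cont_eq[OF assms]
  proof eventually_elim
    case (elim \<omega>)
    show ?case by (rule nn_integral_cong) (auto simp: elim indicator_def)
  qed
qed

lemma dyadic_step_value:
  assumes "0 < T" "r \<in> {0<..T}"
  obtains s where "0 \<le> s" "s \<le> r" "r - s \<le> T / 2 ^ n" "\<And>\<omega>. step_value (dyadic_step T n) r \<omega> = H s \<omega>"
proof -
  \<comment> \<open>Ceiling minus one, because steps are open on the left and closed on the right: a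
    grid point belongs to the step that ends there.\<close>
  define i where "i = nat (\<lceil>r * 2 ^ n / T\<rceil> - 1)"
  have x: "0 < r * 2 ^ n / T" "r * 2 ^ n / T \<le> 2 ^ n" using assms by (auto simp: field_simps)
  have i: "real i < r * 2 ^ n / T" "r * 2 ^ n / T \<le> real (Suc i)"
    using x(1) unfolding i_def by linarith+
  have "real i < 2 ^ n" using i(1) x(2) by linarith
  then have i2: "i < 2 ^ n" by simp
  define s where "s j = real j * T / 2 ^ n" for j
  have si: "s i < r" "r \<le> s (Suc i)" using i assms by (auto simp: s_def field_simps)
  have mono: "s j \<le> s k" if "j \<le> k" for j k using that assms by (auto simp: s_def intro!: divide_right_mono mult_right_mono)
  have ind: "indicator {s j<..s (Suc j)} r = (if j = i then 1 else 0 :: real)" for j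
  proof -
    have "\<not> (s j < r \<and> r \<le> s (Suc j))" if "j \<noteq> i"
    proof (cases "j < i")
      case True
      then show ?thesis using mono[of "Suc j" i] si by auto
    next
      case False
      then show ?thesis using that mono[of "Suc i" j] si by auto
    qed
    then show ?thesis using si by auto
  qed
  have "step_value (dyadic_step T n) r \<omega> = (\<Sum>j<2 ^ n. H (s j) \<omega> * indicator {s j<..s (Suc j)} r)" for \<omega>
    unfolding dyadic_step_def step_value.simps s_def ..
  also have "\<dots> \<omega> = H (s i) \<omega>" for \<omega> unfolding ind using i2 by (simp add: sum.delta' if_distrib cong: if_cong)
  finally have "step_value (dyadic_step T n) r \<omega> = H (s i) \<omega>" for \<omega> .
  moreover have "0 \<le> s i" using assms by (simp add: s_def)
  moreover have "r - s i \<le> T / 2 ^ n" proof -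
    have "s (Suc i) = s i + T / 2 ^ n" by (simp add: s_def add_divide_distrib distrib_right)
    then show ?thesis using si(2) by simp
  qed
  ultimately show thesis using that[of "s i"] si by simp
qed

lemma dyadic_step_L2_dist:
  assumes T: "0 \<le> T"
  shows "L2_dist T (step_value (dyadic_step T n)) (H_cont T) \<le> ennreal (T * T / 2 ^ n)"
proof -
  note el = elementary_dyadic_step[OF T]
  have "L2_dist T (step_value (dyadic_step T n)) (H_cont T) =
    (\<integral>\<^sup>+ r\<in>{0..T}. (\<integral>\<^sup>+ \<omega>. ennreal ((step_value (dyadic_step T n) r \<omega> - H_cont T r \<omega>)\<^sup>2) \<partial>M) \<partial>lborel)"
    by (rule L2_dist_eq(2)[OF step_value_measurable[OF el] H_cont_measurable[OF T]])
  also have "\<dots> \<le> (\<integral>\<^sup>+ r\<in>{0..T}. ennreal (T / 2 ^ n) \<partial>lborel)"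
  proof (rule nn_integral_mono_AE)
    \<comment> \<open>Time 0 belongs to no step, so it is discarded as a null set.\<close>
    have "AE r in lborel. r \<noteq> (0::real)" by (rule AE_lborel_singleton)
    then show "AE r in lborel. (\<integral>\<^sup>+ \<omega>. ennreal ((step_value (dyadic_step T n) r \<omega> - H_cont T r \<omega>)\<^sup>2) \<partial>M) * indicator {0..T} r
      \<le> ennreal (T / 2 ^ n) * indicator {0..T} r"
    proof eventually_elim
      case (elim r)
      show ?case
      proof (cases "r \<in> {0..T}")
        case True
        then have r: "0 < T" "r \<in> {0<..T}" using elim T by auto
        obtain s where s: "0 \<le> s" "s \<le> r" "r - s \<le> T / 2 ^ n" "\<And>\<omega>. step_value (dyadic_step T n) r \<omega> = H s \<omega>"
          using dyadic_step_value[OF r] by blast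
        have "(\<integral>\<^sup>+ \<omega>. ennreal ((step_value (dyadic_step T n) r \<omega> - H_cont T r \<omega>)\<^sup>2) \<partial>M)
          = (\<integral>\<^sup>+ \<omega>. ennreal ((H r \<omega> - H s \<omega>)\<^sup>2) \<partial>M)"
          unfolding s(4) using H_cont_eq[OF T] True
          by (intro nn_integral_cong_AE) (auto elim!: eventually_mono simp: power2_commute)
        also have "\<dots> = ennreal (r - s)" by (rule H_variance[OF s(1,2)])
        also have "\<dots> \<le> ennreal (T / 2 ^ n)" by (rule ennreal_leI[OF s(3)])
        finally show ?thesis using True by simp
      qed simp
    qed
  qed
  also have "\<dots> = ennreal (T / 2 ^ n) * ennreal T"
    using T by (simp add: nn_integral_cmult_indicator)
  also have "\<dots> = ennreal (T * T / 2 ^ n)" using T by (simp add: ennreal_mult[symmetric])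
  finally show ?thesis .
qed

lemma dyadic_step_integral_cauchy:
  assumes T: "0 \<le> T" and "n \<le> m"
  shows "(\<integral>\<^sup>+ \<omega>. ennreal ((step_integral (dyadic_step T n) W \<omega> - step_integral (dyadic_step T m) W \<omega>)\<^sup>2) \<partial>M)
    \<le> ennreal (4 * T * T / 2 ^ n)"
proof -
  note el = elementary_dyadic_step[OF T]
  note meas = step_value_measurable[OF el] H_cont_measurable[OF T]
  have sym: "L2_dist T f g = L2_dist T g f" for f g by (simp add: power2_commute)
  have "(\<integral>\<^sup>+ \<omega>. ennreal ((step_integral (dyadic_step T n) W \<omega> - step_integral (dyadic_step T m) W \<omega>)\<^sup>2) \<partial>M)
    = L2_dist T (step_value (dyadic_step T n)) (step_value (dyadic_step T m))"
    by (rule step_isometry[OF el el])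
  also have "\<dots> \<le> 2 * L2_dist T (step_value (dyadic_step T n)) (H_cont T) + 2 * L2_dist T (H_cont T) (step_value (dyadic_step T m))"
    by (rule L2_dist_triangle[OF meas meas(1)])
  also have "\<dots> \<le> 2 * ennreal (T * T / 2 ^ n) + 2 * ennreal (T * T / 2 ^ m)"
    by (intro add_mono mult_left_mono dyadic_step_L2_dist[OF T] dyadic_step_L2_dist[OF T, unfolded sym[of "step_value _"]]) auto
  also have "\<dots> \<le> 2 * ennreal (T * T / 2 ^ n) + 2 * ennreal (T * T / 2 ^ n)"
    using assms by (intro add_mono mult_left_mono ennreal_leI divide_left_mono power_increasing) auto
  also have "\<dots> = ennreal (4 * T * T / 2 ^ n)"
    using T by (simp add: ennreal_mult[symmetric] ennreal_plus[symmetric] ennreal_numeral[symmetric] del: ennreal_numeral ennreal_plus)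
  finally show ?thesis .
qed

lemma has_ito_integral_exists:
  assumes T: "0 \<le> T"
  shows "\<exists>I. has_ito_integral M F H W T I"
proof -
  note el = elementary_dyadic_step[OF T]
  obtain I where I: "I \<in> borel_measurable M"
    "(\<lambda>n. \<integral>\<^sup>+ \<omega>. ennreal ((step_integral (dyadic_step T n) W \<omega> - I \<omega>)\<^sup>2) \<partial>M) \<longlonglongrightarrow> 0"
    by (rule L2_limit_exists[where X="\<lambda>n. step_integral (dyadic_step T n) W" and C="4 * T * T" and M=M])
       (use T in \<open>auto intro: step_integral_measurable[OF el] dyadic_step_integral_cauchy\<close>)
  have "(\<lambda>n. L2_dist T (step_value (dyadic_step T n)) H) \<longlonglongrightarrow> 0"
    unfolding L2_dist_H[OF T] by (rule ennreal_tendsto_zero_geometric[OF dyadic_step_L2_dist[OF T]])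
  then show ?thesis unfolding has_ito_integral_def using I el by blast
qed

text \<open>By the isometry, the dyadic integral is close to the integrals of whatever elementary
  processes define \<open>I\<close>, as soon as both integrands are close to \<open>H\<close>;
  letting \<open>k\<close> tend to infinity removes the unknown sequence. Thus every version of the
  integral has the same explicit dyadic rate, which tames the choice made in
  \<open>ito_integral\<close>.\<close>

lemma has_ito_integral_dyadic:
  assumes T: "0 \<le> T" and I: "has_ito_integral M F H W T I"
  shows "(\<integral>\<^sup>+ \<omega>. ennreal ((step_integral (dyadic_step T n) W \<omega> - I \<omega>)\<^sup>2) \<partial>M) \<le> ennreal (4 * T * T / 2 ^ n)"
proof -
  note el = elementary_dyadic_step[OF T]
  obtain \<phi> where Im: "I \<in> borel_measurable M" and \<phi>: "\<And>k. elementary_process M F T (\<phi> k)"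
    "(\<lambda>k. L2_dist T (step_value (\<phi> k)) H) \<longlonglongrightarrow> 0"
    "(\<lambda>k. \<integral>\<^sup>+ \<omega>. ennreal ((step_integral (\<phi> k) W \<omega> - I \<omega>)\<^sup>2) \<partial>M) \<longlonglongrightarrow> 0"
    using I unfolding has_ito_integral_def by blast
  have sym: "L2_dist T f g = L2_dist T g f" for f g by (simp add: power2_commute)
  let ?J = "step_integral (dyadic_step T n) W" and ?e = "ennreal (T * T / 2 ^ n)"
  let ?b = "\<lambda>k. 2 * (2 * ?e + 2 * L2_dist T (step_value (\<phi> k)) H) + 2 * (\<integral>\<^sup>+ \<omega>. ennreal ((step_integral (\<phi> k) W \<omega> - I \<omega>)\<^sup>2) \<partial>M)"
  have le: "(\<integral>\<^sup>+ \<omega>. ennreal ((?J \<omega> - I \<omega>)\<^sup>2) \<partial>M) \<le> ?b k" for k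
  proof -
    have "(\<integral>\<^sup>+ \<omega>. ennreal ((?J \<omega> - step_integral (\<phi> k) W \<omega>)\<^sup>2) \<partial>M) = L2_dist T (step_value (dyadic_step T n)) (step_value (\<phi> k))"
      by (rule step_isometry[OF el \<phi>(1)])
    also have "\<dots> \<le> 2 * L2_dist T (step_value (dyadic_step T n)) (H_cont T) + 2 * L2_dist T (H_cont T) (step_value (\<phi> k))"
      by (intro L2_dist_triangle step_value_measurable[OF el] step_value_measurable[OF \<phi>(1)] H_cont_measurable[OF T])
    also have "L2_dist T (H_cont T) (step_value (\<phi> k)) = L2_dist T (step_value (\<phi> k)) H"
      by (subst sym) (simp add: L2_dist_H[OF T])
    also have "2 * L2_dist T (step_value (dyadic_step T n)) (H_cont T) + 2 * L2_dist T (step_value (\<phi> k)) H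
      \<le> 2 * ?e + 2 * L2_dist T (step_value (\<phi> k)) H"
      by (intro add_mono mult_left_mono dyadic_step_L2_dist[OF T]) auto
    finally have 1: "(\<integral>\<^sup>+ \<omega>. ennreal ((?J \<omega> - step_integral (\<phi> k) W \<omega>)\<^sup>2) \<partial>M) \<le> 2 * ?e + 2 * L2_dist T (step_value (\<phi> k)) H" .
    have "(\<integral>\<^sup>+ \<omega>. ennreal ((?J \<omega> - I \<omega>)\<^sup>2) \<partial>M) \<le> 2 * (\<integral>\<^sup>+ \<omega>. ennreal ((?J \<omega> - step_integral (\<phi> k) W \<omega>)\<^sup>2) \<partial>M)
      + 2 * (\<integral>\<^sup>+ \<omega>. ennreal ((step_integral (\<phi> k) W \<omega> - I \<omega>)\<^sup>2) \<partial>M)"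
      by (intro nn_integral_square_diff_le step_integral_measurable[OF el] step_integral_measurable[OF \<phi>(1)] Im)
    also have "\<dots> \<le> ?b k" by (intro add_mono mult_left_mono 1) auto
    finally show ?thesis .
  qed
  have "?b \<longlonglongrightarrow> 2 * (2 * ?e + 2 * 0) + 2 * 0"
    by (intro tendsto_add ennreal_tendsto_cmult tendsto_const \<phi>) auto
  then have "(\<integral>\<^sup>+ \<omega>. ennreal ((?J \<omega> - I \<omega>)\<^sup>2) \<partial>M) \<le> 2 * (2 * ?e + 2 * 0) + 2 * 0"
    by (rule LIMSEQ_le_const) (use le in blast)
  also have "\<dots> = ennreal (4 * T * T / 2 ^ n)"
    using T by (simp add: ennreal_mult[symmetric] ennreal_numeral[symmetric] del: ennreal_numeral)
  finally show ?thesis .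
qed

text \<open>The rate 2^-n makes the squared errors almost surely summable, so the whole dyadic
  sequence converges almost surely and the integral becomes a pathwise limit.\<close>

theorem dyadic_sums_tendsto_ito_integral:
  assumes T: "0 \<le> T"
  shows "ito_integral M F H W T \<in> borel_measurable M"
    and "AE \<omega> in M. (\<lambda>n. \<Sum>i<2 ^ n. H (real i * T / 2 ^ n) \<omega> * (W (real (Suc i) * T / 2 ^ n) \<omega> - W (real i * T / 2 ^ n) \<omega>))
      \<longlonglongrightarrow> ito_integral M F H W T \<omega>"
proof -
  let ?I = "ito_integral M F H W T"
  have I: "has_ito_integral M F H W T ?I"
    unfolding ito_integral_def using has_ito_integral_exists[OF T] by (rule someI_ex)
  then show Im[measurable]: "?I \<in> borel_measurable M" by (simp add: has_ito_integral_def)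
  note [measurable] = step_integral_measurable[OF elementary_dyadic_step[OF T]]
  have "AE \<omega> in M. summable (\<lambda>n. (step_integral (dyadic_step T n) W \<omega> - ?I \<omega>)\<^sup>2)"
  proof (rule AE_summable_of_nn_integral_le[where c="\<lambda>n. 4 * T * T / 2 ^ n"])
    have "summable (\<lambda>n. 4 * T * T * (1/2) ^ n)" by (intro summable_mult summable_geometric) simp
    then show "summable (\<lambda>n. 4 * T * T / 2 ^ n)" by (simp add: power_one_over field_simps)
  qed (use T has_ito_integral_dyadic[OF T I] in auto)
  then show "AE \<omega> in M. (\<lambda>n. \<Sum>i<2 ^ n. H (real i * T / 2 ^ n) \<omega> * (W (real (Suc i) * T / 2 ^ n) \<omega> - W (real i * T / 2 ^ n) \<omega>))
      \<longlonglongrightarrow> ?I \<omega>"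
  proof eventually_elim
    case (elim \<omega>)
    then have "(\<lambda>n. (step_integral (dyadic_step T n) W \<omega> - ?I \<omega>)\<^sup>2) \<longlonglongrightarrow> 0" by (rule summable_LIMSEQ_zero)
    from tendsto_real_sqrt[OF this] have "(\<lambda>n. step_integral (dyadic_step T n) W \<omega> - ?I \<omega>) \<longlonglongrightarrow> 0"
      by - (rule tendsto_rabs_zero_cancel, simp only: real_sqrt_abs real_sqrt_zero)
    then have "(\<lambda>n. step_integral (dyadic_step T n) W \<omega>) \<longlonglongrightarrow> ?I \<omega>" by (rule LIM_zero_cancel)
    then show ?case unfolding dyadic_step_def step_integral.simps .
  qed
qed

end

section \<open>Brownian motions as integrands and integrators\<close>

context prob_space
begin

lemma indep_rv_cong_AE:
  assumes ind: "indep_rv S X T Y" and X': "random_variable S X'" and eq: "AE \<omega> in M. X \<omega> = X' \<omega>"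
  shows "indep_rv S X' T Y"
  unfolding indep_rv_def
proof (intro conjI ballI X')
  note [measurable] = indep_rvD(1,2)[OF ind] X'
  show "random_variable T Y" by measurable
  fix A B assume [measurable]: "A \<in> sets S" "B \<in> sets T"
  have "prob (X' -` A \<inter> space M) = prob (X -` A \<inter> space M)"
    by (rule finite_measure_eq_AE) (use eq in \<open>auto elim!: eventually_mono\<close>)
  moreover have "prob ((X' -` A \<inter> space M) \<inter> (Y -` B \<inter> space M)) = prob ((X -` A \<inter> space M) \<inter> (Y -` B \<inter> space M))"
    by (rule finite_measure_eq_AE) (use eq in \<open>auto elim!: eventually_mono\<close>)
  ultimately show "prob ((X' -` A \<inter> space M) \<inter> (Y -` B \<inter> space M)) = prob (X' -` A \<inter> space M) * prob (Y -` B \<inter> space M)"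
    using indep_rvD(3)[OF ind \<open>A \<in> sets S\<close> \<open>B \<in> sets T\<close>] by simp
qed

text \<open>The second moment drives the isometry, the fourth is for Young's inequality in the final
  estimate. The case s = t is separate, since the definition provides a density only for s <
  t.\<close>

lemma brownian_increment_moments:
  fixes B :: "real \<Rightarrow> 'a \<Rightarrow> real"
  assumes bm: "standard_brownian_motion M B" and st: "0 \<le> s" "s \<le> t"
  shows "integrable M (\<lambda>\<omega>. (B t \<omega> - B s \<omega>) ^ k)" "expectation (\<lambda>\<omega>. B t \<omega> - B s \<omega>) = 0"
    "expectation (\<lambda>\<omega>. (B t \<omega> - B s \<omega>)\<^sup>2) = t - s" "expectation (\<lambda>\<omega>. (B t \<omega> - B s \<omega>) ^ 4) = 3 * (t - s)\<^sup>2"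
proof -
  have "integrable M (\<lambda>\<omega>. (B t \<omega> - B s \<omega>) ^ k) \<and> expectation (\<lambda>\<omega>. B t \<omega> - B s \<omega>) = 0 \<and>
    expectation (\<lambda>\<omega>. (B t \<omega> - B s \<omega>)\<^sup>2) = t - s \<and> expectation (\<lambda>\<omega>. (B t \<omega> - B s \<omega>) ^ 4) = 3 * (t - s)\<^sup>2"
  proof (cases "s = t")
    case False
    then have st': "s < t" using st by simp
    let ?\<sigma> = "sqrt (t - s)"
    have \<sigma>: "0 < ?\<sigma>" using st' by simp
    have D: "distributed M lborel (\<lambda>\<omega>. B t \<omega> - B s \<omega>) (normal_density 0 ?\<sigma>)"
      using bm st st' by (simp add: standard_brownian_motion_def)
    have int: "integrable M (\<lambda>\<omega>. (B t \<omega> - B s \<omega>) ^ k)" for k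
      using distributed_integrable[OF D, of "\<lambda>x. x ^ k"] integrable_normal_moment[OF \<sigma>, of 0 k] by simp
    have even: "expectation (\<lambda>\<omega>. (B t \<omega> - B s \<omega>) ^ (2 * k)) = fact (2 * k) / ((2 / ?\<sigma>\<^sup>2) ^ k * fact k)" for k
      using distributed_integral[OF D, of "\<lambda>x. x ^ (2 * k)"] integral_normal_moment_even[OF \<sigma>, of 0 k] by simp
    have "expectation (\<lambda>\<omega>. B t \<omega> - B s \<omega>) = 0"
      using normal_distributed_expectation[OF \<sigma> D] by simp
    moreover have "expectation (\<lambda>\<omega>. (B t \<omega> - B s \<omega>)\<^sup>2) = t - s"
      using even[of 1] st' by (simp add: fact_numeral)
    moreover have "expectation (\<lambda>\<omega>. (B t \<omega> - B s \<omega>) ^ 4) = 3 * (t - s)\<^sup>2"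
      using even[of 2] st' by (simp add: fact_numeral power_divide)
    ultimately show ?thesis using int by blast
  qed (auto simp: prob_space power_0_left)
  then show "integrable M (\<lambda>\<omega>. (B t \<omega> - B s \<omega>) ^ k)" "expectation (\<lambda>\<omega>. B t \<omega> - B s \<omega>) = 0"
    "expectation (\<lambda>\<omega>. (B t \<omega> - B s \<omega>)\<^sup>2) = t - s" "expectation (\<lambda>\<omega>. (B t \<omega> - B s \<omega>) ^ 4) = 3 * (t - s)\<^sup>2"
    by auto
qed

text \<open>The definition yields independence of increments along one monotone sequence.
  Enumerating finitely many past times and then staying at \<open>t\<close> forever makes the past
  values partial sums of the first \<open>m\<close> increments and the future increment the next
  one. Partial sums start from B 0, which vanishes only almost surely.\<close>

lemma brownian_past_indep:
  fixes B :: "real \<Rightarrow> 'a \<Rightarrow> real"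
  assumes bm: "standard_brownian_motion M B" and st: "0 \<le> s" "s \<le> t"
  shows "indep_rv (PiM {0..s} (\<lambda>_. borel)) (\<lambda>\<omega>. \<lambda>u\<in>{0..s}. B u \<omega>) borel (\<lambda>\<omega>. B t \<omega> - B s \<omega>)"
proof (rule indep_rv_PiM_finite)
  have Bm[measurable]: "B u \<in> borel_measurable M" if "u \<ge> 0" for u
    using bm that by (auto simp: standard_brownian_motion_def)
  show "random_variable borel (B u)" if "u \<in> {0..s}" for u using that by simp
  show "random_variable borel (\<lambda>\<omega>. B t \<omega> - B s \<omega>)"
    using st by (intro borel_measurable_diff Bm) auto
  fix J assume J: "finite J" "J \<subseteq> {0..s}"
  have K: "finite (J \<union> {0, s})" "J \<union> {0, s} \<noteq> {}" using J by auto
  obtain m :: nat and \<tau> :: "nat \<Rightarrow> real" where \<tau>: "\<tau> ` {..m} = J \<union> {0, s}"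
    "\<And>i j. i < j \<Longrightarrow> j \<le> m \<Longrightarrow> \<tau> i < \<tau> j" "mono \<tau>"
    "\<tau> 0 = Min (J \<union> {0, s})" "\<tau> m = Max (J \<union> {0, s})"
    by (rule finite_set_enum_strict_mono[OF K]) (rule that; assumption)
  have range: "\<tau> i \<in> {0..s}" if "i \<le> m" for i
  proof -
    have "\<tau> i \<in> J \<union> {0, s}" using that \<tau>(1) by blast
    then show ?thesis using J(2) st by auto
  qed
  have le: "\<tau> i \<le> \<tau> j" if "i \<le> j" for i j using \<tau>(3) that by (rule monoD)
  have \<tau>0: "\<tau> 0 = 0" unfolding \<tau>(4) by (rule Min_eqI) (use J st in auto)
  have \<tau>m: "\<tau> m = s" unfolding \<tau>(5) by (rule Max_eqI) (use J st in auto)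
  define \<sigma> where "\<sigma> i = (if i \<le> m then \<tau> i else t)" for i
  have "mono \<sigma>"
  proof (rule monoI)
    fix i j :: nat assume "i \<le> j"
    then show "\<sigma> i \<le> \<sigma> j" using range[of i] le[of i j] st by (auto simp: \<sigma>_def)
  qed
  moreover have "0 \<le> \<sigma> 0" by (simp add: \<sigma>_def \<tau>0)
  moreover have "\<forall>\<tau>::nat \<Rightarrow> real. 0 \<le> \<tau> 0 \<longrightarrow> mono \<tau> \<longrightarrow>
      indep_vars (\<lambda>_. borel) (\<lambda>i \<omega>. B (\<tau> (Suc i)) \<omega> - B (\<tau> i) \<omega>) UNIV"
    using bm by (simp add: standard_brownian_motion_def)
  ultimately have "indep_vars (\<lambda>_. borel) (\<lambda>i \<omega>. B (\<sigma> (Suc i)) \<omega> - B (\<sigma> i) \<omega>) UNIV"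
    by blast
  then have ind: "indep_rv (PiM {..<m} (\<lambda>_. borel)) (\<lambda>\<omega>. \<lambda>i\<in>{..<m}. B (\<sigma> (Suc i)) \<omega> - B (\<sigma> i) \<omega>)
    (PiM {m} (\<lambda>_. borel)) (\<lambda>\<omega>. \<lambda>i\<in>{m}. B (\<sigma> (Suc i)) \<omega> - B (\<sigma> i) \<omega>)"
    by (intro indep_var_imp_indep_rv indep_var_restrict) auto
  have "\<forall>u\<in>J. \<exists>k\<le>m. \<tau> k = u" using \<tau>(1) by (metis Un_iff atMost_iff imageE)
  then obtain k where k: "\<And>u. u \<in> J \<Longrightarrow> k u \<le> m" "\<And>u. u \<in> J \<Longrightarrow> \<tau> (k u) = u" by metis
  let ?F = "\<lambda>\<rho> :: nat \<Rightarrow> real. \<lambda>u\<in>J. \<Sum>i<k u. \<rho> i"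
  have F: "?F \<in> measurable (PiM {..<m} (\<lambda>_. borel)) (PiM J (\<lambda>_. borel))"
  proof (intro measurable_restrict borel_measurable_sum measurable_component_singleton)
    fix u i assume "u \<in> J" "i \<in> {..<k u}"
    then show "i \<in> {..<m}" using k(1)[of u] by auto
  qed
  have "(\<lambda>x. x m) \<in> measurable (PiM {m} (\<lambda>_. borel)) borel" by (intro measurable_component_singleton) simp
  from indep_rv_compose[OF ind F this]
  have "indep_rv (PiM J (\<lambda>_. borel)) (\<lambda>\<omega>. ?F (\<lambda>i\<in>{..<m}. B (\<sigma> (Suc i)) \<omega> - B (\<sigma> i) \<omega>)) borel (\<lambda>\<omega>. B t \<omega> - B s \<omega>)"
    by (simp add: \<sigma>_def \<tau>m)
  also have "(\<lambda>\<omega>. ?F (\<lambda>i\<in>{..<m}. B (\<sigma> (Suc i)) \<omega> - B (\<sigma> i) \<omega>)) = (\<lambda>\<omega>. \<lambda>u\<in>J. B u \<omega> - B 0 \<omega>)"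
  proof (intro ext)
    fix \<omega> u
    show "?F (\<lambda>i\<in>{..<m}. B (\<sigma> (Suc i)) \<omega> - B (\<sigma> i) \<omega>) u = (\<lambda>u\<in>J. B u \<omega> - B 0 \<omega>) u"
    proof (cases "u \<in> J")
      case True
      note ku = k(1)[OF True] k(2)[OF True]
      have "(\<Sum>i<k u. (\<lambda>i\<in>{..<m}. B (\<sigma> (Suc i)) \<omega> - B (\<sigma> i) \<omega>) i) = (\<Sum>i<k u. B (\<tau> (Suc i)) \<omega> - B (\<tau> i) \<omega>)"
        using ku by (intro sum.cong) (auto simp: \<sigma>_def)
      also have "\<dots> = B u \<omega> - B 0 \<omega>"
        using sum_lessThan_telescope[of "\<lambda>i. B (\<tau> i) \<omega>" "k u"] by (simp add: ku \<tau>0)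
      finally show ?thesis using True by simp
    qed simp
  qed
  finally have ind': "indep_rv (PiM J (\<lambda>_. borel)) (\<lambda>\<omega>. \<lambda>u\<in>J. B u \<omega> - B 0 \<omega>) borel (\<lambda>\<omega>. B t \<omega> - B s \<omega>)" .
  show "indep_rv (PiM J (\<lambda>_. borel)) (\<lambda>\<omega>. \<lambda>u\<in>J. B u \<omega>) borel (\<lambda>\<omega>. B t \<omega> - B s \<omega>)"
  proof (rule indep_rv_cong_AE[OF ind'])
    show "random_variable (PiM J (\<lambda>_. borel)) (\<lambda>\<omega>. \<lambda>u\<in>J. B u \<omega>)"
      using J(2) by (intro measurable_restrict Bm) auto
    have "AE \<omega> in M. B 0 \<omega> = 0" using bm by (simp add: standard_brownian_motion_def)
    then show "AE \<omega> in M. (\<lambda>u\<in>J. B u \<omega> - B 0 \<omega>) = (\<lambda>u\<in>J. B u \<omega>)" by eventually_elim simp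
  qed
qed

lemma brownian_pair_past_indep:
  assumes ind: "independent_brownian_motions M B1 B2" and st: "0 \<le> s" "s \<le> t"
  shows "indep_rv (PiM {0..s} (\<lambda>_. borel) \<Otimes>\<^sub>M PiM {0..s} (\<lambda>_. borel))
    (\<lambda>\<omega>. (\<lambda>u\<in>{0..s}. B1 u \<omega>, \<lambda>u\<in>{0..s}. B2 u \<omega>)) borel (\<lambda>\<omega>. B2 t \<omega> - B2 s \<omega>)"
proof (rule indep_rv_pair_left)
  have bm: "standard_brownian_motion M B2" and
    12: "indep_var (PiM {0..} (\<lambda>_. borel)) (\<lambda>\<omega>. \<lambda>t\<in>{0..}. B1 t \<omega>) (PiM {0..} (\<lambda>_. borel)) (\<lambda>\<omega>. \<lambda>t\<in>{0..}. B2 t \<omega>)"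
    using ind by (auto simp: independent_brownian_motions_def)
  show "indep_rv (PiM {0..s} (\<lambda>_. borel)) (\<lambda>\<omega>. \<lambda>u\<in>{0..s}. B2 u \<omega>) borel (\<lambda>\<omega>. B2 t \<omega> - B2 s \<omega>)"
    by (rule brownian_past_indep[OF bm st])
  let ?f1 = "\<lambda>x :: real \<Rightarrow> real. \<lambda>u\<in>{0..s}. x u"
  let ?f2 = "\<lambda>x :: real \<Rightarrow> real. (\<lambda>u\<in>{0..s}. x u, x t - x s)"
  have "?f1 \<in> measurable (PiM {0..} (\<lambda>_. borel)) (PiM {0..s} (\<lambda>_. borel))"
    by (intro measurable_restrict measurable_component_singleton) auto
  moreover have "?f2 \<in> measurable (PiM {0..} (\<lambda>_. borel)) (PiM {0..s} (\<lambda>_. borel) \<Otimes>\<^sub>M borel)"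
    using st by (intro measurable_Pair measurable_restrict borel_measurable_diff measurable_component_singleton) auto
  ultimately have "indep_rv (PiM {0..s} (\<lambda>_. borel)) (\<lambda>\<omega>. ?f1 (\<lambda>t\<in>{0..}. B1 t \<omega>))
     (PiM {0..s} (\<lambda>_. borel) \<Otimes>\<^sub>M borel) (\<lambda>\<omega>. ?f2 (\<lambda>t\<in>{0..}. B2 t \<omega>))"
    by (rule indep_rv_compose[OF indep_var_imp_indep_rv[OF 12]])
  moreover have "(\<lambda>\<omega>. ?f1 (\<lambda>t\<in>{0..}. B1 t \<omega>)) = (\<lambda>\<omega>. \<lambda>u\<in>{0..s}. B1 u \<omega>)"
    by (auto simp: fun_eq_iff restrict_def)
  moreover have "(\<lambda>\<omega>. ?f2 (\<lambda>t\<in>{0..}. B2 t \<omega>)) = (\<lambda>\<omega>. (\<lambda>u\<in>{0..s}. B2 u \<omega>, B2 t \<omega> - B2 s \<omega>))"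
    using st by (auto simp: fun_eq_iff restrict_def)
  ultimately show "indep_rv (PiM {0..s} (\<lambda>_. borel)) (\<lambda>\<omega>. \<lambda>u\<in>{0..s}. B1 u \<omega>)
     (PiM {0..s} (\<lambda>_. borel) \<Otimes>\<^sub>M borel) (\<lambda>\<omega>. (\<lambda>u\<in>{0..s}. B2 u \<omega>, B2 t \<omega> - B2 s \<omega>))"
    by simp
qed

end

text \<open>The map \<open>\<phi>\<close> is the identity or the swap, so that both orders of integrand and integrator are
  covered by one filtration.\<close>

lemma ito_integrand_brownian:
  fixes M :: "'w measure" and B1 B2 :: "real \<Rightarrow> 'w \<Rightarrow> real" and \<phi> :: "real \<times> real \<Rightarrow> real \<times> real"
  assumes ind: "independent_brownian_motions M B1 B2"
    and \<phi>: "\<phi> \<in> measurable borel borel" "\<And>p. \<phi> (\<phi> p) = p"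
    and F: "\<And>s. F s = vimage_algebra (space M) (\<lambda>\<omega>. \<lambda>u\<in>{0..s}. \<phi> (B1 u \<omega>, B2 u \<omega>)) (PiM {0..s} (\<lambda>_. borel))"
  shows "ito_integrand M F B1 B2"
proof -
  have bm: "standard_brownian_motion M B1" "standard_brownian_motion M B2"
    using ind by (auto simp: independent_brownian_motions_def)
  then interpret prob_space M by (simp add: standard_brownian_motion_def)
  have Bm[measurable]: "B1 u \<in> borel_measurable M" "B2 u \<in> borel_measurable M" if "u \<ge> 0" for u
    using bm that by (auto simp: standard_brownian_motion_def)
  let ?path = "\<lambda>s \<omega>. \<lambda>u\<in>{0..s}. \<phi> (B1 u \<omega>, B2 u \<omega>)"
  have pth: "indep_rv (PiM {0..s} (\<lambda>_. borel)) (?path s) borel (\<lambda>\<omega>. B2 t \<omega> - B2 s \<omega>)" if "0 \<le> s" "s \<le> t" for s t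
  proof -
    have "(\<lambda>p. \<lambda>u\<in>{0..s}. \<phi> (fst p u, snd p u)) \<in> measurable (PiM {0..s} (\<lambda>_. borel) \<Otimes>\<^sub>M PiM {0..s} (\<lambda>_. borel)) (PiM {0..s} (\<lambda>_. borel))"
    proof (intro measurable_restrict measurable_compose[OF _ \<phi>(1)] borel_measurable_Pair)
      fix u assume "u \<in> {0..s}"
      then show "(\<lambda>p :: (real \<Rightarrow> real) \<times> (real \<Rightarrow> real). fst p u) \<in> borel_measurable (PiM {0..s} (\<lambda>_. borel) \<Otimes>\<^sub>M PiM {0..s} (\<lambda>_. borel))"
        "(\<lambda>p :: (real \<Rightarrow> real) \<times> (real \<Rightarrow> real). snd p u) \<in> borel_measurable (PiM {0..s} (\<lambda>_. borel) \<Otimes>\<^sub>M PiM {0..s} (\<lambda>_. borel))"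
        by (auto intro!: measurable_compose[OF measurable_fst] measurable_compose[OF measurable_snd] measurable_component_singleton)
    qed
    from indep_rv_compose[OF brownian_pair_past_indep[OF ind that] this measurable_ident]
    show ?thesis by (simp add: restrict_def cong: if_cong)
  qed
  have sp: "?path s \<in> space M \<rightarrow> space (PiM {0..s} (\<lambda>_. borel))" for s
    by (auto simp: space_PiM)
  have path_meas: "?path s \<in> measurable (F s) (PiM {0..s} (\<lambda>_. borel))" for s
    unfolding F by (rule measurable_vimage_algebra1[OF sp])
  have spF: "space (F s) = space M" for s by (simp add: F)
  show ?thesis
  proof
    fix s t :: real and X :: "'w \<Rightarrow> real"
    assume s: "0 \<le> s"
    \<comment> \<open>Independence from the zero increment is invoked only for the measurability it
      contains.\<close>
    { assume "X \<in> borel_measurable (F s)"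
      then have "indep_rv borel X borel (\<lambda>\<omega>. B2 s \<omega> - B2 s \<omega>)"
        unfolding F by (rule indep_rv_vimage_algebra[OF pth[OF s order_refl]])
      then show "X \<in> borel_measurable M" by (rule indep_rvD) }
    show "B2 s \<in> borel_measurable (F s)" "B1 s \<in> borel_measurable (F s)"
    proof -
      have c: "(\<lambda>\<omega>. \<phi> (?path s \<omega> s)) \<in> measurable (F s) (borel \<Otimes>\<^sub>M borel)"
        using s by (subst borel_prod) (intro measurable_compose[OF _ \<phi>(1)] measurable_compose[OF path_meas] measurable_component_singleton, simp)
      have "(\<lambda>\<omega>. snd (\<phi> (?path s \<omega> s))) \<in> borel_measurable (F s)" "(\<lambda>\<omega>. fst (\<phi> (?path s \<omega> s))) \<in> borel_measurable (F s)"
        by (rule measurable_compose[OF c measurable_snd], rule measurable_compose[OF c measurable_fst])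
      then show "B2 s \<in> borel_measurable (F s)" "B1 s \<in> borel_measurable (F s)" using s by (simp_all add: \<phi>(2))
    qed
    assume st: "s \<le> t"
    { assume X: "X \<in> borel_measurable (F s)"
      have "(\<lambda>x. x) \<in> measurable (F t) (F s)"
        unfolding F[of s]
      proof (rule measurable_vimage_algebra2)
        have "(\<lambda>x. \<lambda>u\<in>{0..s}. x u) \<in> measurable (PiM {0..t} (\<lambda>_. borel :: (real \<times> real) measure)) (PiM {0..s} (\<lambda>_. borel))"
          using st by (intro measurable_restrict measurable_component_singleton) auto
        from measurable_compose[OF path_meas this]
        have "(\<lambda>\<omega>. \<lambda>u\<in>{0..s}. ?path t \<omega> u) \<in> measurable (F t) (PiM {0..s} (\<lambda>_. borel))" .
        also have "(\<lambda>\<omega>. \<lambda>u\<in>{0..s}. ?path t \<omega> u) = ?path s" using st by (auto simp: fun_eq_iff restrict_def)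
        finally show "?path s \<in> measurable (F t) (PiM {0..s} (\<lambda>_. borel))" .
      qed (simp add: spF)
      from measurable_compose[OF this X] show "X \<in> borel_measurable (F t)" . }
    { assume "X \<in> borel_measurable (F s)"
      then show "indep_rv borel X borel (\<lambda>\<omega>. B2 t \<omega> - B2 s \<omega>)"
        unfolding F by (rule indep_rv_vimage_algebra[OF pth[OF s st]]) }
    show "expectation (\<lambda>\<omega>. B2 t \<omega> - B2 s \<omega>) = 0" "integrable M (\<lambda>\<omega>. (B2 t \<omega> - B2 s \<omega>)\<^sup>2)"
      "expectation (\<lambda>\<omega>. (B2 t \<omega> - B2 s \<omega>)\<^sup>2) = t - s"
      using brownian_increment_moments[OF bm(2) s st] by auto
    show "(\<integral>\<^sup>+ \<omega>. ennreal ((B1 t \<omega> - B1 s \<omega>)\<^sup>2) \<partial>M) = ennreal (t - s)"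
      using brownian_increment_moments(1,3)[OF bm(1) s st] by (subst nn_integral_eq_integral) auto
  next
    show "AE \<omega> in M. B1 0 \<omega> = 0" "AE \<omega> in M. continuous_on {0..} (\<lambda>t. B1 t \<omega>)"
      using bm by (auto simp: standard_brownian_motion_def)
  qed
qed

lemma independent_brownian_motions_sym:
  assumes "independent_brownian_motions M B1 B2"
  shows "independent_brownian_motions M B2 B1"
proof -
  have *: "standard_brownian_motion M B1" "standard_brownian_motion M B2"
    "prob_space.indep_var M (PiM {0..} (\<lambda>_. borel)) (\<lambda>\<omega>. \<lambda>t\<in>{0..}. B1 t \<omega>) (PiM {0..} (\<lambda>_. borel)) (\<lambda>\<omega>. \<lambda>t\<in>{0..}. B2 t \<omega>)"
    using assms by (auto simp: independent_brownian_motions_def)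
  interpret prob_space M using *(1) by (simp add: standard_brownian_motion_def)
  show ?thesis unfolding independent_brownian_motions_def
    using * indep_rv_imp_indep_var[OF indep_rv_sym[OF indep_var_imp_indep_rv[OF *(3)]]] by blast
qed

text \<open>Left-point sums, as in the Ito integral. The antisymmetric combination is the signed
  area swept from the origin by the polygon through the grid points; it is bilinear in the two
  paths.\<close>

definition area_sum :: "real \<Rightarrow> nat \<Rightarrow> (real \<Rightarrow> real) \<Rightarrow> (real \<Rightarrow> real) \<Rightarrow> real" where
  "area_sum T n x y = (\<Sum>i<2 ^ n. x (real i * T / 2 ^ n) * (y (real (Suc i) * T / 2 ^ n) - y (real i * T / 2 ^ n))
    - y (real i * T / 2 ^ n) * (x (real (Suc i) * T / 2 ^ n) - x (real i * T / 2 ^ n))) / 2"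

theorem area_sum_tendsto_levy_area:
  assumes ind: "independent_brownian_motions M B1 B2" and T: "0 \<le> T"
  shows "levy_area M B1 B2 T \<in> borel_measurable M"
    and "AE \<omega> in M. (\<lambda>n. area_sum T n (\<lambda>s. B1 s \<omega>) (\<lambda>s. B2 s \<omega>)) \<longlonglongrightarrow> levy_area M B1 B2 T \<omega>"
proof -
  let ?F = "natural_filtration M B1 B2"
  interpret I1: ito_integrand M ?F B1 B2
    by (rule ito_integrand_brownian[OF ind, of "\<lambda>p. p"]) (auto simp: natural_filtration_def)
  have sw: "prod.swap \<in> measurable borel (borel :: (real \<times> real) measure)"
    by (intro borel_measurable_continuous_onI continuous_on_swap)
  interpret I2: ito_integrand M ?F B2 B1
    by (rule ito_integrand_brownian[OF independent_brownian_motions_sym[OF ind] sw]) (auto simp: natural_filtration_def)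
  note 1 = I1.dyadic_sums_tendsto_ito_integral[OF T] and 2 = I2.dyadic_sums_tendsto_ito_integral[OF T]
  show "levy_area M B1 B2 T \<in> borel_measurable M"
    unfolding levy_area_def[abs_def] using 1(1) 2(1) by measurable
  show "AE \<omega> in M. (\<lambda>n. area_sum T n (\<lambda>s. B1 s \<omega>) (\<lambda>s. B2 s \<omega>)) \<longlonglongrightarrow> levy_area M B1 B2 T \<omega>"
    using 1(2) 2(2)
  proof eventually_elim
    case (elim \<omega>)
    show ?case unfolding area_sum_def levy_area_def sum_subtractf
      by (intro tendsto_divide tendsto_diff elim tendsto_const) simp
  qed
qed

section \<open>Conditional structure of the Levy area\<close>

text \<open>Taking the inverse in \<open>ennreal\<close> makes the value at \<open>0\<close> infinite and the function continuous.\<close>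

definition singular_weight :: "real \<Rightarrow> real \<Rightarrow> ennreal" where
  "singular_weight T x = inverse (ennreal ((\<bar>x\<bar> / T) powr (2/3)))"

lemma singular_weight_measurable[measurable]: "singular_weight T \<in> borel_measurable borel"
  unfolding singular_weight_def[abs_def] by measurable

lemma singular_weight_tendsto:
  assumes "(f \<longlongrightarrow> l) F" "T > 0"
  shows "((\<lambda>n. singular_weight T (f n)) \<longlongrightarrow> singular_weight T l) F"
proof -
  have "((\<lambda>n. (\<bar>f n\<bar> / T) powr (2/3)) \<longlongrightarrow> (\<bar>l\<bar> / T) powr (2/3)) F"
    using assms by (intro tendsto_powr' tendsto_divide tendsto_rabs tendsto_const) auto
  then have lim: "((\<lambda>n. ennreal ((\<bar>f n\<bar> / T) powr (2/3))) \<longlongrightarrow> ennreal ((\<bar>l\<bar> / T) powr (2/3))) F"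
    by (rule tendsto_ennrealI)
  have "continuous_on UNIV (inverse :: ennreal \<Rightarrow> ennreal)"
    by (rule continuous_on_inverse_ennreal) (rule continuous_on_id)
  then have "isCont (inverse :: ennreal \<Rightarrow> ennreal) x" for x
    by (simp add: continuous_on_eq_continuous_at)
  from isCont_tendsto_compose[OF this lim] show ?thesis by (simp add: singular_weight_def)
qed

lemma singular_weight_nonzero:
  assumes "x \<noteq> 0" "T > 0"
  shows "singular_weight T x = ennreal ((\<bar>x\<bar> / T) powr (-2/3))"
  using assms by (simp add: singular_weight_def inverse_ennreal powr_minus)

lemma nn_integral_powr_symmetric:
  assumes T: "T > 0"
  shows "(\<integral>\<^sup>+ x. ennreal ((\<bar>x\<bar> / T) powr (-2/3)) * indicator {-T..T} x \<partial>lborel) \<le> ennreal (6 * T)"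
proof -
  let ?f = "\<lambda>x. ennreal ((x / T) powr (-2/3)) * indicator {0..T} x"
  have half: "(\<integral>\<^sup>+ x. ?f x \<partial>lborel) = ennreal (3 * T)"
  proof -
    have "((\<lambda>x. x powr (-2/3)) has_integral (T powr (-2/3 + 1) / (-2/3 + 1))) {0..T}"
      using T by (intro has_integral_powr_from_0) auto
    from has_integral_mult_right[OF this, of "T powr (2/3)"]
    have "((\<lambda>x. T powr (2/3) * x powr (-2/3)) has_integral (T powr (2/3) * (T powr (-2/3 + 1) / (-2/3 + 1)))) {0..T}" .
    also have "T powr (2/3) * (T powr (-2/3 + 1) / (-2/3 + 1)) = 3 * T"
      using T by (simp add: powr_add[symmetric])
    finally have "integral\<^sup>N lborel (\<lambda>x. ennreal (T powr (2/3) * x powr (-2/3)) * indicator {0..T} x) = ennreal (3 * T)"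
      by (rule nn_integral_has_integral_lebesgue'[rotated]) simp
    also have "(\<lambda>x. ennreal (T powr (2/3) * x powr (-2/3)) * indicator {0..T} x) = ?f"
    proof
      fix x
      show "ennreal (T powr (2/3) * x powr (-2/3)) * indicator {0..T} x = ?f x"
      proof (cases "x \<in> {0..T}")
        case True
        then have "(x / T) powr (-2/3) = T powr (2/3) * x powr (-2/3)"
          using T by (simp add: powr_divide powr_minus field_simps)
        then show ?thesis by simp
      qed simp
    qed
    finally show ?thesis .
  qed
  have "(\<integral>\<^sup>+ x. ennreal ((\<bar>x\<bar> / T) powr (-2/3)) * indicator {-T..T} x \<partial>lborel)
    \<le> (\<integral>\<^sup>+ x. ?f x + ?f (- x) \<partial>lborel)"
  proof (rule nn_integral_mono)
    fix x :: real
    show "ennreal ((\<bar>x\<bar> / T) powr (-2/3)) * indicator {-T..T} x \<le> ?f x + ?f (- x)"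
      by (cases "x \<ge> 0") (auto simp: indicator_def)
  qed
  also have "\<dots> = (\<integral>\<^sup>+ x. ?f x \<partial>lborel) + (\<integral>\<^sup>+ x. ?f (- x) \<partial>lborel)"
    by (rule nn_integral_add) measurable
  also have "(\<integral>\<^sup>+ x. ?f (- x) \<partial>lborel) = (\<integral>\<^sup>+ x. ?f x \<partial>lborel)"
    by (subst (2) nn_integral_real_affine[where c="-1" and t=0]) auto
  also have "(\<integral>\<^sup>+ x. ?f x \<partial>lborel) + (\<integral>\<^sup>+ x. ?f x \<partial>lborel) = ennreal (6 * T)"
    unfolding half using T by (simp add: ennreal_plus[symmetric] del: ennreal_plus)
  finally show ?thesis .
qed

text \<open>Since sqrt (2 * pi) \<ge> 2 and s \<ge> T / 8, the density is at most 4 / T. Outside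
  \<open>{-T..T}\<close> the weight is at most 1, inside it integrates to at most 6 * T, so the
  bound is 1 + (4 / T) * (6 * T) = 25.\<close>

lemma nn_integral_singular_weight_normal:
  assumes T: "T > 0" and s: "T / 8 \<le> s"
  shows "(\<integral>\<^sup>+ x. ennreal (normal_density 0 s x) * singular_weight T x \<partial>lborel) \<le> 25"
proof -
  have s0: "s > 0" using T s by simp
  have d: "normal_density 0 s x \<le> 4 / T" for x
  proof -
    have "2 \<le> sqrt (2 * pi)" using pi_ge_two by (intro real_le_rsqrt) simp
    then have "2 * (T / 8) \<le> sqrt (2 * pi) * s" using s T by (intro mult_mono) auto
    then have "T / 4 \<le> sqrt (2 * pi * s\<^sup>2)" using s0 by (simp add: real_sqrt_mult)
    moreover have "0 < sqrt (2 * pi * s\<^sup>2)" using s0 by simp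
    ultimately have "1 / sqrt (2 * pi * s\<^sup>2) \<le> 1 / (T / 4)" using T by (intro divide_left_mono mult_pos_pos) simp_all
    moreover have "exp (- x\<^sup>2 / (2 * s\<^sup>2)) \<le> 1" by simp
    ultimately have "1 / sqrt (2 * pi * s\<^sup>2) * exp (- x\<^sup>2 / (2 * s\<^sup>2)) \<le> 1 / (T / 4) * 1"
      using T by (intro mult_mono) auto
    then show ?thesis by (simp add: normal_density_def)
  qed
  have "(\<integral>\<^sup>+ x. ennreal (normal_density 0 s x) * singular_weight T x \<partial>lborel)
    \<le> (\<integral>\<^sup>+ x. ennreal (normal_density 0 s x) + ennreal (4 / T) * (ennreal ((\<bar>x\<bar> / T) powr (-2/3)) * indicator {-T..T} x) \<partial>lborel)"
  proof (rule nn_integral_mono_AE)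
    have "AE x in lborel. x \<noteq> (0::real)" by (rule AE_lborel_singleton)
    then show "AE x in lborel. ennreal (normal_density 0 s x) * singular_weight T x
      \<le> ennreal (normal_density 0 s x) + ennreal (4 / T) * (ennreal ((\<bar>x\<bar> / T) powr (-2/3)) * indicator {-T..T} x)"
    proof eventually_elim
      case (elim x)
      note w = singular_weight_nonzero[OF elim T]
      show ?case
      proof (cases "x \<in> {-T..T}")
        case True
        then have "ennreal (normal_density 0 s x) * singular_weight T x \<le> ennreal (4 / T) * (ennreal ((\<bar>x\<bar> / T) powr (-2/3)) * indicator {-T..T} x)"
          unfolding w using d by (simp add: mult_right_mono ennreal_leI)
        also have "\<dots> \<le> ennreal (normal_density 0 s x) + \<dots>" by simp
        finally show ?thesis .
      next
        case False
        then have "1 \<le> \<bar>x\<bar> / T" using T by (auto simp: field_simps)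
        then have "(\<bar>x\<bar> / T) powr (-2/3) \<le> (\<bar>x\<bar> / T) powr 0" by (intro powr_mono) auto
        then have "singular_weight T x \<le> 1" unfolding w using elim T by simp
        then have "ennreal (normal_density 0 s x) * singular_weight T x \<le> ennreal (normal_density 0 s x) * 1"
          by (intro mult_left_mono) auto
        then show ?thesis using False by simp
      qed
    qed
  qed
  also have "\<dots> = (\<integral>\<^sup>+ x. ennreal (normal_density 0 s x) \<partial>lborel) +
    ennreal (4 / T) * (\<integral>\<^sup>+ x. ennreal ((\<bar>x\<bar> / T) powr (-2/3)) * indicator {-T..T} x \<partial>lborel)"
    by (subst nn_integral_add) (auto simp: nn_integral_cmult)
  also have "(\<integral>\<^sup>+ x. ennreal (normal_density 0 s x) \<partial>lborel) = 1"
    using s0 by (subst nn_integral_eq_integral) auto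
  also have "1 + ennreal (4 / T) * (\<integral>\<^sup>+ x. ennreal ((\<bar>x\<bar> / T) powr (-2/3)) * indicator {-T..T} x \<partial>lborel)
    \<le> 1 + ennreal (4 / T) * ennreal (6 * T)"
    by (intro add_left_mono mult_left_mono nn_integral_powr_symmetric T) auto
  also have "\<dots> = 25"
  proof -
    have "ennreal (4 / T) * ennreal (6 * T) = ennreal 24" using T by (simp add: ennreal_mult[symmetric])
    then show ?thesis by simp
  qed
  finally show ?thesis .
qed

section \<open>Dyadic area sums against the tent function\<close>

abbreviation tent :: "real \<Rightarrow> real \<Rightarrow> real" where
  "tent T s \<equiv> min s (T - s)"

lemma dyadic_time_in_range:
  assumes "0 \<le> T" "i \<le> 2 ^ n"
  shows "real i * T / 2 ^ n \<in> {0..T}"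
proof -
  have "real i \<le> 2 ^ n" using assms(2) by (metis of_nat_le_iff of_nat_numeral of_nat_power)
  then show ?thesis using assms(1) mult_right_mono[of "real i" "2 ^ n" T] by (simp add: divide_le_eq mult.commute)
qed

lemma area_sum_cong:
  assumes "0 \<le> T" "\<And>s. s \<in> {0..T} \<Longrightarrow> x s = x' s" "\<And>s. s \<in> {0..T} \<Longrightarrow> y s = y' s"
  shows "area_sum T n x y = area_sum T n x' y'"
proof -
  note g = dyadic_time_in_range[OF assms(1), of _ n]
  show ?thesis unfolding area_sum_def
  proof (intro arg_cong[where f="\<lambda>x. x / 2"] sum.cong refl)
    fix i :: nat assume "i \<in> {..<2 ^ n}"
    then show "x (real i * T / 2 ^ n) * (y (real (Suc i) * T / 2 ^ n) - y (real i * T / 2 ^ n)) -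
         y (real i * T / 2 ^ n) * (x (real (Suc i) * T / 2 ^ n) - x (real i * T / 2 ^ n)) =
         x' (real i * T / 2 ^ n) * (y' (real (Suc i) * T / 2 ^ n) - y' (real i * T / 2 ^ n)) -
         y' (real i * T / 2 ^ n) * (x' (real (Suc i) * T / 2 ^ n) - x' (real i * T / 2 ^ n))"
      using assms(2,3)[OF g[of i]] assms(2,3)[OF g[of "Suc i"]] by (simp del: of_nat_Suc)
  qed
qed

lemma area_sum_linear:
  "area_sum T n x (\<lambda>s. y s + c * z s) = area_sum T n x y + c * area_sum T n x z"
  unfolding area_sum_def
  by (simp add: sum_distrib_left sum.distrib[symmetric] add_divide_distrib[symmetric] algebra_simps)

text \<open>Summation by parts; the boundary terms vanish because the tent does so at both ends.
  What remains is linear in the increments of \<open>x\<close>, hence Gaussian for a Brownian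
  path.\<close>

lemma area_sum_tent:
  "area_sum T n x (tent T) = (\<Sum>i<2 ^ n. - ((tent T (real i * T / 2 ^ n) + tent T (real (Suc i) * T / 2 ^ n)) / 2)
    * (x (real (Suc i) * T / 2 ^ n) - x (real i * T / 2 ^ n)))" if "T \<ge> 0"
proof -
  define p where "p i = tent T (real i * T / 2 ^ n)" for i
  define b where "b i = x (real i * T / 2 ^ n)" for i
  have "(\<Sum>i<2 ^ n. b i * (p (Suc i) - p i) - p i * (b (Suc i) - b i))
    = (\<Sum>i<2 ^ n. (b (Suc i) * p (Suc i) - b i * p i) - (p i + p (Suc i)) * (b (Suc i) - b i))"
    by (simp add: algebra_simps)
  also have "\<dots> = (b (2 ^ n) * p (2 ^ n) - b 0 * p 0) - (\<Sum>i<2 ^ n. (p i + p (Suc i)) * (b (Suc i) - b i))"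
    unfolding sum_subtractf[of "\<lambda>i. b (Suc i) * p (Suc i) - b i * p i"]
    by (subst sum_lessThan_telescope) simp
  also have "b (2 ^ n) * p (2 ^ n) - b 0 * p 0 = 0" using that by (simp add: p_def)
  finally show ?thesis
    unfolding area_sum_def p_def[symmetric] b_def[symmetric]
    by (simp add: sum_negf sum_divide_distrib)
qed

text \<open>The variance is a sum of squares. The lower bound keeps only the 2^(n-2) steps inside
  the second quarter of the time interval, where the tent is at least T / 4; each contributes at
  least (T / 4)^2 / 2^n, in total (T / 8)^2. For n \<ge> 2 the quarter points lie on the
  grid.\<close>

lemma (in prob_space) area_sum_tent_normal:
  fixes B :: "real \<Rightarrow> 'a \<Rightarrow> real"
  assumes bm: "standard_brownian_motion M B" and T: "T > 0" and n: "n \<ge> 2"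
  obtains s where "T / 8 \<le> s"
    "distributed M lborel (\<lambda>\<omega>. area_sum T n (\<lambda>s. B s \<omega>) (tent T) / sqrt T) (normal_density 0 s)"
proof -
  define \<tau> where "\<tau> i = real i * T / 2 ^ n" for i
  define c where "c i = (tent T (\<tau> i) + tent T (\<tau> (Suc i))) / 2" for i
  define X where "X i \<omega> = - (c i / sqrt T) * (B (\<tau> (Suc i)) \<omega> - B (\<tau> i) \<omega>)" for i \<omega>
  have st: "\<tau> (Suc i) = \<tau> i + T / 2 ^ n" for i by (simp add: \<tau>_def add_divide_distrib distrib_right)
  have \<tau>0: "0 \<le> \<tau> i" for i using T by (simp add: \<tau>_def)
  have mono: "\<tau> i \<le> \<tau> j" if "i \<le> j" for i j
    using T that by (auto simp: \<tau>_def intro!: divide_right_mono mult_right_mono)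
  obtain k where k: "n = k + 2" using n le_Suc_ex by (metis add.commute)
  have le_half: "\<tau> (2 ^ (n - 1)) = T / 2" "\<tau> (2 ^ k) = T / 4" "\<tau> (2 ^ n) = T" "\<tau> 0 = 0"
    by (simp_all add: \<tau>_def k power_add)
  have str: "\<tau> i < \<tau> j" if "i < j" for i j
    using T that by (auto simp: \<tau>_def intro!: divide_strict_right_mono mult_strict_right_mono)
  have tent0: "0 \<le> tent T (\<tau> i)" if "i \<le> 2 ^ n" for i
    using mono[OF that] \<tau>0 by (simp add: le_half)
  have tent1: "0 < tent T (\<tau> i)" if "0 < i" "i < 2 ^ n" for i
    using str[OF that(1)] str[OF that(2)] by (simp add: le_half)
  \<comment> \<open>Every summand needs a positive standard deviation to have a normal density. The
    tent vanishes at the two extreme grid points, but its mean over neighbouring points never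
    does.\<close>
  have c0: "0 < c i" if "i < 2 ^ n" for i
  proof (cases "i = 0")
    case True
    have "(1::nat) < 2 ^ n" using n by (intro one_less_power) auto
    from add_nonneg_pos[OF tent0[of 0] tent1[OF _ this]] show ?thesis using True by (simp add: c_def)
  next
    case False
    then show ?thesis using that add_pos_nonneg[OF tent1[of i] tent0[of "Suc i"]] by (simp add: c_def)
  qed
  have cbig: "T / 4 \<le> c i" if "i \<in> {2 ^ k..<2 ^ (n - 1)}" for i
  proof -
    have "T / 4 \<le> \<tau> i" using mono[of "2 ^ k" i] that unfolding le_half by simp
    moreover have "\<tau> (Suc i) \<le> T / 2" using mono[of "Suc i" "2 ^ (n - 1)"] that unfolding le_half by simp
    moreover have "\<tau> i \<le> \<tau> (Suc i)" by (rule mono) simp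
    ultimately show ?thesis by (simp add: c_def min_def)
  qed
  have indB: "indep_vars (\<lambda>_. borel) (\<lambda>i \<omega>. B (\<tau> (Suc i)) \<omega> - B (\<tau> i) \<omega>) UNIV"
  proof -
    have "mono \<tau>" using mono by (rule monoI)
    moreover have "\<forall>\<tau>::nat \<Rightarrow> real. 0 \<le> \<tau> 0 \<longrightarrow> mono \<tau> \<longrightarrow>
        indep_vars (\<lambda>_. borel) (\<lambda>i \<omega>. B (\<tau> (Suc i)) \<omega> - B (\<tau> i) \<omega>) UNIV"
      using bm by (simp add: standard_brownian_motion_def)
    ultimately show ?thesis using \<tau>0 by blast
  qed
  have ind: "indep_vars (\<lambda>_. borel) X {..<2 ^ n}"
    unfolding X_def
    by (rule indep_vars_compose2[OF indep_vars_subset[OF indB], where Y="\<lambda>i x. - (c i / sqrt T) * x"]) auto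
  define \<sigma> where "\<sigma> i = (c i / sqrt T) * sqrt (T / 2 ^ n)" for i
  have \<sigma>: "0 < \<sigma> i" if "i < 2 ^ n" for i using c0[OF that] T by (simp add: \<sigma>_def)
  have dX: "distributed M lborel (X i) (normal_density 0 (\<sigma> i))" if "i < 2 ^ n" for i
  proof -
    have "distributed M lborel (\<lambda>\<omega>. B (\<tau> (Suc i)) \<omega> - B (\<tau> i) \<omega>) (normal_density 0 (sqrt (\<tau> (Suc i) - \<tau> i)))"
      using bm \<tau>0[of i] str[of i "Suc i"] by (simp add: standard_brownian_motion_def)
    then have "distributed M lborel (\<lambda>\<omega>. B (\<tau> (Suc i)) \<omega> - B (\<tau> i) \<omega>) (normal_density 0 (sqrt (T / 2 ^ n)))"
      by (simp add: st)
    from normal_density_affine[OF this, of "- (c i / sqrt T)" 0] show ?thesis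
      using c0[OF that] T by (simp add: X_def[abs_def] \<sigma>_def)
  qed
  define s where "s = sqrt (\<Sum>i<2 ^ n. (\<sigma> i)\<^sup>2)"
  have "distributed M lborel (\<lambda>\<omega>. \<Sum>i<2 ^ n. X i \<omega>) (normal_density (\<Sum>i<(2::nat) ^ n. 0) s)"
    unfolding s_def by (rule sum_indep_normal[OF _ _ ind]) (use \<sigma> dX in \<open>auto simp: lessThan_empty_iff\<close>)
  then have d: "distributed M lborel (\<lambda>\<omega>. \<Sum>i<2 ^ n. X i \<omega>) (normal_density 0 s)" by simp
  have eq: "(\<Sum>i<2 ^ n. X i \<omega>) = area_sum T n (\<lambda>s. B s \<omega>) (tent T) / sqrt T" for \<omega>
    unfolding area_sum_tent[OF less_imp_le[OF T]] X_def c_def \<tau>_def sum_divide_distrib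
    by (intro sum.cong) auto
  have "T / 8 \<le> s"
  proof -
    have "(T / 8)\<^sup>2 = (\<Sum>i\<in>{2 ^ k..<2 ^ (n - 1) :: nat}. (T / 4)\<^sup>2 / 2 ^ n)"
      by (simp add: k power_add power2_eq_square of_nat_diff field_simps)
    also have "\<dots> \<le> (\<Sum>i\<in>{2 ^ k..<2 ^ (n - 1)}. (c i)\<^sup>2 / 2 ^ n)"
      using cbig T by (intro sum_mono divide_right_mono power_mono) auto
    also have "\<dots> \<le> (\<Sum>i<2 ^ n. (c i)\<^sup>2 / 2 ^ n)"
    proof (rule sum_mono2)
      have "(2::nat) ^ (n - 1) \<le> 2 ^ n" by (rule power_increasing) auto
      then show "{2 ^ k..<2 ^ (n - 1)} \<subseteq> {..<(2::nat) ^ n}"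
        by (meson atLeastLessThan_iff lessThan_iff less_le_trans subsetI)
    qed auto
    also have "\<dots> = (\<Sum>i<2 ^ n. (\<sigma> i)\<^sup>2)"
      using T by (intro sum.cong) (simp_all add: \<sigma>_def power_mult_distrib power_divide)
    finally show ?thesis unfolding s_def by (rule real_le_rsqrt)
  qed
  with d show thesis using that[of s] unfolding eq by blast
qed

lemma pred_convergent_real:
  fixes f :: "nat \<Rightarrow> 'a \<Rightarrow> real"
  assumes [measurable]: "\<And>i. f i \<in> borel_measurable M"
  shows "Measurable.pred M (\<lambda>x. convergent (\<lambda>i. f i x))"
  unfolding Cauchy_convergent_iff[symmetric] pred_def by (rule sets_Collect_Cauchy) measurable

text \<open>\<open>V\<close> consists of the first path and the second path without its tent
  component; it is independent of \<open>g\<close> and still determines the planar endpoint, the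
  tent being 0 at T. For the dyadic sums the splitting into \<open>RR\<close> and \<open>LL\<close>
  times \<open>g\<close> is exact, and \<open>R\<close> and \<open>L\<close> are the limits of these
  functions of \<open>V\<close>.\<close>

theorem levy_area_decomposition:
  fixes M :: "'w measure"
  assumes ind: "independent_brownian_motions M B1 B2" and T: "T > 0"
  obtains R L g where "distributed M lborel g std_normal_density"
    "prob_space.indep_rv M borel (\<lambda>\<omega>. (B1 T \<omega>, B2 T \<omega>, R \<omega>, L \<omega>)) borel g"
    "AE \<omega> in M. levy_area M B1 B2 T \<omega> = R \<omega> + L \<omega> * g \<omega>"
    "(\<integral>\<^sup>+ \<omega>. singular_weight T (L \<omega>) \<partial>M) \<le> 25"
proof -
  have bm: "standard_brownian_motion M B1" "standard_brownian_motion M B2"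
    using ind by (auto simp: independent_brownian_motions_def)
  then interpret prob_space M by (simp add: standard_brownian_motion_def)
  have Bm[measurable]: "B1 u \<in> borel_measurable M" "B2 u \<in> borel_measurable M" if "u \<ge> 0" for u
    using bm that by (auto simp: standard_brownian_motion_def)
  define G where "G = (\<lambda>\<omega>. 2 * B2 (T/2) \<omega> - B2 0 \<omega> - B2 T \<omega>)"
  define g where "g \<omega> = G \<omega> / sqrt T" for \<omega>
  define W where "W s \<omega> = B2 s \<omega> - B2 0 \<omega> - tent T s / T * G \<omega>" for s \<omega>
  define V where "V \<omega> = (\<lambda>s\<in>{0..T}. B1 s \<omega>, \<lambda>s\<in>{0..T}. W s \<omega>)" for \<omega>
  define S where "S = (PiM {0..T} (\<lambda>_. borel :: real measure) \<Otimes>\<^sub>M PiM {0..T} (\<lambda>_. borel :: real measure))"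
  define RR where "RR n v = area_sum T n (fst v) (snd v)" for n and v :: "(real \<Rightarrow> real) \<times> (real \<Rightarrow> real)"
  define LL where "LL n v = area_sum T n (fst v) (tent T) / sqrt T" for n and v :: "(real \<Rightarrow> real) \<times> (real \<Rightarrow> real)"
  have VG: "indep_rv S V borel G"
    unfolding S_def V_def W_def G_def by (rule brownian_pair_tent_indep[OF ind T])
  have "indep_rv S V borel (\<lambda>\<omega>. G \<omega> / sqrt T)"
    by (rule indep_rv_compose[OF VG, of "\<lambda>v. v" S "\<lambda>x. x / sqrt T" borel]) auto
  then have Vg: "indep_rv S V borel g" by (simp add: g_def[abs_def])
  note Vm[measurable] = indep_rvD(1)[OF Vg] and gm[measurable] = indep_rvD(2)[OF Vg]
  have dg: "distributed M lborel g std_normal_density"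
    using brownian_tent_indep(1)[OF bm(2) T] normal_standard_normal_convert[of "sqrt T" G 0] T
    by (simp add: G_def g_def[abs_def])
  note grid = dyadic_time_in_range[OF less_imp_le[OF T]]
  have coord: "(\<lambda>v. fst v s) \<in> borel_measurable S" "(\<lambda>v. snd v s) \<in> borel_measurable S" if "s \<in> {0..T}" for s
    unfolding S_def using that
    by (auto intro!: measurable_compose[OF measurable_fst] measurable_compose[OF measurable_snd] measurable_component_singleton)
  have [measurable]: "RR n \<in> borel_measurable S" "LL n \<in> borel_measurable S" for n
    unfolding RR_def[abs_def] LL_def[abs_def] area_sum_def
    by (auto intro!: borel_measurable_divide borel_measurable_sum borel_measurable_diff borel_measurable_times
      coord grid simp del: of_nat_Suc)
  have zero: "AE \<omega> in M. B2 0 \<omega> = 0" using bm by (simp add: standard_brownian_motion_def)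
  have decomp: "AE \<omega> in M. \<forall>n. area_sum T n (\<lambda>s. B1 s \<omega>) (\<lambda>s. B2 s \<omega>) = RR n (V \<omega>) + LL n (V \<omega>) * g \<omega>"
    using zero
  proof eventually_elim
    case (elim \<omega>)
    show ?case
    proof
      fix n
      \<comment> \<open>The second path is its residual plus g / sqrt T times the tent, and the area
        is linear in it.\<close>
      have "area_sum T n (\<lambda>s. B1 s \<omega>) (\<lambda>s. B2 s \<omega>) =
        area_sum T n (fst (V \<omega>)) (\<lambda>s. snd (V \<omega>) s + g \<omega> / sqrt T * tent T s)"
      proof (rule area_sum_cong)
        fix s assume "s \<in> {0..T}"
        moreover have "g \<omega> / sqrt T = G \<omega> / T" using T by (simp add: g_def)
        ultimately show "B2 s \<omega> = snd (V \<omega>) s + g \<omega> / sqrt T * tent T s"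
          using elim by (simp add: V_def W_def)
      qed (use T in \<open>auto simp: V_def\<close>)
      from trans[OF this area_sum_linear]
      show "area_sum T n (\<lambda>s. B1 s \<omega>) (\<lambda>s. B2 s \<omega>) = RR n (V \<omega>) + LL n (V \<omega>) * g \<omega>"
        by (simp add: RR_def LL_def)
    qed
  qed
  have area: "AE \<omega> in M. (\<lambda>n. RR n (V \<omega>) + LL n (V \<omega>) * g \<omega>) \<longlonglongrightarrow> levy_area M B1 B2 T \<omega>"
    using decomp area_sum_tendsto_levy_area(2)[OF ind less_imp_le[OF T]] by eventually_elim simp
  \<comment> \<open>Since \<open>g\<close> is independent of \<open>V\<close>, for almost every value of \<open>V\<close> convergence holds at two distinct
    values of \<open>g\<close>, so both coefficients converge.\<close>
  have conv: "AE \<omega> in M. convergent (\<lambda>n. RR n (V \<omega>)) \<and> convergent (\<lambda>n. LL n (V \<omega>))"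
  proof -
    let ?\<rho> = "distr M S V" and ?\<nu> = "distr M borel g"
    interpret \<rho>: prob_space ?\<rho> by (rule prob_space_distr) measurable
    interpret \<nu>: prob_space ?\<nu> by (rule prob_space_distr) measurable
    interpret P: pair_sigma_finite ?\<rho> ?\<nu> ..
    have "AE p in distr M (S \<Otimes>\<^sub>M borel) (\<lambda>\<omega>. (V \<omega>, g \<omega>)). convergent (\<lambda>n. RR n (fst p) + LL n (fst p) * snd p)"
    proof (subst AE_distr_iff)
      show "AE \<omega> in M. convergent (\<lambda>n. RR n (fst (V \<omega>, g \<omega>)) + LL n (fst (V \<omega>, g \<omega>)) * snd (V \<omega>, g \<omega>))"
        using area by eventually_elim (auto simp: convergent_def)
      have "Measurable.pred (S \<Otimes>\<^sub>M borel) (\<lambda>p. convergent (\<lambda>n. RR n (fst p) + LL n (fst p) * snd p))"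
        by (rule pred_convergent_real) measurable
      then show "{p \<in> space (S \<Otimes>\<^sub>M borel). convergent (\<lambda>n. RR n (fst p) + LL n (fst p) * snd p)} \<in> sets (S \<Otimes>\<^sub>M borel)"
        by measurable
    qed measurable
    then have "AE p in ?\<rho> \<Otimes>\<^sub>M ?\<nu>. convergent (\<lambda>n. RR n (fst p) + LL n (fst p) * snd p)"
      unfolding indep_rv_distr[OF Vg] .
    then have "AE v in ?\<rho>. AE y in ?\<nu>. convergent (\<lambda>n. RR n v + LL n v * y)"
      by (drule_tac P.AE_pair) simp
    then have "AE v in ?\<rho>. convergent (\<lambda>n. RR n v) \<and> convergent (\<lambda>n. LL n v)"
    proof eventually_elim
      case (elim v)
      have "\<exists>y. convergent (\<lambda>n. RR n v + LL n v * y)"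
        using eventually_happens'[OF \<nu>.ae_filter_bot elim] .
      then obtain y1 where y1: "convergent (\<lambda>n. RR n v + LL n v * y1)" by blast
      have "AE y in ?\<nu>. y \<noteq> y1"
      proof -
        have "distr M borel g = density lborel std_normal_density"
          using distributed_distr_eq_density[OF dg] by (simp cong: distr_cong)
        moreover have "AE y in lborel. y \<noteq> y1" by (rule AE_lborel_singleton)
        ultimately show ?thesis by (simp only:) (subst AE_density, auto elim: eventually_mono)
      qed
      with elim have "AE y in ?\<nu>. convergent (\<lambda>n. RR n v + LL n v * y) \<and> y \<noteq> y1" by eventually_elim simp
      then have "\<exists>y. convergent (\<lambda>n. RR n v + LL n v * y) \<and> y \<noteq> y1"
        using eventually_happens'[OF \<nu>.ae_filter_bot] by blast
      then obtain y2 where y2: "convergent (\<lambda>n. RR n v + LL n v * y2)" "y2 \<noteq> y1" by blast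
      have "convergent (\<lambda>n. (1 / (y2 - y1)) * ((RR n v + LL n v * y2) - (RR n v + LL n v * y1)))"
        by (intro convergent_mult convergent_const convergent_diff y1 y2)
      also have "(\<lambda>n. (1 / (y2 - y1)) * ((RR n v + LL n v * y2) - (RR n v + LL n v * y1))) = (\<lambda>n. LL n v)"
        using y2(2) by (simp add: fun_eq_iff field_simps)
      finally have L: "convergent (\<lambda>n. LL n v)" .
      have "convergent (\<lambda>n. (RR n v + LL n v * y1) - LL n v * y1)"
        by (intro convergent_diff convergent_mult convergent_const y1 L)
      then show ?case using L by simp
    qed
    then show ?thesis
    proof (subst (asm) AE_distr_iff)
      have "Measurable.pred S (\<lambda>v. convergent (\<lambda>n. RR n v))" "Measurable.pred S (\<lambda>v. convergent (\<lambda>n. LL n v))"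
        by (rule pred_convergent_real, measurable)+
      then show "{v \<in> space S. convergent (\<lambda>n. RR n v) \<and> convergent (\<lambda>n. LL n v)} \<in> sets S"
        by measurable
    qed auto
  qed
  \<comment> \<open>Total measurable functions of \<open>V\<close>; on the null event without
    convergence the value of \<open>lim\<close> is irrelevant.\<close>
  define Rl where "Rl v = lim (\<lambda>n. RR n v)" for v
  define Ll where "Ll v = lim (\<lambda>n. LL n v)" for v
  have [measurable]: "Rl \<in> borel_measurable S" "Ll \<in> borel_measurable S"
    unfolding Rl_def[abs_def] Ll_def[abs_def] by measurable
  have TT: "T \<in> {0..T}" using T by simp
  note coordT[measurable] = coord[OF TT]
  have "indep_rv borel (\<lambda>\<omega>. (fst (V \<omega>) T, snd (V \<omega>) T, Rl (V \<omega>), Ll (V \<omega>))) borel g"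
    by (rule indep_rv_compose[OF Vg, of "\<lambda>v. (fst v T, snd v T, Rl v, Ll v)" borel "\<lambda>x. x" borel])
       (auto intro!: borel_measurable_Pair)
  then have "indep_rv borel (\<lambda>\<omega>. (B1 T \<omega>, B2 T \<omega>, Rl (V \<omega>), Ll (V \<omega>))) borel g"
  proof (rule indep_rv_cong_AE)
    show "(\<lambda>\<omega>. (B1 T \<omega>, B2 T \<omega>, Rl (V \<omega>), Ll (V \<omega>))) \<in> borel_measurable M"
      using T by (intro borel_measurable_Pair) auto
    show "AE \<omega> in M. (fst (V \<omega>) T, snd (V \<omega>) T, Rl (V \<omega>), Ll (V \<omega>)) = (B1 T \<omega>, B2 T \<omega>, Rl (V \<omega>), Ll (V \<omega>))"
      using zero by eventually_elim (use T in \<open>simp add: V_def W_def\<close>)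
  qed
  moreover have "AE \<omega> in M. levy_area M B1 B2 T \<omega> = Rl (V \<omega>) + Ll (V \<omega>) * g \<omega>"
    using conv area
  proof eventually_elim
    case (elim \<omega>)
    then have "(\<lambda>n. RR n (V \<omega>) + LL n (V \<omega>) * g \<omega>) \<longlonglongrightarrow> Rl (V \<omega>) + Ll (V \<omega>) * g \<omega>"
      unfolding Rl_def Ll_def by (intro tendsto_intros) (auto simp: convergent_LIMSEQ_iff)
    with elim show ?case by (auto intro: LIMSEQ_unique)
  qed
  moreover have "(\<integral>\<^sup>+ \<omega>. singular_weight T (Ll (V \<omega>)) \<partial>M) \<le> 25"
  proof -
    have "(\<integral>\<^sup>+ \<omega>. singular_weight T (Ll (V \<omega>)) \<partial>M) = (\<integral>\<^sup>+ \<omega>. liminf (\<lambda>n. singular_weight T (LL n (V \<omega>))) \<partial>M)"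
    proof (rule nn_integral_cong_AE)
      \<comment> \<open>Continuity of the weight up to its infinite value at 0 allows Fatou's lemma,
        so the uniform Gaussian bound passes to \<open>L\<close> without determining the law of
        \<open>L\<close> itself.\<close>
      show "AE \<omega> in M. singular_weight T (Ll (V \<omega>)) = liminf (\<lambda>n. singular_weight T (LL n (V \<omega>)))"
        using conv
      proof eventually_elim
        case (elim \<omega>)
        then have "(\<lambda>n. LL n (V \<omega>)) \<longlonglongrightarrow> Ll (V \<omega>)" by (simp add: convergent_LIMSEQ_iff Ll_def)
        from singular_weight_tendsto[OF this T] show ?case by (intro lim_imp_Liminf[symmetric]) auto
      qed
    qed
    also have "\<dots> \<le> liminf (\<lambda>n. \<integral>\<^sup>+ \<omega>. singular_weight T (LL n (V \<omega>)) \<partial>M)"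
      by (rule nn_integral_liminf) measurable
    also have "\<dots> \<le> 25"
    proof (rule Liminf_le)
      show "\<forall>\<^sub>F n in sequentially. (\<integral>\<^sup>+ \<omega>. singular_weight T (LL n (V \<omega>)) \<partial>M) \<le> 25"
        unfolding eventually_sequentially
      proof (intro exI[of _ 2] allI impI)
        fix n :: nat assume "2 \<le> n"
        then obtain s where s: "T / 8 \<le> s"
          "distributed M lborel (\<lambda>\<omega>. area_sum T n (\<lambda>s. B1 s \<omega>) (tent T) / sqrt T) (normal_density 0 s)"
          by (rule area_sum_tent_normal[OF bm(1) T]) blast
        have "LL n (V \<omega>) = area_sum T n (\<lambda>s. B1 s \<omega>) (tent T) / sqrt T" for \<omega>
          unfolding LL_def by (intro arg_cong[where f="\<lambda>x. x / sqrt T"] area_sum_cong) (use T in \<open>auto simp: V_def\<close>)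
        then have "(\<integral>\<^sup>+ \<omega>. singular_weight T (LL n (V \<omega>)) \<partial>M)
          = (\<integral>\<^sup>+ x. ennreal (normal_density 0 s x) * singular_weight T x \<partial>lborel)"
          using distributed_nn_integral[OF s(2), of "singular_weight T"] by simp
        also have "\<dots> \<le> 25" by (rule nn_integral_singular_weight_normal[OF T s(1)])
        finally show "(\<integral>\<^sup>+ \<omega>. singular_weight T (LL n (V \<omega>)) \<partial>M) \<le> 25" .
      qed
    qed simp
    finally show ?thesis .
  qed
  ultimately show thesis by (rule that[OF dg])
qed

section \<open>Reflection coupling\<close>

definition unit_uniform :: "real measure" where
  "unit_uniform = density lborel (indicator {0..1})"

lemma sets_unit_uniform[measurable_cong, simp]: "sets unit_uniform = sets borel"
  by (simp add: unit_uniform_def)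

lemma prob_space_unit_uniform: "prob_space unit_uniform"
  by (rule prob_spaceI) (simp add: unit_uniform_def emeasure_density)

lemma nn_integral_unit_uniform_threshold:
  assumes q: "0 \<le> q"
  shows "(\<integral>\<^sup>+ u. (if u \<le> q then A else B) \<partial>unit_uniform) = ennreal (min 1 q) * A + ennreal (1 - min 1 q) * B"
proof -
  have "(\<integral>\<^sup>+ u. (if u \<le> q then A else B) \<partial>unit_uniform) = (\<integral>\<^sup>+ u. indicator {0..1} u * (if u \<le> q then A else B) \<partial>lborel)"
    unfolding unit_uniform_def by (subst nn_integral_density) auto
  also have "\<dots> = (\<integral>\<^sup>+ u. A * indicator {0..min 1 q} u + B * indicator {min 1 q<..1} u \<partial>lborel)"
    using q by (intro nn_integral_cong) (auto simp: indicator_def)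
  also have "\<dots> = A * emeasure lborel {0..min 1 q} + B * emeasure lborel {min 1 q<..1}"
    by (subst nn_integral_add) (auto simp: nn_integral_cmult_indicator)
  finally show ?thesis using q by (simp add: mult.commute)
qed

text \<open>Reflection coupling of \<open>N(0,1)\<close> with itself, of density \<open>\<phi>\<close>: the second variable is \<open>x + k\<close> with
  the largest possible probability; the excess mass \<open>\<phi> x - min (\<phi> x) (\<phi> (x + k))\<close>, sent to \<open>-x\<close>, fills
  exactly the deficit there because \<open>\<phi>\<close> is even.\<close>

definition reflect_step :: "real \<Rightarrow> real \<Rightarrow> real \<Rightarrow> real" where
  "reflect_step k x u = (if u \<le> std_normal_density (x + k) / std_normal_density x then x + k else - x)"

lemma reflect_step_measurable[measurable (raw)]:
  assumes [measurable]: "f \<in> borel_measurable M" "g \<in> borel_measurable M" "h \<in> borel_measurable M"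
  shows "(\<lambda>x. reflect_step (f x) (g x) (h x)) \<in> borel_measurable M"
  unfolding reflect_step_def by measurable

lemma std_normal_density_even: "std_normal_density (- x) = std_normal_density x"
  by (simp add: std_normal_density_def)

lemma nn_integral_reflect_step:
  "(\<integral>\<^sup>+ u. f (reflect_step k x u) \<partial>unit_uniform) =
    ennreal (min 1 (std_normal_density (x + k) / std_normal_density x)) * f (x + k)
    + ennreal (1 - min 1 (std_normal_density (x + k) / std_normal_density x)) * f (- x)"
proof -
  have "(\<integral>\<^sup>+ u. f (reflect_step k x u) \<partial>unit_uniform) =
    (\<integral>\<^sup>+ u. (if u \<le> std_normal_density (x + k) / std_normal_density x then f (x + k) else f (- x)) \<partial>unit_uniform)"
    unfolding reflect_step_def by (intro nn_integral_cong) auto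
  also have "\<dots> = ennreal (min 1 (std_normal_density (x + k) / std_normal_density x)) * f (x + k)
    + ennreal (1 - min 1 (std_normal_density (x + k) / std_normal_density x)) * f (- x)"
    by (rule nn_integral_unit_uniform_threshold) simp
  finally show ?thesis .
qed

text \<open>With m the pointwise minimum of the density and its shift, y receives the mass m (y - k)
  from the shift and the excess density minus m (- y) from the reflection. Evenness of the density
  gives m (- y) = m (y - k), so the two add up to the density at y.\<close>

lemma reflect_step_preserves_normal:
  fixes f :: "real \<Rightarrow> ennreal"
  assumes [measurable]: "f \<in> borel_measurable borel"
  shows "(\<integral>\<^sup>+ x. ennreal (std_normal_density x) * (\<integral>\<^sup>+ u. f (reflect_step k x u) \<partial>unit_uniform) \<partial>lborel)
    = (\<integral>\<^sup>+ x. ennreal (std_normal_density x) * f x \<partial>lborel)"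
proof -
  let ?d = std_normal_density
  define m where "m x = min (?d x) (?d (x + k))" for x
  have d0: "0 < ?d x" for x by (rule normal_density_pos) simp
  have [measurable]: "m \<in> borel_measurable borel" unfolding m_def[abs_def] by measurable
  have m: "0 \<le> m x" "m x \<le> ?d x" for x unfolding m_def by auto
  have 1: "?d x * min 1 (?d (x + k) / ?d x) = m x" for x
    using d0[of x] by (auto simp: m_def min_def field_simps)
  have "(\<integral>\<^sup>+ x. ennreal (?d x) * (\<integral>\<^sup>+ u. f (reflect_step k x u) \<partial>unit_uniform) \<partial>lborel)
    = (\<integral>\<^sup>+ x. ennreal (m x) * f (x + k) + ennreal (?d x - m x) * f (- x) \<partial>lborel)"
  proof (rule nn_integral_cong)
    fix x
    have "?d x * (1 - min 1 (?d (x + k) / ?d x)) = ?d x - m x" by (simp add: right_diff_distrib 1)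
    moreover have "0 \<le> min 1 (?d (x + k) / ?d x)" "0 \<le> 1 - min 1 (?d (x + k) / ?d x)" by auto
    ultimately show "ennreal (?d x) * (\<integral>\<^sup>+ u. f (reflect_step k x u) \<partial>unit_uniform)
      = ennreal (m x) * f (x + k) + ennreal (?d x - m x) * f (- x)"
      unfolding nn_integral_reflect_step distrib_left mult.assoc[symmetric]
      by (simp only: ennreal_mult[symmetric] less_imp_le[OF d0] 1)
  qed
  also have "\<dots> = (\<integral>\<^sup>+ x. ennreal (m x) * f (x + k) \<partial>lborel) + (\<integral>\<^sup>+ x. ennreal (?d x - m x) * f (- x) \<partial>lborel)"
    by (rule nn_integral_add) measurable
  also have "(\<integral>\<^sup>+ x. ennreal (m x) * f (x + k) \<partial>lborel) = (\<integral>\<^sup>+ y. ennreal (m (y - k)) * f y \<partial>lborel)"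
    by (subst nn_integral_real_affine[where c=1 and t="- k"]) auto
  also have "(\<integral>\<^sup>+ x. ennreal (?d x - m x) * f (- x) \<partial>lborel) = (\<integral>\<^sup>+ y. ennreal (?d y - m (- y)) * f y \<partial>lborel)"
    by (subst nn_integral_real_affine[where c="-1" and t=0]) (auto simp: std_normal_density_even)
  also have "(\<integral>\<^sup>+ y. ennreal (m (y - k)) * f y \<partial>lborel) + (\<integral>\<^sup>+ y. ennreal (?d y - m (- y)) * f y \<partial>lborel)
    = (\<integral>\<^sup>+ y. ennreal (m (y - k)) * f y + ennreal (?d y - m (- y)) * f y \<partial>lborel)"
    by (rule nn_integral_add[symmetric]) measurable
  also have "\<dots> = (\<integral>\<^sup>+ y. ennreal (?d y) * f y \<partial>lborel)"
  proof (rule nn_integral_cong)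
    fix y
    have "m (- y) = m (y - k)"
      using std_normal_density_even[of y] std_normal_density_even[of "y - k"] by (simp add: m_def min.commute)
    then show "ennreal (m (y - k)) * f y + ennreal (?d y - m (- y)) * f y = ennreal (?d y) * f y"
      using m(1)[of "y - k"] m(2)[of "- y"]
      by (simp add: distrib_right[symmetric] ennreal_plus[symmetric] std_normal_density_even del: ennreal_plus)
  qed
  finally show ?thesis .
qed

text \<open>With l = sqrt \<bar>L\<bar> one has \<bar>h\<bar> = \<bar>k\<bar> * l^2, so the cost of
  failure is l times (e * sqrt (2 * \<bar>x\<bar>) + e * sqrt \<bar>k\<bar>) for the failure
  probability e. As e is of order \<bar>k\<bar>, this is linear in l * \<bar>k\<bar> = \<bar>h\<bar>
  / sqrt \<bar>L\<bar>. The quadratic factor is a convenient majorant in x with a known Gaussian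
  mean.\<close>

lemma reflect_failure_cost:
  fixes h k L x :: real
  assumes L: "L \<noteq> 0" and k: "L * k = - h"
  shows "(1 - min 1 (std_normal_density (x + k) / std_normal_density x)) * (sqrt (2 * \<bar>L\<bar> * \<bar>x\<bar>) + sqrt \<bar>h\<bar>)
    \<le> \<bar>h\<bar> / sqrt \<bar>L\<bar> * (3 * x\<^sup>2 + 4)"
proof -
  define e where "e = 1 - min 1 (std_normal_density (x + k) / std_normal_density x)"
  define l where "l = sqrt \<bar>L\<bar>"
  have l: "l > 0" "\<bar>L\<bar> = l * l" using L by (auto simp: l_def)
  have hL: "\<bar>h\<bar> = \<bar>k\<bar> * (l * l)" using k l(2) by (metis abs_minus_cancel abs_mult mult.commute)
  have e01: "0 \<le> e" "e \<le> 1" by (auto simp: e_def)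
  have "std_normal_density (x + k) / std_normal_density x = exp (- (x + k)\<^sup>2 / 2 - (- x\<^sup>2 / 2))"
    unfolding std_normal_density_def exp_diff by (rule mult_divide_mult_cancel_left) simp
  also have "- (x + k)\<^sup>2 / 2 - (- x\<^sup>2 / 2) = - (k * x + k\<^sup>2 / 2)"
    by (simp add: power2_eq_square field_simps)
  finally have ratio: "std_normal_density (x + k) / std_normal_density x = exp (- (k * x + k\<^sup>2 / 2))" .
  \<comment> \<open>For small k the exponential is linearized. For large k the trivial bound e \<le>
    1 suffices, together with sqrt \<bar>k\<bar> \<le> \<bar>k\<bar>.\<close>
  have ek: "e \<le> \<bar>k\<bar> * (\<bar>x\<bar> + 1) \<and> e * sqrt \<bar>k\<bar> \<le> \<bar>k\<bar> * (\<bar>x\<bar> + 1)"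
  proof (cases "\<bar>k\<bar> \<le> 1")
    case True
    have "1 + - (k * x + k\<^sup>2 / 2) \<le> exp (- (k * x + k\<^sup>2 / 2))" by (rule exp_ge_add_one_self)
    moreover have "k * x \<le> \<bar>k\<bar> * \<bar>x\<bar>" by (simp add: abs_mult[symmetric])
    moreover have "k\<^sup>2 \<le> \<bar>k\<bar>" using True by (metis abs_ge_zero mult_left_le power2_abs power2_eq_square)
    moreover have "0 \<le> \<bar>k\<bar> * \<bar>x\<bar>" "0 \<le> \<bar>k\<bar>" by simp_all
    moreover have "e = 0 \<or> e = 1 - exp (- (k * x + k\<^sup>2 / 2))" unfolding e_def ratio by (simp only: min_def) simp
    ultimately have 1: "e \<le> \<bar>k\<bar> * (\<bar>x\<bar> + 1)" unfolding distrib_left by linarith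
    have "e * sqrt \<bar>k\<bar> \<le> e * 1" using True e01 by (intro mult_left_mono) auto
    with 1 show ?thesis by simp
  next
    case False
    then have "1 \<le> \<bar>k\<bar> * (\<bar>x\<bar> + 1)" by (simp add: distrib_left add_increasing)
    moreover have "sqrt \<bar>k\<bar> \<le> \<bar>k\<bar>" proof (rule real_le_lsqrt)
      show "\<bar>k\<bar> \<le> \<bar>k\<bar>\<^sup>2" using False mult_left_mono[of 1 "\<bar>k\<bar>" "\<bar>k\<bar>"] by (simp add: power2_eq_square)
    qed auto
    then have "e * sqrt \<bar>k\<bar> \<le> 1 * \<bar>k\<bar>" using e01 by (intro mult_mono) auto
    moreover have "\<bar>k\<bar> \<le> \<bar>k\<bar> * (\<bar>x\<bar> + 1)" by (simp add: distrib_left)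
    ultimately show ?thesis using e01 by simp
  qed
  have s: "sqrt (2 * \<bar>x\<bar>) \<le> \<bar>x\<bar> + 1"
  proof (rule real_le_lsqrt)
    show "2 * \<bar>x\<bar> \<le> (\<bar>x\<bar> + 1)\<^sup>2" by (simp add: power2_eq_square algebra_simps)
  qed auto
  have sq: "sqrt (2 * \<bar>L\<bar> * \<bar>x\<bar>) = l * sqrt (2 * \<bar>x\<bar>)" "sqrt \<bar>h\<bar> = l * sqrt \<bar>k\<bar>"
    using l(1) by (simp_all add: l(2) hL real_sqrt_mult)
  have "e * (sqrt (2 * \<bar>L\<bar> * \<bar>x\<bar>) + sqrt \<bar>h\<bar>) = l * (e * sqrt (2 * \<bar>x\<bar>) + e * sqrt \<bar>k\<bar>)"
    unfolding sq by (simp add: algebra_simps)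
  also have "\<dots> \<le> l * ((\<bar>k\<bar> * (\<bar>x\<bar> + 1)) * (\<bar>x\<bar> + 1) + \<bar>k\<bar> * (\<bar>x\<bar> + 1))"
  proof (rule mult_left_mono)
    have "e * sqrt (2 * \<bar>x\<bar>) \<le> (\<bar>k\<bar> * (\<bar>x\<bar> + 1)) * (\<bar>x\<bar> + 1)"
      using ek s e01 by (intro mult_mono) auto
    with ek show "e * sqrt (2 * \<bar>x\<bar>) + e * sqrt \<bar>k\<bar> \<le> (\<bar>k\<bar> * (\<bar>x\<bar> + 1)) * (\<bar>x\<bar> + 1) + \<bar>k\<bar> * (\<bar>x\<bar> + 1)"
      by linarith
  qed (use l in simp)
  also have "\<dots> = (l * \<bar>k\<bar>) * ((\<bar>x\<bar> + 1) * (\<bar>x\<bar> + 2))" by (simp add: algebra_simps)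
  also have "\<dots> \<le> (l * \<bar>k\<bar>) * (3 * x\<^sup>2 + 4)"
  proof (intro mult_left_mono)
    have "0 \<le> 2 * (\<bar>x\<bar> - 1)\<^sup>2 + \<bar>x\<bar>" by simp
    then show "(\<bar>x\<bar> + 1) * (\<bar>x\<bar> + 2) \<le> 3 * x\<^sup>2 + 4" by (simp add: power2_eq_square algebra_simps)
  qed (use l in auto)
  also have "l * \<bar>k\<bar> = \<bar>h\<bar> / sqrt \<bar>L\<bar>" using l by (simp add: hL l_def[symmetric])
  finally show ?thesis by (simp add: e_def)
qed

lemma nn_integral_std_normal_quadratic:
  assumes "0 \<le> c" "0 \<le> d"
  shows "(\<integral>\<^sup>+ x. ennreal (std_normal_density x) * ennreal (c + d * (3 * x\<^sup>2 + 4)) \<partial>lborel) = ennreal (c + 7 * d)"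
proof -
  have 0: "has_bochner_integral lborel (\<lambda>x. std_normal_density x) 1"
    using std_normal_moment_even[of 0] by simp
  have 2: "has_bochner_integral lborel (\<lambda>x. std_normal_density x * x\<^sup>2) 1"
    using std_normal_moment_even[of 1] by (simp add: fact_numeral)
  have "has_bochner_integral lborel (\<lambda>x. (c + 4 * d) * std_normal_density x + (3 * d) * (std_normal_density x * x\<^sup>2)) ((c + 4 * d) * 1 + (3 * d) * 1)"
    by (intro has_bochner_integral_add has_bochner_integral_mult_right 0 2)
  then have "has_bochner_integral lborel (\<lambda>x. std_normal_density x * (c + d * (3 * x\<^sup>2 + 4))) (c + 7 * d)"
    by (simp add: algebra_simps)
  then have "(\<integral>\<^sup>+ x. ennreal (std_normal_density x * (c + d * (3 * x\<^sup>2 + 4))) \<partial>lborel) = ennreal (c + 7 * d)"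
    using assms unfolding has_bochner_integral_iff by (subst nn_integral_eq_integral) auto
  then show ?thesis using assms by (simp only: ennreal_mult' normal_density_nonneg)
qed

text \<open>After the shift the vertical part is exactly r, since L * k + h = 0. After the
  reflection, subadditivity of the square root splits off sqrt \<bar>r\<bar>, so this term is paid
  with total weight one. The 7 is 3 + 4, the Gaussian mean of the quadratic factor.\<close>

lemma reflect_coupling_cost:
  assumes L: "L \<noteq> 0" and k: "L * k = - h"
  shows "(\<integral>\<^sup>+ x. ennreal (std_normal_density x) *
      (\<integral>\<^sup>+ u. ennreal (sqrt \<bar>r + L * (reflect_step k x u - x) + h\<bar>) \<partial>unit_uniform) \<partial>lborel)
    \<le> ennreal (sqrt \<bar>r\<bar> + 7 * (\<bar>h\<bar> / sqrt \<bar>L\<bar>))"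
proof -
  have "(\<integral>\<^sup>+ u. ennreal (sqrt \<bar>r + L * (reflect_step k x u - x) + h\<bar>) \<partial>unit_uniform)
    \<le> ennreal (sqrt \<bar>r\<bar> + \<bar>h\<bar> / sqrt \<bar>L\<bar> * (3 * x\<^sup>2 + 4))" for x
  proof -
    define m where "m = min 1 (std_normal_density (x + k) / std_normal_density x)"
    have m: "0 \<le> m" "0 \<le> 1 - m" by (auto simp: m_def)
    have "\<bar>r + L * (- x - x) + h\<bar> \<le> \<bar>r\<bar> + (2 * \<bar>L\<bar> * \<bar>x\<bar> + \<bar>h\<bar>)"
    proof -
      have "\<bar>L * (- x - x)\<bar> = 2 * \<bar>L\<bar> * \<bar>x\<bar>" proof -
        have "- x - x = - 2 * x" by simp
        then show ?thesis by (simp only: abs_mult)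
      qed
      then show ?thesis by linarith
    qed
    then have "sqrt \<bar>r + L * (- x - x) + h\<bar> \<le> sqrt (\<bar>r\<bar> + (2 * \<bar>L\<bar> * \<bar>x\<bar> + \<bar>h\<bar>))" by simp
    also have "\<dots> \<le> sqrt \<bar>r\<bar> + sqrt (2 * \<bar>L\<bar> * \<bar>x\<bar> + \<bar>h\<bar>)" by (rule sqrt_add_le_add_sqrt) auto
    also have "sqrt (2 * \<bar>L\<bar> * \<bar>x\<bar> + \<bar>h\<bar>) \<le> sqrt (2 * \<bar>L\<bar> * \<bar>x\<bar>) + sqrt \<bar>h\<bar>" by (rule sqrt_add_le_add_sqrt) auto
    finally have f: "sqrt \<bar>r + L * (- x - x) + h\<bar> \<le> sqrt \<bar>r\<bar> + (sqrt (2 * \<bar>L\<bar> * \<bar>x\<bar>) + sqrt \<bar>h\<bar>)" by simp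
    have "(\<integral>\<^sup>+ u. ennreal (sqrt \<bar>r + L * (reflect_step k x u - x) + h\<bar>) \<partial>unit_uniform)
      = ennreal m * ennreal (sqrt \<bar>r + L * (x + k - x) + h\<bar>) + ennreal (1 - m) * ennreal (sqrt \<bar>r + L * (- x - x) + h\<bar>)"
      unfolding m_def using nn_integral_reflect_step[of "\<lambda>y. ennreal (sqrt \<bar>r + L * (y - x) + h\<bar>)" k x] .
    also have "\<dots> = ennreal (m * sqrt \<bar>r\<bar> + (1 - m) * sqrt \<bar>r + L * (- x - x) + h\<bar>)"
      using m k by (simp add: ennreal_mult)
    also have "\<dots> \<le> ennreal (sqrt \<bar>r\<bar> + \<bar>h\<bar> / sqrt \<bar>L\<bar> * (3 * x\<^sup>2 + 4))"
    proof (rule ennreal_leI)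
      have "(1 - m) * sqrt \<bar>r + L * (- x - x) + h\<bar> \<le> (1 - m) * (sqrt \<bar>r\<bar> + (sqrt (2 * \<bar>L\<bar> * \<bar>x\<bar>) + sqrt \<bar>h\<bar>))"
        using f m(2) by (rule mult_left_mono)
      also have "\<dots> = (1 - m) * sqrt \<bar>r\<bar> + (1 - m) * (sqrt (2 * \<bar>L\<bar> * \<bar>x\<bar>) + sqrt \<bar>h\<bar>)" by (simp add: distrib_left)
      also have "\<dots> \<le> (1 - m) * sqrt \<bar>r\<bar> + \<bar>h\<bar> / sqrt \<bar>L\<bar> * (3 * x\<^sup>2 + 4)"
        using reflect_failure_cost[OF L k, of x] unfolding m_def by (rule add_left_mono)
      finally show "m * sqrt \<bar>r\<bar> + (1 - m) * sqrt \<bar>r + L * (- x - x) + h\<bar> \<le> sqrt \<bar>r\<bar> + \<bar>h\<bar> / sqrt \<bar>L\<bar> * (3 * x\<^sup>2 + 4)"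
        by (simp add: left_diff_distrib)
    qed
    finally show ?thesis .
  qed
  then have "(\<integral>\<^sup>+ x. ennreal (std_normal_density x) *
      (\<integral>\<^sup>+ u. ennreal (sqrt \<bar>r + L * (reflect_step k x u - x) + h\<bar>) \<partial>unit_uniform) \<partial>lborel)
    \<le> (\<integral>\<^sup>+ x. ennreal (std_normal_density x) * ennreal (sqrt \<bar>r\<bar> + \<bar>h\<bar> / sqrt \<bar>L\<bar> * (3 * x\<^sup>2 + 4)) \<partial>lborel)"
    by (intro nn_integral_mono mult_left_mono) auto
  also have "\<dots> = ennreal (sqrt \<bar>r\<bar> + 7 * (\<bar>h\<bar> / sqrt \<bar>L\<bar>))"
    by (rule nn_integral_std_normal_quadratic) auto
  finally show ?thesis .
qed

text \<open>Young's inequality with the exponents 4 and 4/3, in the crude form z \<le> z^4 + 1 and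
  normalized by the scales sqrt T of b and T of L. The exponent 4/3 turns the power -1/2 of L into
  -2/3, which is still integrable at 0.\<close>

lemma young_singular_weight:
  assumes L: "L \<noteq> 0" and T: "T > 0"
  shows "ennreal (\<bar>b\<bar> / sqrt \<bar>L\<bar>) \<le> ennreal (b ^ 4 / T\<^sup>2) + singular_weight T L"
proof -
  define w where "w = (\<bar>L\<bar> / T) powr (1/6)"
  define x where "x = \<bar>b\<bar> / sqrt T"
  have LT: "\<bar>L\<bar> / T > 0" using L T by simp
  have w: "w > 0" using LT unfolding w_def powr_gt_zero by linarith
  have w3: "w ^ 3 = sqrt (\<bar>L\<bar> / T)" "w ^ 4 = (\<bar>L\<bar> / T) powr (2/3)"
    using LT by (simp_all only: w_def powr_half_sqrt[symmetric] less_imp_le powr_power) simp_all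
  have "\<bar>b\<bar> / sqrt \<bar>L\<bar> = x / w ^ 3"
    using T L unfolding w3 x_def by (simp add: real_sqrt_divide)
  also have "\<dots> \<le> x ^ 4 + 1 / w ^ 4"
  proof -
    define z where "z = x * w"
    have "z \<le> z ^ 4 + 1"
    proof (cases "z \<le> 1")
      case False
      then have "z ^ 1 \<le> z ^ 4" by (intro power_increasing) auto
      then show ?thesis by simp
    qed (simp add: add_increasing)
    then have "z / w ^ 4 \<le> (z ^ 4 + 1) / w ^ 4" using w by (intro divide_right_mono) auto
    moreover have "z / w ^ 4 = x / w ^ 3" using w by (simp add: z_def field_simps power4_eq_xxxx power3_eq_cube)
    moreover have "(z ^ 4 + 1) / w ^ 4 = x ^ 4 + 1 / w ^ 4" using w by (simp add: z_def power_mult_distrib add_divide_distrib)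
    ultimately show ?thesis by simp
  qed
  also have "x ^ 4 = b ^ 4 / T\<^sup>2"
  proof -
    have "sqrt T ^ 4 = (sqrt T ^ 2) ^ 2" by (simp only: power_mult[symmetric]) simp
    then show ?thesis using T by (simp add: x_def power_divide)
  qed
  also have "1 / w ^ 4 = (\<bar>L\<bar> / T) powr (-2/3)" unfolding w3 using LT by (simp add: powr_minus field_simps)
  finally have "ennreal (\<bar>b\<bar> / sqrt \<bar>L\<bar>) \<le> ennreal (b ^ 4 / T\<^sup>2 + (\<bar>L\<bar> / T) powr (-2/3))" by (rule ennreal_leI)
  then show ?thesis using singular_weight_nonzero[OF L T] by (simp add: ennreal_plus)
qed


section \<open>From coupled Gaussians to coupled laws on the Heisenberg group\<close>

lemma heis_mult_eq:
  "heis_mult a b = (fst a + fst b, fst (snd a) + fst (snd b),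
    snd (snd a) + snd (snd b) + (fst a * fst (snd b) - fst (snd a) * fst b) / 2)"
  by (cases a; cases b) simp

lemma heis_mult_measurable[measurable (raw)]:
  assumes "f \<in> borel_measurable M"
  shows "(\<lambda>x. heis_mult a (f x)) \<in> borel_measurable M"
proof (rule measurable_compose[OF assms])
  show "heis_mult a \<in> borel_measurable borel"
    unfolding heis_mult_eq[abs_def] by (intro borel_measurable_continuous_onI continuous_intros) auto
qed

lemma cc_gauge_eq:
  "cc_gauge p q = \<bar>fst q - fst p\<bar> + \<bar>fst (snd q) - fst (snd p)\<bar>
    + sqrt \<bar>snd (snd q) - snd (snd p) - (fst p * fst (snd q) - fst (snd p) * fst q) / 2\<bar>"
  by (cases p; cases q) simp

lemma cc_gauge_measurable[measurable (raw)]: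
  assumes "f \<in> borel_measurable M" "g \<in> borel_measurable M"
  shows "(\<lambda>x. cc_gauge (f x) (g x)) \<in> borel_measurable M"
proof -
  have "(\<lambda>w. cc_gauge (fst w) (snd w)) \<in> borel_measurable borel"
    unfolding cc_gauge_eq by (intro borel_measurable_continuous_onI continuous_intros) auto
  from measurable_compose[OF borel_measurable_Pair[OF assms] this] show ?thesis by simp
qed

lemma cc_gauge_heis_mult:
  "cc_gauge (heis_mult (x, y, z) (b1, b2, A)) (heis_mult (x', y', z') (b1, b2, A'))
    = \<bar>x' - x\<bar> + \<bar>y' - y\<bar>
      + sqrt \<bar>(z' - z - (x * y' - y * x') / 2) + (A' - A) + ((x' - x) * b2 - (y' - y) * b1)\<bar>"
proof -
  have "z' + A' + (x' * b2 - y' * b1) / 2 - (z + A + (x * b2 - y * b1) / 2)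
      - ((x + b1) * (y' + b2) - (y + b2) * (x' + b1)) / 2
    = (z' - z - (x * y' - y * x') / 2) + (A' - A) + ((x' - x) * b2 - (y' - y) * b1)"
    by (simp add: field_simps)
  then show ?thesis by (simp only: heis_mult.simps cc_gauge.simps)
qed

text \<open>The constant is \<open>270 * 200 * 3\<close>: the two comparison constants between gauge and distance, and the
  bound \<open>200\<close> for the cost in the gauge.\<close>

lemma coupling_from_gauge_bound:
  fixes f f' :: "'b \<Rightarrow> heis"
  assumes P: "prob_space P" and f[measurable]: "f \<in> borel_measurable P" "f' \<in> borel_measurable P"
    and law: "distr P borel f = \<mu>" "distr P borel f' = \<mu>'"
    and shift: "\<And>\<omega>. fst (f' \<omega>) = fst (f \<omega>) + (x' - x)" "\<And>\<omega>. fst (snd (f' \<omega>)) = fst (snd (f \<omega>)) + (y' - y)"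
    and cost: "(\<integral>\<^sup>+ \<omega>. ennreal (cc_gauge (f \<omega>) (f' \<omega>)) \<partial>P) \<le> ennreal (200 * cc_gauge (x, y, z) (x', y', z'))"
  shows "\<exists>(N :: (heis \<times> heis) measure) X Y Z X' Y' Z'.
        prob_space N \<and>
        X \<in> borel_measurable N \<and> Y \<in> borel_measurable N \<and> Z \<in> borel_measurable N \<and>
        X' \<in> borel_measurable N \<and> Y' \<in> borel_measurable N \<and> Z' \<in> borel_measurable N \<and>
        distr N borel (\<lambda>\<omega>. (X \<omega>, Y \<omega>, Z \<omega>)) = \<mu> \<and>
        distr N borel (\<lambda>\<omega>. (X' \<omega>, Y' \<omega>, Z' \<omega>)) = \<mu>' \<and>
        W1_dist \<mu> \<mu>' \<le> (\<integral>\<^sup>+ \<omega>. ennreal (cc_dist (X \<omega>, Y \<omega>, Z \<omega>) (X' \<omega>, Y' \<omega>, Z' \<omega>)) \<partial>N) \<and>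
        (\<integral>\<^sup>+ \<omega>. ennreal (cc_dist (X \<omega>, Y \<omega>, Z \<omega>) (X' \<omega>, Y' \<omega>, Z' \<omega>)) \<partial>N)
          \<le> ennreal (162000 * cc_dist (x, y, z) (x', y', z')) \<and>
        (AE \<omega> in N. X' \<omega> = X \<omega> + (x' - x)) \<and> (AE \<omega> in N. Y' \<omega> = Y \<omega> + (y' - y))"
proof -
  interpret P: prob_space P by (rule P)
  \<comment> \<open>With the joint law itself as probability space, \<open>N\<close> is a member of
    \<open>couplings\<close>, so the Wasserstein bound is an instance of the infimum.\<close>
  define N where "N = distr P borel (\<lambda>\<omega>. (f \<omega>, f' \<omega>))"
  have pm[measurable]: "(\<lambda>\<omega>. (f \<omega>, f' \<omega>)) \<in> borel_measurable P" by (intro borel_measurable_Pair f)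
  have sN[measurable_cong]: "sets N = sets borel" by (simp add: N_def)
  have N: "prob_space N" unfolding N_def by (rule P.prob_space_distr) measurable
  have fs: "continuous_on UNIV (fst :: heis \<times> heis \<Rightarrow> heis)" "continuous_on UNIV (snd :: heis \<times> heis \<Rightarrow> heis)"
    by (intro continuous_intros)+
  note fsm[measurable] = borel_measurable_continuous_onI[OF fs(1)] borel_measurable_continuous_onI[OF fs(2)]
  have m1: "distr N borel fst = \<mu>" "distr N borel snd = \<mu>'"
    unfolding N_def law[symmetric] by (subst distr_distr, auto simp: comp_def)+
  have cont: "(\<lambda>w :: heis \<times> heis. fst (fst w)) \<in> borel_measurable N" "(\<lambda>w :: heis \<times> heis. fst (snd (fst w))) \<in> borel_measurable N"
    "(\<lambda>w :: heis \<times> heis. snd (snd (fst w))) \<in> borel_measurable N" "(\<lambda>w :: heis \<times> heis. fst (snd w)) \<in> borel_measurable N"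
    "(\<lambda>w :: heis \<times> heis. fst (snd (snd w))) \<in> borel_measurable N" "(\<lambda>w :: heis \<times> heis. snd (snd (snd w))) \<in> borel_measurable N"
    by (simp_all only: measurable_cong_sets[OF sN refl], (intro borel_measurable_continuous_onI
      continuous_on_fst continuous_on_snd continuous_on_id)+)
  have W: "W1_dist \<mu> \<mu>' \<le> (\<integral>\<^sup>+ w. ennreal (cc_dist (fst w) (snd w)) \<partial>N)"
    unfolding W1_dist_def by (rule INF_lower) (simp add: couplings_def N sN m1)
  have "(\<integral>\<^sup>+ w. ennreal (cc_dist (fst w) (snd w)) \<partial>N) \<le> (\<integral>\<^sup>+ w. ennreal (270 * cc_gauge (fst w) (snd w)) \<partial>N)"
    \<comment> \<open>The comparison comes before the change of variables, which requires a Borel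
      integrand; the gauge is continuous.\<close>
    by (intro nn_integral_mono ennreal_leI cc_dist_le_cc_gauge)
  also have "\<dots> = (\<integral>\<^sup>+ \<omega>. ennreal (270 * cc_gauge (f \<omega>) (f' \<omega>)) \<partial>P)"
    unfolding N_def by (subst nn_integral_distr[OF pm]) simp_all
  also have "\<dots> = ennreal 270 * (\<integral>\<^sup>+ \<omega>. ennreal (cc_gauge (f \<omega>) (f' \<omega>)) \<partial>P)"
    by (subst nn_integral_cmult[symmetric]) (auto simp: ennreal_mult cc_gauge_nonneg)
  also have "\<dots> \<le> ennreal 270 * ennreal (200 * cc_gauge (x, y, z) (x', y', z'))"
    by (intro mult_left_mono cost) auto
  also have "\<dots> = ennreal (54000 * cc_gauge (x, y, z) (x', y', z'))"
    by (subst ennreal_mult[symmetric]) (auto simp: cc_gauge_nonneg simp del: cc_gauge.simps)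
  also have "\<dots> \<le> ennreal (162000 * cc_dist (x, y, z) (x', y', z'))"
    using cc_gauge_le_cc_dist[of "(x, y, z)" "(x', y', z')"] by (intro ennreal_leI) simp
  finally have C: "(\<integral>\<^sup>+ w. ennreal (cc_dist (fst w) (snd w)) \<partial>N) \<le> ennreal (162000 * cc_dist (x, y, z) (x', y', z'))" .
  have AE: "AE w in N. fst (snd w) = fst (fst w) + (x' - x)" "AE w in N. fst (snd (snd w)) = fst (snd (fst w)) + (y' - y)"
  proof -
    have "closed {w :: heis \<times> heis. fst (snd w) = fst (fst w) + (x' - x)}"
      "closed {w :: heis \<times> heis. fst (snd (snd w)) = fst (snd (fst w)) + (y' - y)}"
      by (intro closed_Collect_eq continuous_intros)+
    from borel_closed[OF this(1)] borel_closed[OF this(2)]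
    show "AE w in N. fst (snd w) = fst (fst w) + (x' - x)" "AE w in N. fst (snd (snd w)) = fst (snd (fst w)) + (y' - y)"
      unfolding N_def by (simp_all add: AE_distr_iff[OF pm] shift)
  qed
  show ?thesis
    by (rule exI[of _ N], rule exI[of _ "\<lambda>w. fst (fst w)"], rule exI[of _ "\<lambda>w. fst (snd (fst w))"],
        rule exI[of _ "\<lambda>w. snd (snd (fst w))"], rule exI[of _ "\<lambda>w. fst (snd w)"],
        rule exI[of _ "\<lambda>w. fst (snd (snd w))"], rule exI[of _ "\<lambda>w. snd (snd (snd w))"])
       (use N cont m1 W C AE in \<open>simp add: prod.collapse\<close>)
qed

lemma nn_integral_coupling_space:
  assumes "prob_space \<rho>" and "h \<in> borel_measurable (\<rho> \<Otimes>\<^sub>M (density lborel std_normal_density \<Otimes>\<^sub>M unit_uniform))"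
  shows "(\<integral>\<^sup>+ p. h p \<partial>(\<rho> \<Otimes>\<^sub>M (density lborel std_normal_density \<Otimes>\<^sub>M unit_uniform)))
    = (\<integral>\<^sup>+ q. (\<integral>\<^sup>+ x. ennreal (std_normal_density x) * (\<integral>\<^sup>+ u. h (q, x, u) \<partial>unit_uniform) \<partial>lborel) \<partial>\<rho>)"
proof -
  interpret \<rho>: prob_space \<rho> by fact
  interpret U: prob_space unit_uniform by (rule prob_space_unit_uniform)
  interpret n: prob_space "density lborel std_normal_density" by (rule prob_space_normal_density) simp
  interpret nU: pair_prob_space "density lborel std_normal_density" unit_uniform ..
  have "(\<integral>\<^sup>+ p. h p \<partial>(\<rho> \<Otimes>\<^sub>M (density lborel std_normal_density \<Otimes>\<^sub>M unit_uniform)))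
    = (\<integral>\<^sup>+ q. (\<integral>\<^sup>+ w. h (q, w) \<partial>(density lborel std_normal_density \<Otimes>\<^sub>M unit_uniform)) \<partial>\<rho>)"
    by (rule nU.P.nn_integral_fst[OF assms(2), symmetric])
  also have "\<dots> = (\<integral>\<^sup>+ q. (\<integral>\<^sup>+ x. (\<integral>\<^sup>+ u. h (q, x, u) \<partial>unit_uniform) \<partial>density lborel std_normal_density) \<partial>\<rho>)"
    by (intro nn_integral_cong U.nn_integral_fst[symmetric] measurable_compose_Pair1[OF _ assms(2)])
  also have "\<dots> = (\<integral>\<^sup>+ q. (\<integral>\<^sup>+ x. ennreal (std_normal_density x) * (\<integral>\<^sup>+ u. h (q, x, u) \<partial>unit_uniform) \<partial>lborel) \<partial>\<rho>)"
  proof (rule nn_integral_cong)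
    fix q assume q: "q \<in> space \<rho>"
    have "(\<lambda>w. h (q, w)) \<in> borel_measurable (density lborel std_normal_density \<Otimes>\<^sub>M unit_uniform)"
      by (rule measurable_compose_Pair1[OF q assms(2)])
    from U.borel_measurable_nn_integral_fst[OF this]
    have "(\<lambda>x. \<integral>\<^sup>+ u. h (q, x, u) \<partial>unit_uniform) \<in> borel_measurable lborel" by simp
    then show "(\<integral>\<^sup>+ x. (\<integral>\<^sup>+ u. h (q, x, u) \<partial>unit_uniform) \<partial>density lborel std_normal_density)
      = (\<integral>\<^sup>+ x. ennreal (std_normal_density x) * (\<integral>\<^sup>+ u. h (q, x, u) \<partial>unit_uniform) \<partial>lborel)"
      by (intro nn_integral_density) simp_all
  qed
  finally show ?thesis .
qed

lemma heis_law_decomposition: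
  assumes ind: "independent_brownian_motions M B1 B2" and T: "0 \<le> T"
    and [measurable]: "R \<in> borel_measurable M" "L \<in> borel_measurable M" "g \<in> borel_measurable M"
    and area: "AE \<omega> in M. levy_area M B1 B2 T \<omega> = R \<omega> + L \<omega> * g \<omega>"
  shows "heis_law M B1 B2 a T = distr M borel (\<lambda>\<omega>. heis_mult a (B1 T \<omega>, B2 T \<omega>, R \<omega> + L \<omega> * g \<omega>))"
proof -
  have bm: "standard_brownian_motion M B1" "standard_brownian_motion M B2"
    using ind by (auto simp: independent_brownian_motions_def)
  have [measurable]: "B1 T \<in> borel_measurable M" "B2 T \<in> borel_measurable M" "levy_area M B1 B2 T \<in> borel_measurable M"
    using bm T area_sum_tendsto_levy_area(1)[OF ind T] by (auto simp: standard_brownian_motion_def)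
  show ?thesis unfolding heis_law_def
  proof (rule distr_cong_AE)
    show "AE \<omega> in M. heis_brownian_motion M B1 B2 a T \<omega> = heis_mult a (B1 T \<omega>, B2 T \<omega>, R \<omega> + L \<omega> * g \<omega>)"
      using area by eventually_elim (simp add: heis_brownian_motion_def)
    show "heis_brownian_motion M B1 B2 a T \<in> borel_measurable M"
      unfolding heis_brownian_motion_def[abs_def] by (intro heis_mult_measurable borel_measurable_Pair) measurable
    show "(\<lambda>\<omega>. heis_mult a (B1 T \<omega>, B2 T \<omega>, R \<omega> + L \<omega> * g \<omega>)) \<in> borel_measurable M"
      by (intro heis_mult_measurable borel_measurable_Pair) measurable
  qed simp_all
qed

text \<open>The weight is infinite at 0, so its finite mean already forces L to be nonzero almost
  surely. The constant is 28 = 3 + 25: the normalized fourth moment of the endpoint plus the mean of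
  the weight.\<close>

lemma reflect_coupling_moment:
  fixes M :: "'w measure"
  assumes ind: "independent_brownian_motions M B1 B2" and T: "T > 0"
    and [measurable]: "L \<in> borel_measurable M" and sing: "(\<integral>\<^sup>+ \<omega>. singular_weight T (L \<omega>) \<partial>M) \<le> 25"
  shows "AE \<omega> in M. L \<omega> \<noteq> 0"
    and "(\<integral>\<^sup>+ \<omega>. ennreal (\<bar>p * B2 T \<omega> - q * B1 T \<omega>\<bar> / sqrt \<bar>L \<omega>\<bar>) \<partial>M) \<le> ennreal (28 * (\<bar>p\<bar> + \<bar>q\<bar>))"
proof -
  have bm: "standard_brownian_motion M B1" "standard_brownian_motion M B2"
    using ind by (auto simp: independent_brownian_motions_def)
  then interpret prob_space M by (simp add: standard_brownian_motion_def)
  have Bm[measurable]: "B1 T \<in> borel_measurable M" "B2 T \<in> borel_measurable M"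
    using bm T by (auto simp: standard_brownian_motion_def)
  have "AE \<omega> in M. singular_weight T (L \<omega>) \<noteq> \<infinity>"
  proof (rule nn_integral_PInf_AE)
    have "(\<integral>\<^sup>+ \<omega>. singular_weight T (L \<omega>) \<partial>M) < \<infinity>" using sing by (rule order.strict_trans1) simp
    then show "(\<integral>\<^sup>+ \<omega>. singular_weight T (L \<omega>) \<partial>M) \<noteq> \<infinity>" by simp
  qed measurable
  then show L0: "AE \<omega> in M. L \<omega> \<noteq> 0"
    by eventually_elim (auto simp: singular_weight_def)
  have one: "(\<integral>\<^sup>+ \<omega>. ennreal (\<bar>B T \<omega>\<bar> / sqrt \<bar>L \<omega>\<bar>) \<partial>M) \<le> 28" if B: "standard_brownian_motion M B" for B
  proof -
    have [measurable]: "B T \<in> borel_measurable M" using B T by (auto simp: standard_brownian_motion_def)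
    \<comment> \<open>The fourth moment is available for increments only, so the endpoint is
      replaced by the increment from time 0.\<close>
    have zero: "AE \<omega> in M. B 0 \<omega> = 0" using B by (simp add: standard_brownian_motion_def)
    have "(\<integral>\<^sup>+ \<omega>. ennreal (\<bar>B T \<omega>\<bar> / sqrt \<bar>L \<omega>\<bar>) \<partial>M)
      \<le> (\<integral>\<^sup>+ \<omega>. ennreal ((B T \<omega> - B 0 \<omega>) ^ 4 / T\<^sup>2) + singular_weight T (L \<omega>) \<partial>M)"
    proof (rule nn_integral_mono_AE)
      show "AE \<omega> in M. ennreal (\<bar>B T \<omega>\<bar> / sqrt \<bar>L \<omega>\<bar>) \<le> ennreal ((B T \<omega> - B 0 \<omega>) ^ 4 / T\<^sup>2) + singular_weight T (L \<omega>)"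
        using L0 zero by eventually_elim (simp add: young_singular_weight[OF _ T])
    qed
    also have "\<dots> = (\<integral>\<^sup>+ \<omega>. ennreal ((B T \<omega> - B 0 \<omega>) ^ 4 / T\<^sup>2) \<partial>M) + (\<integral>\<^sup>+ \<omega>. singular_weight T (L \<omega>) \<partial>M)"
    proof (rule nn_integral_add)
      have "B 0 \<in> borel_measurable M" using B by (auto simp: standard_brownian_motion_def)
      then show "(\<lambda>\<omega>. ennreal ((B T \<omega> - B 0 \<omega>) ^ 4 / T\<^sup>2)) \<in> borel_measurable M" by measurable
    qed measurable
    also have "(\<integral>\<^sup>+ \<omega>. ennreal ((B T \<omega> - B 0 \<omega>) ^ 4 / T\<^sup>2) \<partial>M) = ennreal 3"
      using brownian_increment_moments(1,4)[OF B order_refl less_imp_le[OF T]] T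
      by (subst nn_integral_eq_integral) auto
    also have "ennreal 3 + (\<integral>\<^sup>+ \<omega>. singular_weight T (L \<omega>) \<partial>M) \<le> ennreal 3 + 25" by (rule add_left_mono[OF sing])
    finally show ?thesis by simp
  qed
  have "(\<integral>\<^sup>+ \<omega>. ennreal (\<bar>p * B2 T \<omega> - q * B1 T \<omega>\<bar> / sqrt \<bar>L \<omega>\<bar>) \<partial>M)
    \<le> (\<integral>\<^sup>+ \<omega>. ennreal \<bar>p\<bar> * ennreal (\<bar>B2 T \<omega>\<bar> / sqrt \<bar>L \<omega>\<bar>) + ennreal \<bar>q\<bar> * ennreal (\<bar>B1 T \<omega>\<bar> / sqrt \<bar>L \<omega>\<bar>) \<partial>M)"
  proof (rule nn_integral_mono)
    fix \<omega>
    have "\<bar>p * B2 T \<omega> - q * B1 T \<omega>\<bar> \<le> \<bar>p\<bar> * \<bar>B2 T \<omega>\<bar> + \<bar>q\<bar> * \<bar>B1 T \<omega>\<bar>"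
      using abs_triangle_ineq4[of "p * B2 T \<omega>" "q * B1 T \<omega>"] by (simp add: abs_mult)
    then have "\<bar>p * B2 T \<omega> - q * B1 T \<omega>\<bar> / sqrt \<bar>L \<omega>\<bar> \<le> (\<bar>p\<bar> * \<bar>B2 T \<omega>\<bar> + \<bar>q\<bar> * \<bar>B1 T \<omega>\<bar>) / sqrt \<bar>L \<omega>\<bar>"
      by (intro divide_right_mono) auto
    then have "ennreal (\<bar>p * B2 T \<omega> - q * B1 T \<omega>\<bar> / sqrt \<bar>L \<omega>\<bar>)
      \<le> ennreal (\<bar>p\<bar> * (\<bar>B2 T \<omega>\<bar> / sqrt \<bar>L \<omega>\<bar>) + \<bar>q\<bar> * (\<bar>B1 T \<omega>\<bar> / sqrt \<bar>L \<omega>\<bar>))"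
      by (intro ennreal_leI) (simp add: add_divide_distrib)
    also have "\<dots> = ennreal \<bar>p\<bar> * ennreal (\<bar>B2 T \<omega>\<bar> / sqrt \<bar>L \<omega>\<bar>) + ennreal \<bar>q\<bar> * ennreal (\<bar>B1 T \<omega>\<bar> / sqrt \<bar>L \<omega>\<bar>)"
      by (subst ennreal_plus) (simp_all only: ennreal_mult abs_ge_zero mult_nonneg_nonneg divide_nonneg_nonneg real_sqrt_ge_zero)
    finally show "ennreal (\<bar>p * B2 T \<omega> - q * B1 T \<omega>\<bar> / sqrt \<bar>L \<omega>\<bar>)
      \<le> ennreal \<bar>p\<bar> * ennreal (\<bar>B2 T \<omega>\<bar> / sqrt \<bar>L \<omega>\<bar>) + ennreal \<bar>q\<bar> * ennreal (\<bar>B1 T \<omega>\<bar> / sqrt \<bar>L \<omega>\<bar>)" .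
  qed
  also have "\<dots> = ennreal \<bar>p\<bar> * (\<integral>\<^sup>+ \<omega>. ennreal (\<bar>B2 T \<omega>\<bar> / sqrt \<bar>L \<omega>\<bar>) \<partial>M)
    + ennreal \<bar>q\<bar> * (\<integral>\<^sup>+ \<omega>. ennreal (\<bar>B1 T \<omega>\<bar> / sqrt \<bar>L \<omega>\<bar>) \<partial>M)"
    by (simp add: nn_integral_add nn_integral_cmult)
  also have "\<dots> \<le> ennreal \<bar>p\<bar> * 28 + ennreal \<bar>q\<bar> * 28"
    by (intro add_mono mult_left_mono one bm) auto
  also have "\<dots> = ennreal (28 * (\<bar>p\<bar> + \<bar>q\<bar>))"
    by (simp add: distrib_left ennreal_plus ennreal_mult mult.commute)
  finally show "(\<integral>\<^sup>+ \<omega>. ennreal (\<bar>p * B2 T \<omega> - q * B1 T \<omega>\<bar> / sqrt \<bar>L \<omega>\<bar>) \<partial>M) \<le> ennreal (28 * (\<bar>p\<bar> + \<bar>q\<bar>))" .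
qed

text \<open>The coupling space carries the law of the retained data \<open>Q\<close>, an independent
  standard Gaussian and an independent uniform variable that decides between shift and reflection.
  The shift depends on \<open>Q\<close> alone, so for each fixed value of \<open>Q\<close> the
  second Gaussian again has the standard law. The resulting constant is 1 + 7 * 28 = 197, rounded up
  to 200.\<close>

lemma heis_coupling_positive_time:
  fixes M :: "'w measure"
  assumes ind: "independent_brownian_motions M B1 B2" and T: "T > 0"
  obtains P :: "((real \<times> real \<times> real \<times> real) \<times> real \<times> real) measure" and f f' where
    "prob_space P" "f \<in> borel_measurable P" "f' \<in> borel_measurable P"
    "distr P borel f = heis_law M B1 B2 (x, y, z) T" "distr P borel f' = heis_law M B1 B2 (x', y', z') T"
    "\<And>\<omega>. fst (f' \<omega>) = fst (f \<omega>) + (x' - x)" "\<And>\<omega>. fst (snd (f' \<omega>)) = fst (snd (f \<omega>)) + (y' - y)"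
    "(\<integral>\<^sup>+ \<omega>. ennreal (cc_gauge (f \<omega>) (f' \<omega>)) \<partial>P) \<le> ennreal (200 * cc_gauge (x, y, z) (x', y', z'))"
proof -
  have bm: "standard_brownian_motion M B1" "standard_brownian_motion M B2"
    using ind by (auto simp: independent_brownian_motions_def)
  then interpret prob_space M by (simp add: standard_brownian_motion_def)
  obtain R L g where dec: "distributed M lborel g std_normal_density"
    "indep_rv borel (\<lambda>\<omega>. (B1 T \<omega>, B2 T \<omega>, R \<omega>, L \<omega>)) borel g"
    "AE \<omega> in M. levy_area M B1 B2 T \<omega> = R \<omega> + L \<omega> * g \<omega>"
    "(\<integral>\<^sup>+ \<omega>. singular_weight T (L \<omega>) \<partial>M) \<le> 25"
    by (rule levy_area_decomposition[OF ind T])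
  define Q where "Q \<omega> = (B1 T \<omega>, B2 T \<omega>, R \<omega>, L \<omega>)" for \<omega>
  have Qm[measurable]: "Q \<in> borel_measurable M" and gm[measurable]: "g \<in> borel_measurable M"
    using indep_rvD(1,2)[OF dec(2)] by (simp_all add: Q_def[abs_def])
  define b1 :: "real \<times> real \<times> real \<times> real \<Rightarrow> real" where "b1 q = fst q" for q
  define b2 :: "real \<times> real \<times> real \<times> real \<Rightarrow> real" where "b2 q = fst (snd q)" for q
  define r :: "real \<times> real \<times> real \<times> real \<Rightarrow> real" where "r q = fst (snd (snd q))" for q
  define l :: "real \<times> real \<times> real \<times> real \<Rightarrow> real" where "l q = snd (snd (snd q))" for q
  have cm[measurable]: "b1 \<in> borel_measurable borel" "b2 \<in> borel_measurable borel" "r \<in> borel_measurable borel" "l \<in> borel_measurable borel"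
    unfolding b1_def[abs_def] b2_def[abs_def] r_def[abs_def] l_def[abs_def]
    by (intro borel_measurable_continuous_onI continuous_on_fst continuous_on_snd continuous_on_id)+
  have RLm[measurable]: "R \<in> borel_measurable M" "L \<in> borel_measurable M"
    using measurable_compose[OF Qm cm(3)] measurable_compose[OF Qm cm(4)] by (simp_all add: r_def l_def Q_def)
  define \<rho> where "\<rho> = distr M borel Q"
  interpret \<rho>: prob_space \<rho> unfolding \<rho>_def by (rule prob_space_distr) measurable
  have s\<rho>[measurable_cong, simp]: "sets \<rho> = sets borel" by (simp add: \<rho>_def)
  let ?\<nu> = "density lborel std_normal_density"
  interpret n: prob_space ?\<nu> by (rule prob_space_normal_density) simp
  interpret U: prob_space unit_uniform by (rule prob_space_unit_uniform)
  interpret nU: pair_prob_space ?\<nu> unit_uniform ..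
  interpret P: pair_prob_space \<rho> "?\<nu> \<Otimes>\<^sub>M unit_uniform" ..
  define P where "P = \<rho> \<Otimes>\<^sub>M (?\<nu> \<Otimes>\<^sub>M unit_uniform)"
  have dg: "distr M borel g = ?\<nu>"
    using distributed_distr_eq_density[OF dec(1)] by (simp cong: distr_cong)
  have joint: "distr M (borel \<Otimes>\<^sub>M borel) (\<lambda>\<omega>. (Q \<omega>, g \<omega>)) = \<rho> \<Otimes>\<^sub>M ?\<nu>"
    using indep_rv_distr[OF dec(2)] unfolding Q_def[symmetric, abs_def] \<rho>_def dg by simp
  define F where "F a q w = heis_mult a (b1 q, b2 q, r q + l q * w)" for a q and w :: real
  have Fm[measurable (raw)]: "(\<lambda>x. F a (u x) (w x)) \<in> borel_measurable N"
    if [measurable]: "u \<in> borel_measurable N" "w \<in> borel_measurable N" for u w a and N :: "'n measure"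
    unfolding F_def by (intro heis_mult_measurable borel_measurable_Pair) measurable
  define h where "h q = (x' - x) * b2 q - (y' - y) * b1 q" for q
  have hm[measurable]: "h \<in> borel_measurable borel" unfolding h_def[abs_def] by measurable
  \<comment> \<open>Where \<open>l q = 0\<close> the quotient is 0 by convention. The law of the
    second process is correct there too, since every value of \<open>k\<close> preserves the
    Gaussian; for the cost the event is null.\<close>
  define k where "k q = - h q / l q" for q
  have km[measurable]: "k \<in> borel_measurable borel" unfolding k_def[abs_def] by measurable
  define f where "f p = F (x, y, z) (fst p) (fst (snd p))" for p :: "(real \<times> real \<times> real \<times> real) \<times> real \<times> real"
  define f' where "f' p = F (x', y', z') (fst p) (reflect_step (k (fst p)) (fst (snd p)) (snd (snd p)))"
    for p :: "(real \<times> real \<times> real \<times> real) \<times> real \<times> real"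
  have c1[measurable]: "(\<lambda>p. fst p) \<in> borel_measurable P" "(\<lambda>p. fst (snd p)) \<in> borel_measurable P" "(\<lambda>p. snd (snd p)) \<in> borel_measurable P"
    unfolding P_def by measurable
  have fm[measurable]: "f \<in> borel_measurable P"
    unfolding f_def[abs_def] by (rule Fm[OF c1(1,2)])
  have km': "(\<lambda>p. reflect_step (k (fst p)) (fst (snd p)) (snd (snd p))) \<in> borel_measurable P"
    by (rule reflect_step_measurable[OF measurable_compose[OF c1(1) km] c1(2,3)])
  have fm'[measurable]: "f' \<in> borel_measurable P"
    unfolding f'_def[abs_def] by (rule Fm[OF c1(1) km'])
  \<comment> \<open>Writing the laws as iterated integrals over \<open>Q\<close> and the Gaussian
    reduces the identification of the marginals to the inner Gaussian integral for fixed
    \<open>q\<close>.\<close>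
  have law0: "emeasure (heis_law M B1 B2 a T) A =
    (\<integral>\<^sup>+ q. (\<integral>\<^sup>+ w. ennreal (std_normal_density w) * indicator A (F a q w) \<partial>lborel) \<partial>\<rho>)" if A[measurable]: "A \<in> sets borel" for a A
  proof -
    have Fp: "(\<lambda>p. F a (fst p) (snd p)) \<in> borel_measurable (borel \<Otimes>\<^sub>M borel)" by (rule Fm) measurable
    have iF: "(\<lambda>p. indicator A (F a (fst p) (snd p)) :: ennreal) \<in> borel_measurable (borel \<Otimes>\<^sub>M borel)"
      by (rule measurable_compose[OF Fp]) measurable
    have hl: "heis_law M B1 B2 a T = distr M borel (\<lambda>\<omega>. F a (Q \<omega>) (g \<omega>))"
      unfolding heis_law_decomposition[OF ind less_imp_le[OF T] RLm gm dec(3)]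
      by (simp add: F_def Q_def b1_def b2_def r_def l_def)
    have "emeasure (heis_law M B1 B2 a T) A = (\<integral>\<^sup>+ v. indicator A v \<partial>distr M borel (\<lambda>\<omega>. F a (Q \<omega>) (g \<omega>)))"
      unfolding hl by simp
    also have "\<dots> = (\<integral>\<^sup>+ \<omega>. indicator A (F a (Q \<omega>) (g \<omega>)) \<partial>M)"
      by (rule nn_integral_distr[OF Fm[OF Qm gm]]) measurable
    also have "\<dots> = (\<integral>\<^sup>+ p. indicator A (F a (fst p) (snd p)) \<partial>distr M (borel \<Otimes>\<^sub>M borel) (\<lambda>\<omega>. (Q \<omega>, g \<omega>)))"
    proof -
      have "(\<lambda>\<omega>. (Q \<omega>, g \<omega>)) \<in> measurable M (borel \<Otimes>\<^sub>M borel)" by measurable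
      from nn_integral_distr[OF this, of "\<lambda>p. indicator A (F a (fst p) (snd p))"] iF show ?thesis by simp
    qed
    also have "\<dots> = (\<integral>\<^sup>+ p. indicator A (F a (fst p) (snd p)) \<partial>(\<rho> \<Otimes>\<^sub>M ?\<nu>))" unfolding joint ..
    also have "\<dots> = (\<integral>\<^sup>+ q. (\<integral>\<^sup>+ w. indicator A (F a q w) \<partial>?\<nu>) \<partial>\<rho>)"
      by (subst n.nn_integral_fst[symmetric]) (use iF in \<open>simp_all cong: measurable_cong_sets sets_pair_measure_cong\<close>)
    also have "\<dots> = (\<integral>\<^sup>+ q. (\<integral>\<^sup>+ w. ennreal (std_normal_density w) * indicator A (F a q w) \<partial>lborel) \<partial>\<rho>)"
    proof (rule nn_integral_cong)
      fix q
      have "(\<lambda>w. F a q w) \<in> borel_measurable lborel" by (rule Fm) measurable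
      then have "(\<lambda>w. indicator A (F a q w) :: ennreal) \<in> borel_measurable lborel" by (rule measurable_compose) measurable
      then show "(\<integral>\<^sup>+ w. indicator A (F a q w) \<partial>?\<nu>) = (\<integral>\<^sup>+ w. ennreal (std_normal_density w) * indicator A (F a q w) \<partial>lborel)"
        by (intro nn_integral_density) simp_all
    qed
    finally show ?thesis .
  qed
  have lawP: "emeasure (distr P borel G) A =
    (\<integral>\<^sup>+ q. (\<integral>\<^sup>+ w. ennreal (std_normal_density w) * (\<integral>\<^sup>+ u. indicator A (G (q, w, u)) \<partial>unit_uniform) \<partial>lborel) \<partial>\<rho>)"
    if G[measurable]: "G \<in> borel_measurable P" and A[measurable]: "A \<in> sets borel" for G :: "_ \<Rightarrow> heis" and A
  proof -
    have iG: "(\<lambda>p. indicator A (G p) :: ennreal) \<in> borel_measurable P" by measurable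
    have "emeasure (distr P borel G) A = (\<integral>\<^sup>+ v. indicator A v \<partial>distr P borel G)" by simp
    also have "\<dots> = (\<integral>\<^sup>+ p. indicator A (G p) \<partial>P)" by (rule nn_integral_distr) measurable
    also have "\<dots> = (\<integral>\<^sup>+ q. (\<integral>\<^sup>+ w. ennreal (std_normal_density w) * (\<integral>\<^sup>+ u. indicator A (G (q, w, u)) \<partial>unit_uniform) \<partial>lborel) \<partial>\<rho>)"
      unfolding P_def by (rule nn_integral_coupling_space[OF \<rho>.prob_space_axioms iG[unfolded P_def]])
    finally show ?thesis .
  qed
  have law: "distr P borel f = heis_law M B1 B2 (x, y, z) T"
  proof (rule measure_eqI)
    show "sets (distr P borel f) = sets (heis_law M B1 B2 (x, y, z) T)" by (simp add: heis_law_def)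
    fix A assume "A \<in> sets (distr P borel f)"
    then have A: "A \<in> sets borel" by simp
    show "emeasure (distr P borel f) A = emeasure (heis_law M B1 B2 (x, y, z) T) A"
      unfolding lawP[OF fm A] law0[OF A] by (simp add: f_def U.emeasure_space_1)
  qed
  have law': "distr P borel f' = heis_law M B1 B2 (x', y', z') T"
  proof (rule measure_eqI)
    show "sets (distr P borel f') = sets (heis_law M B1 B2 (x', y', z') T)" by (simp add: heis_law_def)
    fix A assume "A \<in> sets (distr P borel f')"
    then have A[measurable]: "A \<in> sets borel" by simp
    show "emeasure (distr P borel f') A = emeasure (heis_law M B1 B2 (x', y', z') T) A"
      unfolding lawP[OF fm' A] law0[OF A]
    proof (rule nn_integral_cong)
      fix q
      have "(\<lambda>w. F (x', y', z') q w) \<in> borel_measurable borel" by (rule Fm) measurable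
      then have "(\<lambda>w. indicator A (F (x', y', z') q w) :: ennreal) \<in> borel_measurable borel" by (rule measurable_compose) measurable
      from reflect_step_preserves_normal[OF this, of "k q"]
      show "(\<integral>\<^sup>+ w. ennreal (std_normal_density w) * (\<integral>\<^sup>+ u. indicator A (f' (q, w, u)) \<partial>unit_uniform) \<partial>lborel)
        = (\<integral>\<^sup>+ w. ennreal (std_normal_density w) * indicator A (F (x', y', z') q w) \<partial>lborel)"
        by (simp add: f'_def)
    qed
  qed
  define r0 where "r0 = z' - z - (x * y' - y * x') / 2"
  define pq where "pq = \<bar>x' - x\<bar> + \<bar>y' - y\<bar>"
  have gauge: "cc_gauge (f (q, w, u)) (f' (q, w, u)) = pq + sqrt \<bar>r0 + l q * (reflect_step (k q) w u - w) + h q\<bar>" for q w u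
    unfolding f_def f'_def F_def fst_conv snd_conv cc_gauge_heis_mult pq_def r0_def h_def
    by (simp add: algebra_simps)
  have inner: "(\<integral>\<^sup>+ w. ennreal (std_normal_density w) * (\<integral>\<^sup>+ u. ennreal (cc_gauge (f (q, w, u)) (f' (q, w, u))) \<partial>unit_uniform) \<partial>lborel)
    \<le> ennreal (pq + sqrt \<bar>r0\<bar> + 7 * (\<bar>h q\<bar> / sqrt \<bar>l q\<bar>))" if lq: "l q \<noteq> 0" for q
  proof -
    let ?c = "\<lambda>w u. sqrt \<bar>r0 + l q * (reflect_step (k q) w u - w) + h q\<bar>"
    have pq0: "0 \<le> pq" by (simp add: pq_def)
    have cmeas: "(\<lambda>u. ennreal (?c w u)) \<in> borel_measurable unit_uniform" for w by measurable
    have cmeas2: "(\<lambda>p. ennreal (?c (fst p) (snd p))) \<in> borel_measurable (lborel \<Otimes>\<^sub>M unit_uniform)" by measurable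
    have "(\<integral>\<^sup>+ u. ennreal (cc_gauge (f (q, w, u)) (f' (q, w, u))) \<partial>unit_uniform) = ennreal pq + (\<integral>\<^sup>+ u. ennreal (?c w u) \<partial>unit_uniform)" for w
      unfolding gauge using pq0 cmeas by (simp add: ennreal_plus nn_integral_add U.emeasure_space_1)
    then have "(\<integral>\<^sup>+ w. ennreal (std_normal_density w) * (\<integral>\<^sup>+ u. ennreal (cc_gauge (f (q, w, u)) (f' (q, w, u))) \<partial>unit_uniform) \<partial>lborel)
      = (\<integral>\<^sup>+ w. ennreal pq * ennreal (std_normal_density w) + ennreal (std_normal_density w) * (\<integral>\<^sup>+ u. ennreal (?c w u) \<partial>unit_uniform) \<partial>lborel)"
      by (simp add: distrib_left mult.commute)
    also have "\<dots> = ennreal pq * (\<integral>\<^sup>+ w. ennreal (std_normal_density w) \<partial>lborel)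
      + (\<integral>\<^sup>+ w. ennreal (std_normal_density w) * (\<integral>\<^sup>+ u. ennreal (?c w u) \<partial>unit_uniform) \<partial>lborel)"
      using U.borel_measurable_nn_integral_fst[OF cmeas2]
      by (subst nn_integral_add) (simp_all add: nn_integral_cmult)
    also have "(\<integral>\<^sup>+ w. ennreal (std_normal_density w) \<partial>lborel) = 1"
      using nn_integral_std_normal_quadratic[of 1 0] by simp
    also have "ennreal pq * 1 + (\<integral>\<^sup>+ w. ennreal (std_normal_density w) * (\<integral>\<^sup>+ u. ennreal (?c w u) \<partial>unit_uniform) \<partial>lborel)
      \<le> ennreal pq * 1 + ennreal (sqrt \<bar>r0\<bar> + 7 * (\<bar>h q\<bar> / sqrt \<bar>l q\<bar>))"
      by (intro add_left_mono reflect_coupling_cost[OF lq]) (use lq in \<open>simp add: k_def\<close>)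
    also have "\<dots> = ennreal (pq + sqrt \<bar>r0\<bar> + 7 * (\<bar>h q\<bar> / sqrt \<bar>l q\<bar>))"
      using pq0 by (simp add: ennreal_plus[symmetric] add.assoc del: ennreal_plus)
    finally show ?thesis .
  qed
  have lnz: "AE q in \<rho>. l q \<noteq> 0"
    unfolding \<rho>_def
  proof (subst AE_distr_iff[OF Qm])
    show "AE \<omega> in M. l (Q \<omega>) \<noteq> 0"
      using reflect_coupling_moment(1)[OF ind T RLm(2) dec(4)] by (simp add: l_def Q_def)
  qed measurable
  have gm': "(\<lambda>p. ennreal (cc_gauge (f p) (f' p))) \<in> borel_measurable P"
    by (intro measurable_compose[OF cc_gauge_measurable[OF fm fm'] measurable_ennreal])
  have "(\<integral>\<^sup>+ p. ennreal (cc_gauge (f p) (f' p)) \<partial>P)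
    = (\<integral>\<^sup>+ q. (\<integral>\<^sup>+ w. ennreal (std_normal_density w) * (\<integral>\<^sup>+ u. ennreal (cc_gauge (f (q, w, u)) (f' (q, w, u))) \<partial>unit_uniform) \<partial>lborel) \<partial>\<rho>)"
    unfolding P_def by (rule nn_integral_coupling_space[OF \<rho>.prob_space_axioms gm'[unfolded P_def]])
  also have "\<dots> \<le> (\<integral>\<^sup>+ q. ennreal (pq + sqrt \<bar>r0\<bar> + 7 * (\<bar>h q\<bar> / sqrt \<bar>l q\<bar>)) \<partial>\<rho>)"
  proof (rule nn_integral_mono_AE)
    show "AE q in \<rho>. (\<integral>\<^sup>+ w. ennreal (std_normal_density w) * (\<integral>\<^sup>+ u. ennreal (cc_gauge (f (q, w, u)) (f' (q, w, u))) \<partial>unit_uniform) \<partial>lborel)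
      \<le> ennreal (pq + sqrt \<bar>r0\<bar> + 7 * (\<bar>h q\<bar> / sqrt \<bar>l q\<bar>))"
      using lnz by eventually_elim (rule inner)
  qed
  also have "\<dots> = (\<integral>\<^sup>+ \<omega>. ennreal (pq + sqrt \<bar>r0\<bar> + 7 * (\<bar>h (Q \<omega>)\<bar> / sqrt \<bar>l (Q \<omega>)\<bar>)) \<partial>M)"
    unfolding \<rho>_def by (rule nn_integral_distr[OF Qm]) measurable
  also have "\<dots> = (\<integral>\<^sup>+ \<omega>. ennreal (pq + sqrt \<bar>r0\<bar>) + 7 * ennreal (\<bar>h (Q \<omega>)\<bar> / sqrt \<bar>l (Q \<omega>)\<bar>) \<partial>M)"
  proof (rule nn_integral_cong)
    fix \<omega>
    define c where "c = \<bar>h (Q \<omega>)\<bar> / sqrt \<bar>l (Q \<omega>)\<bar>"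
    have "0 \<le> c" by (simp add: c_def)
    moreover have "ennreal (7 * c) = 7 * ennreal c" using ennreal_mult'[of 7 c] by simp
    ultimately show "ennreal (pq + sqrt \<bar>r0\<bar> + 7 * (\<bar>h (Q \<omega>)\<bar> / sqrt \<bar>l (Q \<omega>)\<bar>))
      = ennreal (pq + sqrt \<bar>r0\<bar>) + 7 * ennreal (\<bar>h (Q \<omega>)\<bar> / sqrt \<bar>l (Q \<omega>)\<bar>)"
      unfolding c_def[symmetric] by (subst ennreal_plus) (simp_all add: pq_def)
  qed
  also have "\<dots> = ennreal (pq + sqrt \<bar>r0\<bar>) + 7 * (\<integral>\<^sup>+ \<omega>. ennreal (\<bar>h (Q \<omega>)\<bar> / sqrt \<bar>l (Q \<omega>)\<bar>) \<partial>M)"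
    by (subst nn_integral_add) (simp_all add: nn_integral_cmult emeasure_space_1)
  also have "\<dots> \<le> ennreal (pq + sqrt \<bar>r0\<bar>) + 7 * ennreal (28 * pq)"
    using reflect_coupling_moment(2)[OF ind T RLm(2) dec(4), of "x' - x" "y' - y"]
    by (intro add_left_mono mult_left_mono) (simp_all add: h_def Q_def b1_def b2_def l_def pq_def)
  also have "\<dots> = ennreal (pq + sqrt \<bar>r0\<bar> + 196 * pq)"
  proof -
    have "7 * ennreal (28 * pq) = ennreal (7 * (28 * pq))" by (subst ennreal_mult') simp_all
    then show ?thesis by (simp add: pq_def ennreal_plus[symmetric] del: ennreal_plus)
  qed
  also have "\<dots> \<le> ennreal (200 * cc_gauge (x, y, z) (x', y', z'))"
  proof (rule ennreal_leI)
    have "cc_gauge (x, y, z) (x', y', z') = pq + sqrt \<bar>r0\<bar>" by (simp add: pq_def r0_def)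
    moreover have "0 \<le> pq" "0 \<le> sqrt \<bar>r0\<bar>" by (simp_all add: pq_def)
    ultimately show "pq + sqrt \<bar>r0\<bar> + 196 * pq \<le> 200 * cc_gauge (x, y, z) (x', y', z')" by linarith
  qed
  finally have cost: "(\<integral>\<^sup>+ p. ennreal (cc_gauge (f p) (f' p)) \<partial>P) \<le> ennreal (200 * cc_gauge (x, y, z) (x', y', z'))" .
  have "prob_space P" unfolding P_def by (rule P.P.prob_space_axioms)
  from that[OF this fm fm' law law' _ _ cost] show thesis
    by (simp add: f_def f'_def F_def)
qed

lemma levy_area_time_zero:
  assumes ind: "independent_brownian_motions M B1 B2"
  shows "AE \<omega> in M. levy_area M B1 B2 0 \<omega> = 0"
  using area_sum_tendsto_levy_area(2)[OF ind order_refl]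
proof eventually_elim
  case (elim \<omega>)
  have "area_sum 0 n (\<lambda>s. B1 s \<omega>) (\<lambda>s. B2 s \<omega>) = 0" for n by (simp add: area_sum_def)
  with elim show ?case by (simp add: LIMSEQ_const_iff)
qed

theorem theorem1p10:
  shows "\<exists>C>0::real. \<forall>(M::'w measure) B1 B2. independent_brownian_motions M B1 B2 \<longrightarrow>
    (\<forall>t\<ge>0. \<forall>x y z x' y' z' :: real.
      \<exists>(N :: (heis \<times> heis) measure) X Y Z X' Y' Z'.
        prob_space N \<and>
        X \<in> borel_measurable N \<and> Y \<in> borel_measurable N \<and> Z \<in> borel_measurable N \<and>
        X' \<in> borel_measurable N \<and> Y' \<in> borel_measurable N \<and> Z' \<in> borel_measurable N \<and>
        distr N borel (\<lambda>\<omega>. (X \<omega>, Y \<omega>, Z \<omega>)) = heis_law M B1 B2 (x, y, z) t \<and>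
        distr N borel (\<lambda>\<omega>. (X' \<omega>, Y' \<omega>, Z' \<omega>)) = heis_law M B1 B2 (x', y', z') t \<and>
        W1_dist (heis_law M B1 B2 (x, y, z) t) (heis_law M B1 B2 (x', y', z') t)
          \<le> (\<integral>\<^sup>+ \<omega>. ennreal (cc_dist (X \<omega>, Y \<omega>, Z \<omega>) (X' \<omega>, Y' \<omega>, Z' \<omega>)) \<partial>N) \<and>
        (\<integral>\<^sup>+ \<omega>. ennreal (cc_dist (X \<omega>, Y \<omega>, Z \<omega>) (X' \<omega>, Y' \<omega>, Z' \<omega>)) \<partial>N)
          \<le> ennreal (C * cc_dist (x, y, z) (x', y', z')) \<and>
        (AE \<omega> in N. X' \<omega> = X \<omega> + (x' - x)) \<and>
        (AE \<omega> in N. Y' \<omega> = Y \<omega> + (y' - y)))"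
proof (intro exI[of _ "162000 :: real"] conjI allI impI, goal_cases)
  case (2 M B1 B2 t x y z x' y' z')
  note ind = 2(1) and t = 2(2)
  show ?case
  proof (cases "t = 0")
    case False
    then have T: "t > 0" using t by simp
    show ?thesis
      by (rule heis_coupling_positive_time[OF ind T, of x y z x' y' z']) (rule coupling_from_gauge_bound)
  next
    \<comment> \<open>At time 0 the tent degenerates. Both processes sit almost surely at their
      starting points, so \<open>M\<close> itself serves as the coupling space.\<close>
    case t0: True
    have bm: "standard_brownian_motion M B1" "standard_brownian_motion M B2"
      using ind by (auto simp: independent_brownian_motions_def)
    then interpret prob_space M by (simp add: standard_brownian_motion_def)
    have [measurable]: "B1 t \<in> borel_measurable M" "B2 t \<in> borel_measurable M" "levy_area M B1 B2 t \<in> borel_measurable M"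
      using bm t area_sum_tendsto_levy_area(1)[OF ind t] by (auto simp: standard_brownian_motion_def)
    have fm: "heis_brownian_motion M B1 B2 a t \<in> borel_measurable M" for a
      unfolding heis_brownian_motion_def[abs_def] by (intro heis_mult_measurable borel_measurable_Pair) measurable
    have zero: "AE \<omega> in M. B1 t \<omega> = 0" "AE \<omega> in M. B2 t \<omega> = 0" "AE \<omega> in M. levy_area M B1 B2 t \<omega> = 0"
      using bm levy_area_time_zero[OF ind] by (auto simp: standard_brownian_motion_def t0)
    show ?thesis
    proof (rule coupling_from_gauge_bound[OF prob_space_axioms fm fm])
      have "(\<integral>\<^sup>+ \<omega>. ennreal (cc_gauge (heis_brownian_motion M B1 B2 (x, y, z) t \<omega>) (heis_brownian_motion M B1 B2 (x', y', z') t \<omega>)) \<partial>M)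
        = (\<integral>\<^sup>+ \<omega>. ennreal (cc_gauge (x, y, z) (x', y', z')) \<partial>M)"
      proof (rule nn_integral_cong_AE)
        show "AE \<omega> in M. ennreal (cc_gauge (heis_brownian_motion M B1 B2 (x, y, z) t \<omega>) (heis_brownian_motion M B1 B2 (x', y', z') t \<omega>))
          = ennreal (cc_gauge (x, y, z) (x', y', z'))"
          using zero by eventually_elim (simp add: heis_brownian_motion_def)
      qed
      also have "\<dots> \<le> ennreal (200 * cc_gauge (x, y, z) (x', y', z'))"
        using cc_gauge_nonneg[of "(x, y, z)" "(x', y', z')"] by (simp add: emeasure_space_1 ennreal_leI del: cc_gauge.simps)
      finally show "(\<integral>\<^sup>+ \<omega>. ennreal (cc_gauge (heis_brownian_motion M B1 B2 (x, y, z) t \<omega>) (heis_brownian_motion M B1 B2 (x', y', z') t \<omega>)) \<partial>M)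
        \<le> ennreal (200 * cc_gauge (x, y, z) (x', y', z'))" .
    qed (simp_all add: heis_law_def heis_brownian_motion_def)
  qed
qed simp

end
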